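(* Let $M_n$ be drawn from the real or complex gaussian ensemble. Then for any fixed $C > 0$, and any $z_0 \in B(0,C)$, $\log |\det(M_n - z_0 \sqrt{n})|$ concentrates around $\frac{1}{2} n \log n + \frac{1}{2} n (|z_0|^2 - 1)$ for $|z_0| \leq 1$ and around $\frac{1}{2} n \log n + n \log |z_0|$ for $|z_0| \geq 1$, uniformly in $z_0$.
   Context: Conventions: $n$ is a natural number parameter going to infinity; a quantity is fixed if it does not depend on $n$; $X = O(Y)$ means $|X| \leq C'Y$ for some fixed $C'$. $B(z_0,r)=\{z\in\mathbb{C}:|z-z_0|<r\}$. $M_n - z$ means $M_n - zI$. A random variable $X$ depending on $n$ concentrates around a deterministic scalar $M$ (depending on $n$) if for every fixed $\varepsilon,A>0$ one has $X = M + O(n^{\varepsilon})$ outside of an event of probability $O(n^{-A})$. Uniformly in $z_0$ means that the implied constants (for each $\varepsilon,A$) can be taken independent of $z_0\in B(0,C)$. The real gaussian ensemble consists of $n\times n$ random matrices with iid $N(0,1)_{\mathbb{R}}$ entries; the complex gaussian ensemble consists of $n\times n$ random matrices with iid entries of density $\frac{1}{\pi} e^{-|z|^2}$ on $\mathbb{C}$. *)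

theory Defs
  imports "HOL-Probability.Probability" "Jordan_Normal_Form.Determinant"
begin

definition real_gaussian :: "complex measure" where
  "real_gaussian = distr (density lborel (\<lambda>x. ennreal (normal_density 0 1 x))) borel complex_of_real"

definition complex_gaussian :: "complex measure" where
  "complex_gaussian = density lborel (\<lambda>z. ennreal (1 / pi * exp (- (cmod z)\<^sup>2)))"

definition iid_matrix :: "complex measure \<Rightarrow> nat \<Rightarrow> 'a measure \<Rightarrow> ('a \<Rightarrow> complex mat) \<Rightarrow> bool" where
  "iid_matrix \<mu> n P M \<longleftrightarrow>
     prob_space P \<and>
     (\<forall>\<omega>\<in>space P. M \<omega> \<in> carrier_mat n n) \<and>
     prob_space.indep_vars P (\<lambda>_. borel) (\<lambda>(i, j) \<omega>. M \<omega> $$ (i, j)) ({..<n} \<times> {..<n}) \<and>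
     (\<forall>i<n. \<forall>j<n. distr P borel (\<lambda>\<omega>. M \<omega> $$ (i, j)) = \<mu>)"

abbreviation real_gaussian_ensemble :: "nat \<Rightarrow> 'a measure \<Rightarrow> ('a \<Rightarrow> complex mat) \<Rightarrow> bool" where
  "real_gaussian_ensemble \<equiv> iid_matrix real_gaussian"

abbreviation complex_gaussian_ensemble :: "nat \<Rightarrow> 'a measure \<Rightarrow> ('a \<Rightarrow> complex mat) \<Rightarrow> bool" where
  "complex_gaussian_ensemble \<equiv> iid_matrix complex_gaussian"

text \<open>In HOL \<open>ln 0\<close> is a real number. The extended logarithm below makes a vanishing
  determinant violate any concentration bound, instead of satisfying it by accident.\<close>

definition ln_cmod :: "complex \<Rightarrow> ereal" where
  "ln_cmod w = (if w = 0 then -\<infinity> else ereal (ln (cmod w)))"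

text \<open>The constants \<open>K\<close> and \<open>L\<close> witness \<open>O(n\<^sup>\<epsilon>)\<close> and \<open>O(n\<^sup>-\<^sup>A)\<close>; uniformity over \<open>S\<close> means
  that they are chosen before \<open>z\<close>, while the exceptional event \<open>E\<close> may depend on \<open>n\<close> and \<open>z\<close>.\<close>

definition concentrates_uniformly_on ::
    "'b set \<Rightarrow> (nat \<Rightarrow> 'a measure) \<Rightarrow> (nat \<Rightarrow> 'b \<Rightarrow> 'a \<Rightarrow> ereal) \<Rightarrow> (nat \<Rightarrow> 'b \<Rightarrow> real) \<Rightarrow> bool" where
  "concentrates_uniformly_on S P X m \<longleftrightarrow>
     (\<forall>\<epsilon>>0. \<forall>A>0. \<exists>K L :: real. \<forall>n\<ge>1. \<forall>z\<in>S.
        \<exists>E\<in>sets (P n). measure (P n) E \<le> L * real n powr (- A) \<and>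
          (\<forall>\<omega>\<in>space (P n) - E. \<bar>X n z \<omega> - ereal (m n z)\<bar> \<le> ereal (K * real n powr \<epsilon>)))"

end

theory Submission
  imports Defs "HOL-Real_Asymp.Real_Asymp"
begin

text \<open>
  Write \<open>A = G - w\<close> with \<open>G\<close> the Gaussian matrix, \<open>w = z sqrt n\<close> and \<open>\<rho> = |z|^2\<close>. Both claimed centres equal
  half the logarithm of \<open>W = (n / (e c))^n\<close>, where \<open>c\<close> is the maximum of \<open>t exp (- \<rho> t)\<close> over
  \<open>0 \<le> t \<le> 1\<close>: it is \<open>exp (- \<rho>)\<close> for \<open>\<rho> \<le> 1\<close> and \<open>1 / (e \<rho>)\<close> for \<open>\<rho> \<ge> 1\<close>. It is enough to show that
  \<open>|det A|^2\<close> lies within a polynomial factor of \<open>W\<close>, because a polynomial factor costs only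
  \<open>O (ln n)\<close> in the logarithm. Each side follows from one moment and Markov's inequality.

  The upper bound uses \<open>E |det A|^2\<close>. The permutation products in the Leibniz expansion are
  orthogonal (\<open>permutation_products_orthogonal\<close>), so the moment is the sum over permutations of
  \<open>(1 + |w|^2)\<close> to the number of fixed points, that is \<open>n! (\<Sum>k\<le>n. |w|^(2k) / k!)\<close>, and this is at most a
  polynomial times \<open>W\<close>.

  The lower bound uses a regularised moment of order \<open>-2\<close>. Since
  \<open>|det A|^(-2)\<close> is \<open>pi^(-n)\<close> times the integral of \<open>exp (- |A v|^2)\<close> over \<open>v\<close> in \<open>C^n\<close>
  (\<open>nn_integral_gauss_image\<close>), its mean can be found by averaging over \<open>G\<close> inside the integral, where
  the rows of \<open>A v\<close> are independent Gaussian variables. The averaged kernel is at most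
  \<open>(c^2 / (4 D))^q\<close> for every \<open>q \<le> n / 2\<close>, where \<open>D\<close> is the Gram determinant of the real and imaginary
  parts of \<open>v\<close> (\<open>kernel_bound_real\<close>, \<open>kernel_bound_complex\<close>). The exponent \<open>q = n / 2\<close> would produce
  \<open>1 / W\<close>, but the integral over \<open>v\<close> diverges both at \<open>D = 0\<close> and at infinity. Taking
  \<open>q\<close> slightly below \<open>n / 2 - 1\<close> cures the first problem, and an extra factor \<open>exp (- \<delta> |v|^2)\<close> with
  \<open>\<delta>\<close> polynomially small cures the second; both cost polynomial factors only
  (\<open>nn_integral_gamma_kernel_gram_det\<close>, \<open>expected_regularised_integral\<close>). The extra factor in turn
  changes the integral by at most a constant factor when the entries of the inverse of \<open>A\<close> are
  polynomially bounded (\<open>nn_integral_regularised_ge\<close>). That happens with high probability, because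
  the determinant is an affine function of each single entry with the cofactor as slope
  (\<open>cofactor_over_det_tail\<close>).

  The real and the complex ensemble enter only through a few properties of the law of one entry,
  collected in the locale \<open>gaussian_kernel_law\<close>.
\<close>

section \<open>Gaussian integrals over the complex plane\<close>

abbreviation lborel_pow :: "'i set \<Rightarrow> ('i \<Rightarrow> 'a::euclidean_space) measure" where
  "lborel_pow J \<equiv> PiM J (\<lambda>i. lborel)"

lemma lborel_complex_eq:
  "(lborel :: complex measure) = distr (lborel \<Otimes>\<^sub>M lborel) borel (\<lambda>(x, y). Complex x y)"
proof (rule lborel_eqI)
  have [measurable]: "(\<lambda>(x, y). Complex x y) \<in> borel_measurable (lborel \<Otimes>\<^sub>M lborel)"
    by (simp add: Complex_eq[abs_def] case_prod_beta)
  fix l u :: complex assume le: "\<And>b. b \<in> Basis \<Longrightarrow> l \<bullet> b \<le> u \<bullet> b"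
  have le': "Re l \<le> Re u" "Im l \<le> Im u"
    using le[of 1] le[of \<i>] by (auto simp: Basis_complex_def inner_complex_def)
  have v: "(\<lambda>(x, y). Complex x y) -` box l u = {Re l<..<Re u} \<times> {Im l<..<Im u}"
    by (auto simp: box_def Basis_complex_def inner_complex_def)
  have "emeasure (distr (lborel \<Otimes>\<^sub>M lborel) borel (\<lambda>(x, y). Complex x y)) (box l u)
      = emeasure (lborel \<Otimes>\<^sub>M lborel) ({Re l<..<Re u} \<times> {Im l<..<Im u})"
    by (subst emeasure_distr) (simp_all add: v space_pair_measure)
  also have "\<dots> = ennreal (Re u - Re l) * ennreal (Im u - Im l)"
    using le' by (subst lborel.emeasure_pair_measure_Times) simp_all
  also have "\<dots> = (\<Prod>b\<in>Basis. (u - l) \<bullet> b)"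
    using le' by (simp add: Basis_complex_def inner_complex_def ennreal_mult)
  finally show "emeasure (distr (lborel \<Otimes>\<^sub>M lborel) borel (\<lambda>(x, y). Complex x y)) (box l u)
      = (\<Prod>b\<in>Basis. (u - l) \<bullet> b)" .
qed simp

lemma nn_integral_lborel_complex:
  fixes f :: "complex \<Rightarrow> ennreal"
  assumes [measurable]: "f \<in> borel_measurable borel"
  shows "(\<integral>\<^sup>+z. f z \<partial>lborel) = (\<integral>\<^sup>+x. \<integral>\<^sup>+y. f (Complex x y) \<partial>lborel \<partial>lborel)"
proof -
  have [measurable]: "(\<lambda>(x, y). Complex x y) \<in> borel_measurable (lborel \<Otimes>\<^sub>M lborel)"
    by (simp add: Complex_eq[abs_def] case_prod_beta)
  have "(\<integral>\<^sup>+z. f z \<partial>lborel) = (\<integral>\<^sup>+z. f (case z of (x, y) \<Rightarrow> Complex x y) \<partial>(lborel \<Otimes>\<^sub>M lborel))"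
    by (subst lborel_complex_eq) (simp add: nn_integral_distr)
  also have "\<dots> = (\<integral>\<^sup>+x. \<integral>\<^sup>+y. f (Complex x y) \<partial>lborel \<partial>lborel)"
    by (subst lborel.nn_integral_fst[symmetric]) (simp_all add: case_prod_beta Complex_eq[abs_def])
  finally show ?thesis .
qed

text \<open>The linear term is kept because the later computations complete squares with it; its coefficient
  is written \<open>2 l\<close> so that the exponent on the right is just \<open>l^2 / k\<close>.\<close>
lemma nn_integral_gauss_real:
  fixes k l :: real
  assumes "k > 0"
  shows "(\<integral>\<^sup>+x. ennreal (exp (- k * x\<^sup>2 + 2 * l * x)) \<partial>lborel) = ennreal (sqrt (pi / k) * exp (l\<^sup>2 / k))"
proof -
  define s where "s = sqrt (1 / (2 * k))"
  have s: "s > 0" "s\<^sup>2 = 1 / (2 * k)" using assms by (auto simp: s_def)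
  have "exp (- k * x\<^sup>2 + 2 * l * x) = sqrt (pi / k) * exp (l\<^sup>2 / k) * normal_density (l / k) s x" for x
  proof -
    have "- k * x\<^sup>2 + 2 * l * x = l\<^sup>2 / k + (- (x - l / k)\<^sup>2 / (2 * s\<^sup>2))"
      using assms unfolding s by (simp add: field_simps power2_eq_square)
    moreover have "2 * pi * s\<^sup>2 = pi / k" unfolding s by simp
    ultimately show ?thesis
      using assms by (simp only: normal_density_def exp_add) simp
  qed
  then have "(\<integral>\<^sup>+x. ennreal (exp (- k * x\<^sup>2 + 2 * l * x)) \<partial>lborel)
      = ennreal (sqrt (pi / k) * exp (l\<^sup>2 / k)) * (\<integral>\<^sup>+x. normal_density (l / k) s x \<partial>lborel)"
    using assms by (simp add: ennreal_mult nn_integral_cmult)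
  also have "(\<integral>\<^sup>+x. normal_density (l / k) s x \<partial>lborel) = 1"
    using prob_space.emeasure_space_1[OF prob_space_normal_density[OF s(1), of "l / k"]]
    by (simp add: emeasure_density)
  finally show ?thesis by simp
qed

lemma nn_integral_gauss_complex:
  fixes a :: complex and k :: real
  assumes "k > 0"
  shows "(\<integral>\<^sup>+z. ennreal (exp (- k * (cmod (z + a))\<^sup>2)) \<partial>lborel) = ennreal (pi / k)"
proof -
  have "(\<integral>\<^sup>+z. ennreal (exp (- k * (cmod (z + a))\<^sup>2)) \<partial>lborel)
      = (\<integral>\<^sup>+z. ennreal (exp (- k * (cmod z)\<^sup>2)) \<partial>distr lborel borel ((+) a))"
    by (simp add: nn_integral_distr add.commute)
  also have "\<dots> = (\<integral>\<^sup>+x. \<integral>\<^sup>+y. ennreal (exp (- k * (cmod (Complex x y))\<^sup>2)) \<partial>lborel \<partial>lborel)"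
    by (simp add: lborel_distr_plus nn_integral_lborel_complex)
  also have "\<dots> = (\<integral>\<^sup>+x. \<integral>\<^sup>+y. ennreal (exp (- k * x\<^sup>2 + 2 * 0 * x)) * ennreal (exp (- k * y\<^sup>2 + 2 * 0 * y)) \<partial>lborel \<partial>lborel)"
    by (intro nn_integral_cong)
       (simp add: cmod_power2 ennreal_mult[symmetric] exp_add[symmetric] algebra_simps)
  also have "\<dots> = ennreal (sqrt (pi / k)) * ennreal (sqrt (pi / k))"
    using nn_integral_gauss_real[OF assms, of 0] by (simp add: nn_integral_cmult nn_integral_multc)
  also have "\<dots> = ennreal (pi / k)"
    using assms by (simp add: ennreal_mult[symmetric])
  finally show ?thesis .
qed

section \<open>Integrating out one Gaussian row\<close>

lemma sets_real_gaussian [measurable_cong, simp]: "sets real_gaussian = sets borel"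
  and sets_complex_gaussian [measurable_cong, simp]: "sets complex_gaussian = sets borel"
  by (simp_all add: real_gaussian_def complex_gaussian_def)

lemma nn_integral_real_gaussian:
  assumes [measurable]: "f \<in> borel_measurable borel"
  shows "(\<integral>\<^sup>+z. f z \<partial>real_gaussian) = (\<integral>\<^sup>+x. ennreal (std_normal_density x) * f (complex_of_real x) \<partial>lborel)"
  by (simp add: real_gaussian_def nn_integral_distr nn_integral_density)

lemma nn_integral_complex_gaussian:
  assumes [measurable]: "f \<in> borel_measurable borel"
  shows "(\<integral>\<^sup>+z. f z \<partial>complex_gaussian) = (\<integral>\<^sup>+z. ennreal (1 / pi * exp (- (cmod z)\<^sup>2)) * f z \<partial>lborel)"
  by (simp add: complex_gaussian_def nn_integral_density)

lemma prob_space_real_gaussian: "prob_space real_gaussian"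
  unfolding real_gaussian_def
  by (intro prob_space.prob_space_distr prob_space_normal_density) simp_all

lemma prob_space_complex_gaussian: "prob_space complex_gaussian"
proof
  have "emeasure complex_gaussian (space complex_gaussian) = (\<integral>\<^sup>+z. 1 \<partial>complex_gaussian)"
    by simp
  also have "\<dots> = ennreal (1 / pi) * (\<integral>\<^sup>+z. ennreal (exp (- 1 * (cmod (z + 0))\<^sup>2)) \<partial>lborel)"
    by (subst nn_integral_complex_gaussian, simp, subst nn_integral_cmult[symmetric], simp)
       (simp only: ennreal_mult[symmetric] exp_ge_zero divide_nonneg_pos zero_le_one pi_gt_zero mult_1_right
          add_0_right minus_mult_left mult_1_left mult_minus1)
  also have "\<dots> = 1"
    by (subst nn_integral_gauss_complex) (simp_all add: ennreal_mult[symmetric])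
  finally show "emeasure complex_gaussian (space complex_gaussian) = 1" .
qed

text \<open>The quadratic form of the inverse of the symmetric matrix with rows \<open>(\<alpha>, \<beta>)\<close> and \<open>(\<beta>, \<gamma>)\<close>,
  evaluated at the vector \<open>(Re b, Im b)\<close>.\<close>
definition inv_form :: "real \<Rightarrow> real \<Rightarrow> real \<Rightarrow> complex \<Rightarrow> real" where
  "inv_form \<alpha> \<beta> \<gamma> b = (\<gamma> * (Re b)\<^sup>2 - 2 * \<beta> * Re b * Im b + \<alpha> * (Im b)\<^sup>2) / (\<alpha> * \<gamma> - \<beta>\<^sup>2)"

text \<open>This is \<open>2 \<times> 2\<close> positive semidefiniteness; multiplication by \<open>\<alpha>\<close> turns the form into a sum of squares.\<close>
lemma pos_form_nonneg:
  fixes \<alpha> \<beta> \<gamma> x y :: real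
  assumes "\<alpha> > 0" "\<alpha> * \<gamma> - \<beta>\<^sup>2 > 0"
  shows "\<gamma> * x\<^sup>2 - 2 * \<beta> * x * y + \<alpha> * y\<^sup>2 \<ge> 0"
proof -
  have "\<alpha> * (\<gamma> * x\<^sup>2 - 2 * \<beta> * x * y + \<alpha> * y\<^sup>2) = (\<alpha> * \<gamma> - \<beta>\<^sup>2) * x\<^sup>2 + (\<beta> * x - \<alpha> * y)\<^sup>2"
    by (simp add: power2_eq_square algebra_simps)
  also have "\<dots> \<ge> 0" using assms by simp
  finally show ?thesis using assms(1) by (simp add: zero_le_mult_iff)
qed

lemma borel_measurable_inv_form [measurable]: "inv_form \<alpha> \<beta> \<gamma> \<in> borel_measurable borel"
  unfolding inv_form_def[abs_def] by measurable

text \<open>A real Gaussian multiple of a fixed vector has rank one covariance. Averaging the kernel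
  \<open>exp (- b\<^sup>T S\<inverse> b)\<close> over it again gives such a kernel, with \<open>S\<close> replaced by \<open>S + 2 v v\<^sup>T\<close>; this is the
  Sherman-Morrison formula together with the matrix determinant lemma. A whole row of real entries
  can therefore be integrated out one entry at a time.\<close>
lemma nn_integral_real_gaussian_inv_form:
  fixes \<alpha> \<beta> \<gamma> :: real and v :: complex
  assumes "\<alpha> > 0" and d: "\<alpha> * \<gamma> - \<beta>\<^sup>2 > 0"
  defines "\<alpha>' \<equiv> \<alpha> + 2 * (Re v)\<^sup>2" and "\<beta>' \<equiv> \<beta> + 2 * Re v * Im v" and "\<gamma>' \<equiv> \<gamma> + 2 * (Im v)\<^sup>2"
  shows "(\<integral>\<^sup>+g. ennreal (exp (- inv_form \<alpha> \<beta> \<gamma> (g * v + b))) \<partial>real_gaussian)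
      = ennreal (sqrt ((\<alpha> * \<gamma> - \<beta>\<^sup>2) / (\<alpha>' * \<gamma>' - \<beta>'\<^sup>2)) * exp (- inv_form \<alpha>' \<beta>' \<gamma>' b))"
    and "\<alpha>' > 0" and "\<alpha>' * \<gamma>' - \<beta>'\<^sup>2 > 0"
proof -
  define d where "d = \<alpha> * \<gamma> - \<beta>\<^sup>2"
  define N where "N = \<gamma> * (Re v)\<^sup>2 - 2 * \<beta> * Re v * Im v + \<alpha> * (Im v)\<^sup>2"
  define L where "L = \<gamma> * Re v * Re b - \<beta> * (Re v * Im b + Im v * Re b) + \<alpha> * Im v * Im b"
  have dp: "d > 0" using d by (simp add: d_def)
  have N: "N \<ge> 0" unfolding N_def by (rule pos_form_nonneg[OF assms(1,2)])
  have d': "\<alpha>' * \<gamma>' - \<beta>'\<^sup>2 = d + 2 * N"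
    by (simp add: d_def N_def \<alpha>'_def \<beta>'_def \<gamma>'_def power2_eq_square algebra_simps)
  show "\<alpha>' > 0" using assms(1) by (simp add: \<alpha>'_def add_pos_nonneg)
  show "\<alpha>' * \<gamma>' - \<beta>'\<^sup>2 > 0" using dp N d' by simp
  define k where "k = 1 / 2 + N / d"
  have k: "k > 0" using dp N by (simp add: k_def add_pos_nonneg)
  have k': "k = (d + 2 * N) / (2 * d)" using dp by (simp add: k_def field_simps)
  have e: "inv_form \<alpha> \<beta> \<gamma> (complex_of_real g * v + b) = N / d * g\<^sup>2 + 2 * (L / d) * g + inv_form \<alpha> \<beta> \<gamma> b" for g
    unfolding inv_form_def d_def[symmetric] N_def L_def using dp
    by (simp add: divide_simps) (simp add: power2_eq_square algebra_simps)
  have "(\<integral>\<^sup>+g. ennreal (exp (- inv_form \<alpha> \<beta> \<gamma> (g * v + b))) \<partial>real_gaussian)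
    = (\<integral>\<^sup>+g. ennreal (exp (- inv_form \<alpha> \<beta> \<gamma> b) / sqrt (2 * pi)) * ennreal (exp (- k * g\<^sup>2 + 2 * (- L / d) * g)) \<partial>lborel)"
  proof (subst nn_integral_real_gaussian, simp, intro nn_integral_cong)
    fix g :: real
    have "exp (- g\<^sup>2 / 2) * exp (- inv_form \<alpha> \<beta> \<gamma> (g * v + b)) = exp (- inv_form \<alpha> \<beta> \<gamma> b) * exp (- k * g\<^sup>2 + 2 * (- L / d) * g)"
      unfolding exp_add[symmetric] e by (simp add: k_def algebra_simps)
    then show "ennreal (std_normal_density g) * ennreal (exp (- inv_form \<alpha> \<beta> \<gamma> (g * v + b)))
      = ennreal (exp (- inv_form \<alpha> \<beta> \<gamma> b) / sqrt (2 * pi)) * ennreal (exp (- k * g\<^sup>2 + 2 * (- L / d) * g))"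
      by (simp add: std_normal_density_def ennreal_mult[symmetric])
  qed
  also have "\<dots> = ennreal (exp (- inv_form \<alpha> \<beta> \<gamma> b) / sqrt (2 * pi) * (sqrt (pi / k) * exp ((- L / d)\<^sup>2 / k)))"
    by (subst nn_integral_cmult, simp, subst nn_integral_gauss_real[OF k], subst ennreal_mult[symmetric])
       (use k in simp_all)
  also have "exp (- inv_form \<alpha> \<beta> \<gamma> b) / sqrt (2 * pi) * (sqrt (pi / k) * exp ((- L / d)\<^sup>2 / k))
      = sqrt (d / (d + 2 * N)) * exp (- inv_form \<alpha>' \<beta>' \<gamma>' b)"
  proof -
    have 1: "sqrt (pi / k) / sqrt (2 * pi) = sqrt (d / (d + 2 * N))"
      using dp N by (simp add: real_sqrt_divide[symmetric] k' del: real_sqrt_divide) (simp add: field_simps)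
    \<comment> \<open>Lagrange's identity for the form of \<open>S\<inverse>\<close>.\<close>
    have key: "L\<^sup>2 = (\<gamma> * (Re b)\<^sup>2 - 2 * \<beta> * Re b * Im b + \<alpha> * (Im b)\<^sup>2) * N - d * (Re v * Im b - Im v * Re b)\<^sup>2"
      by (simp add: L_def N_def d_def power2_eq_square algebra_simps)
    have 2: "- inv_form \<alpha> \<beta> \<gamma> b + (- L / d)\<^sup>2 / k = - inv_form \<alpha>' \<beta>' \<gamma>' b"
    proof -
      define F W where "F = \<gamma> * (Re b)\<^sup>2 - 2 * \<beta> * Re b * Im b + \<alpha> * (Im b)\<^sup>2"
        and "W = (Re v * Im b - Im v * Re b)\<^sup>2"
      have "inv_form \<alpha>' \<beta>' \<gamma>' b = (F + 2 * W) / (d + 2 * N)"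
        unfolding inv_form_def d' F_def W_def
        by (simp add: \<alpha>'_def \<beta>'_def \<gamma>'_def power2_eq_square algebra_simps)
      moreover have "(- L / d)\<^sup>2 / k = (F * N - d * W) * 2 / (d * (d + 2 * N))"
        unfolding F_def W_def key[symmetric] k' using dp N by (simp add: field_simps power2_eq_square)
      moreover have "inv_form \<alpha> \<beta> \<gamma> b = F / d"
        by (simp add: inv_form_def d_def F_def)
      moreover have "- (F / d) + (F * N - d * W) * 2 / (d * (d + 2 * N)) = - ((F + 2 * W) / (d + 2 * N))"
        using dp N by (simp add: divide_simps) (simp add: algebra_simps)
      ultimately show ?thesis by simp
    qed
    show ?thesis unfolding 1[symmetric] 2[symmetric] exp_add by simp
  qed
  finally show "(\<integral>\<^sup>+g. ennreal (exp (- inv_form \<alpha> \<beta> \<gamma> (g * v + b))) \<partial>real_gaussian)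
      = ennreal (sqrt ((\<alpha> * \<gamma> - \<beta>\<^sup>2) / (\<alpha>' * \<gamma>' - \<beta>'\<^sup>2)) * exp (- inv_form \<alpha>' \<beta>' \<gamma>' b))"
    unfolding d' d_def[symmetric] .
qed

lemma nn_integral_row_real:
  fixes u :: "'k \<Rightarrow> complex"
  assumes "finite K" "\<alpha> > 0" "\<alpha> * \<gamma> - \<beta>\<^sup>2 > 0"
  defines "\<alpha>' \<equiv> \<alpha> + 2 * (\<Sum>k\<in>K. (Re (u k))\<^sup>2)" and "\<beta>' \<equiv> \<beta> + 2 * (\<Sum>k\<in>K. Re (u k) * Im (u k))"
    and "\<gamma>' \<equiv> \<gamma> + 2 * (\<Sum>k\<in>K. (Im (u k))\<^sup>2)"
  shows "(\<integral>\<^sup>+x. ennreal (exp (- inv_form \<alpha> \<beta> \<gamma> ((\<Sum>k\<in>K. x k * u k) + b))) \<partial>PiM K (\<lambda>_. real_gaussian))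
      = ennreal (sqrt ((\<alpha> * \<gamma> - \<beta>\<^sup>2) / (\<alpha>' * \<gamma>' - \<beta>'\<^sup>2)) * exp (- inv_form \<alpha>' \<beta>' \<gamma>' b))"
    and "\<alpha>' * \<gamma>' - \<beta>'\<^sup>2 > 0"
proof -
  interpret product_prob_space "\<lambda>_::'k. real_gaussian"
    by (intro product_prob_spaceI prob_space_real_gaussian)
  have "(\<integral>\<^sup>+x. ennreal (exp (- inv_form \<alpha> \<beta> \<gamma> ((\<Sum>k\<in>K. x k * u k) + b))) \<partial>PiM K (\<lambda>_. real_gaussian))
      = ennreal (sqrt ((\<alpha> * \<gamma> - \<beta>\<^sup>2) / (\<alpha>' * \<gamma>' - \<beta>'\<^sup>2)) * exp (- inv_form \<alpha>' \<beta>' \<gamma>' b)) \<and> \<alpha>' * \<gamma>' - \<beta>'\<^sup>2 > 0"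
    using assms(1-3) unfolding \<alpha>'_def \<beta>'_def \<gamma>'_def
  proof (induction K arbitrary: \<alpha> \<beta> \<gamma> rule: finite_induct)
    case empty
    then show ?case by (subst nn_integral_empty) simp_all
  next
    case (insert k K)
    define A B G where "A = \<alpha> + 2 * (Re (u k))\<^sup>2" and "B = \<beta> + 2 * Re (u k) * Im (u k)"
      and "G = \<gamma> + 2 * (Im (u k))\<^sup>2"
    note step = nn_integral_real_gaussian_inv_form[OF insert.prems, of "u k", folded A_def B_def G_def]
    have sums: "\<alpha> + 2 * (\<Sum>k\<in>insert k K. (Re (u k))\<^sup>2) = A + 2 * (\<Sum>k\<in>K. (Re (u k))\<^sup>2)"
      "\<beta> + 2 * (\<Sum>k\<in>insert k K. Re (u k) * Im (u k)) = B + 2 * (\<Sum>k\<in>K. Re (u k) * Im (u k))"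
      "\<gamma> + 2 * (\<Sum>k\<in>insert k K. (Im (u k))\<^sup>2) = G + 2 * (\<Sum>k\<in>K. (Im (u k))\<^sup>2)"
      using insert.hyps by (simp_all add: A_def B_def G_def)
    note IH = insert.IH[OF step(2,3)]
    have s: "(\<Sum>j\<in>insert k K. (x(k := y)) j * u j) + b = y * u k + ((\<Sum>j\<in>K. x j * u j) + b)" for x y
      using insert.hyps by (simp add: algebra_simps cong: sum.cong) (intro sum.cong; auto)
    have "(\<integral>\<^sup>+x. ennreal (exp (- inv_form \<alpha> \<beta> \<gamma> ((\<Sum>k\<in>insert k K. x k * u k) + b))) \<partial>PiM (insert k K) (\<lambda>_. real_gaussian))
      = (\<integral>\<^sup>+x. \<integral>\<^sup>+y. ennreal (exp (- inv_form \<alpha> \<beta> \<gamma> (y * u k + ((\<Sum>j\<in>K. x j * u j) + b)))) \<partial>real_gaussian \<partial>PiM K (\<lambda>_. real_gaussian))"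
      by (subst product_nn_integral_insert[OF insert.hyps]) (measurable, simp only: s)
    also have "\<dots> = (\<integral>\<^sup>+x. ennreal (sqrt ((\<alpha> * \<gamma> - \<beta>\<^sup>2) / (A * G - B\<^sup>2))) * ennreal (exp (- inv_form A B G ((\<Sum>j\<in>K. x j * u j) + b))) \<partial>PiM K (\<lambda>_. real_gaussian))"
      using insert.prems step(3) by (simp add: step(1) ennreal_mult)
    also have "\<dots> = ennreal (sqrt ((\<alpha> * \<gamma> - \<beta>\<^sup>2) / (A * G - B\<^sup>2))) *
        (\<integral>\<^sup>+x. ennreal (exp (- inv_form A B G ((\<Sum>j\<in>K. x j * u j) + b))) \<partial>PiM K (\<lambda>_. real_gaussian))"
      by (rule nn_integral_cmult) measurable
    finally show ?case
      unfolding sums using IH insert.prems step(3)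
      by (simp add: ennreal_mult[symmetric] real_sqrt_divide)
  qed
  then show "(\<integral>\<^sup>+x. ennreal (exp (- inv_form \<alpha> \<beta> \<gamma> ((\<Sum>k\<in>K. x k * u k) + b))) \<partial>PiM K (\<lambda>_. real_gaussian))
      = ennreal (sqrt ((\<alpha> * \<gamma> - \<beta>\<^sup>2) / (\<alpha>' * \<gamma>' - \<beta>'\<^sup>2)) * exp (- inv_form \<alpha>' \<beta>' \<gamma>' b))"
    and "\<alpha>' * \<gamma>' - \<beta>'\<^sup>2 > 0" by simp_all
qed

text \<open>A complex Gaussian multiple of \<open>v\<close> has covariance proportional to the identity, so for complex entries a
  single scale parameter \<open>s\<close> takes the place of the matrix of the real case.\<close>
lemma nn_integral_complex_gaussian_affine:
  fixes s :: real and v b :: complex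
  assumes s: "s > 0"
  shows "(\<integral>\<^sup>+g. ennreal (exp (- (cmod (g * v + b))\<^sup>2 / s)) \<partial>complex_gaussian)
      = ennreal (s / (s + (cmod v)\<^sup>2) * exp (- (cmod b)\<^sup>2 / (s + (cmod v)\<^sup>2)))"
proof -
  define t where "t = s + (cmod v)\<^sup>2"
  have t: "t > 0" using s by (simp add: t_def add_pos_nonneg)
  have sq: "(cmod g)\<^sup>2 + (cmod (g * v + b))\<^sup>2 / s = t / s * (cmod (g + cnj v * b / t))\<^sup>2 + (cmod b)\<^sup>2 / t" for g
  proof -
    have "of_real (s * t * ((cmod g)\<^sup>2 + (cmod (g * v + b))\<^sup>2 / s)) = (of_real (t * t * (cmod (g + cnj v * b / t))\<^sup>2 + s * (cmod b)\<^sup>2) :: complex)"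
    proof -
      have tt: "complex_of_real t = of_real s + v * cnj v" by (simp add: t_def complex_norm_square[symmetric])
      have a: "of_real (t * t * (cmod (g + cnj v * b / t))\<^sup>2) = (of_real t * g + cnj v * b) * (of_real t * cnj g + v * cnj b)"
        using t by (simp only: of_real_mult complex_norm_square) (simp add: field_simps)
      have b: "of_real (s * t * ((cmod g)\<^sup>2 + (cmod (g * v + b))\<^sup>2 / s)) = of_real t * (of_real s * (g * cnj g) + (g * v + b) * (cnj g * cnj v + cnj b))"
        using s by (simp add: field_simps complex_norm_square del: of_real_power)
      show ?thesis unfolding of_real_add a b
        by (simp add: tt complex_norm_square algebra_simps del: of_real_power)
    qed
    then have "s * t * ((cmod g)\<^sup>2 + (cmod (g * v + b))\<^sup>2 / s) = t * t * (cmod (g + cnj v * b / t))\<^sup>2 + s * (cmod b)\<^sup>2"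
      using of_real_eq_iff by blast
    then show ?thesis using s t by (simp add: field_simps)
  qed
  have "(\<integral>\<^sup>+g. ennreal (exp (- (cmod (g * v + b))\<^sup>2 / s)) \<partial>complex_gaussian)
    = (\<integral>\<^sup>+g. ennreal (1 / pi * exp (- (cmod b)\<^sup>2 / t)) * ennreal (exp (- (t / s) * (cmod (g + cnj v * b / t))\<^sup>2)) \<partial>lborel)"
  proof (subst nn_integral_complex_gaussian, simp, intro nn_integral_cong)
    fix g
    have "exp (- (cmod g)\<^sup>2) * exp (- (cmod (g * v + b))\<^sup>2 / s) = exp (- (cmod b)\<^sup>2 / t) * exp (- (t / s) * (cmod (g + cnj v * b / t))\<^sup>2)"
      unfolding exp_add[symmetric] using sq[of g] by simp
    then show "ennreal (1 / pi * exp (- (cmod g)\<^sup>2)) * ennreal (exp (- (cmod (g * v + b))\<^sup>2 / s)) =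
         ennreal (1 / pi * exp (- (cmod b)\<^sup>2 / t)) * ennreal (exp (- (t / s) * (cmod (g + cnj v * b / t))\<^sup>2))"
      by (simp add: ennreal_mult[symmetric])
  qed
  also have "\<dots> = ennreal (1 / pi * exp (- (cmod b)\<^sup>2 / t)) * ennreal (pi / (t / s))"
    by (subst nn_integral_cmult, simp, subst nn_integral_gauss_complex) (use s t in simp_all)
  also have "\<dots> = ennreal (s / t * exp (- (cmod b)\<^sup>2 / t))"
    using s t by (simp add: ennreal_mult[symmetric])
  finally show ?thesis by (simp add: t_def)
qed

lemma nn_integral_row_complex:
  fixes u :: "'k \<Rightarrow> complex"
  assumes "finite K" "s > 0"
  shows "(\<integral>\<^sup>+x. ennreal (exp (- (cmod ((\<Sum>k\<in>K. x k * u k) + b))\<^sup>2 / s)) \<partial>PiM K (\<lambda>_. complex_gaussian))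
      = ennreal (s / (s + (\<Sum>k\<in>K. (cmod (u k))\<^sup>2)) * exp (- (cmod b)\<^sup>2 / (s + (\<Sum>k\<in>K. (cmod (u k))\<^sup>2))))"
proof -
  interpret product_prob_space "\<lambda>_::'k. complex_gaussian"
    by (intro product_prob_spaceI prob_space_complex_gaussian)
  show ?thesis using assms
  proof (induction K arbitrary: s rule: finite_induct)
    case empty
    then show ?case by (subst nn_integral_empty) simp_all
  next
    case (insert k K)
    define t where "t = s + (cmod (u k))\<^sup>2"
    have t: "t > 0" using insert.prems by (simp add: t_def add_pos_nonneg)
    have tK: "t + (\<Sum>k\<in>K. (cmod (u k))\<^sup>2) > 0" using t by (simp add: add_pos_nonneg sum_nonneg)
    have s: "(\<Sum>j\<in>insert k K. (x(k := y)) j * u j) + b = y * u k + ((\<Sum>j\<in>K. x j * u j) + b)" for x y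
      using insert.hyps by (simp add: algebra_simps cong: sum.cong) (intro sum.cong; auto)
    have "(\<integral>\<^sup>+x. ennreal (exp (- (cmod ((\<Sum>k\<in>insert k K. x k * u k) + b))\<^sup>2 / s)) \<partial>PiM (insert k K) (\<lambda>_. complex_gaussian))
      = (\<integral>\<^sup>+x. \<integral>\<^sup>+y. ennreal (exp (- (cmod (y * u k + ((\<Sum>j\<in>K. x j * u j) + b)))\<^sup>2 / s)) \<partial>complex_gaussian \<partial>PiM K (\<lambda>_. complex_gaussian))"
      by (subst product_nn_integral_insert[OF insert.hyps]) (measurable, simp only: s)
    also have "\<dots> = (\<integral>\<^sup>+x. ennreal (s / t) * ennreal (exp (- (cmod ((\<Sum>j\<in>K. x j * u j) + b))\<^sup>2 / t)) \<partial>PiM K (\<lambda>_. complex_gaussian))"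
      unfolding nn_integral_complex_gaussian_affine[OF insert.prems] t_def[symmetric]
      using insert.prems t by (intro nn_integral_cong) (simp add: ennreal_mult[symmetric])
    also have "\<dots> = ennreal (s / t) * (\<integral>\<^sup>+x. ennreal (exp (- (cmod ((\<Sum>j\<in>K. x j * u j) + b))\<^sup>2 / t)) \<partial>PiM K (\<lambda>_. complex_gaussian))"
      by (rule nn_integral_cmult) measurable
    finally show ?case
      unfolding insert.IH[OF t] using insert.prems t tK insert.hyps
      by (simp add: ennreal_mult[symmetric] t_def add.assoc)
  qed
qed

section \<open>The Gaussian kernel averaged over the matrix\<close>

text \<open>Distinct rows of a matrix with independent entries are independent. The rows stay indexed by
  \<open>{i} \<times> J\<close>, so that the one-row formulas apply with an arbitrary finite index set.\<close>
lemma nn_integral_prod_rows: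
  fixes v :: "'j \<Rightarrow> complex" and h :: "'i \<Rightarrow> complex \<Rightarrow> ennreal"
  assumes "prob_space \<mu>" and sets [measurable_cong]: "sets \<mu> = sets borel"
    and "finite A" and J: "finite J" and h [measurable]: "\<And>i. h i \<in> borel_measurable borel"
  shows "(\<integral>\<^sup>+x. (\<Prod>i\<in>A. h i (\<Sum>j\<in>J. x (i, j) * v j)) \<partial>PiM (A \<times> J) (\<lambda>_. \<mu>))
    = (\<Prod>i\<in>A. \<integral>\<^sup>+x. h i (\<Sum>k\<in>{i} \<times> J. x k * v (snd k)) \<partial>PiM ({i} \<times> J) (\<lambda>_. \<mu>))"
proof -
  interpret product_prob_space "\<lambda>_::'i \<times> 'j. \<mu>"
    by (intro product_prob_spaceI assms)
  have row: "(\<Sum>k\<in>{i} \<times> J. x k * v (snd k)) = (\<Sum>j\<in>J. x (i, j) * v j)" for x :: "'i \<times> 'j \<Rightarrow> complex" and i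
    by (simp add: sum.cartesian_product')
  show ?thesis using \<open>finite A\<close>
  proof (induction A rule: finite_induct)
    case empty
    then show ?case by (subst Sigma_empty1, subst nn_integral_empty) simp_all
  next
    case (insert a A)
    have split: "insert a A \<times> J = ({a} \<times> J) \<union> (A \<times> J)" by auto
    have m1: "(\<Sum>j\<in>J. merge ({a} \<times> J) (A \<times> J) (x, y) (a, j) * v j) = (\<Sum>j\<in>J. x (a, j) * v j)" for x y :: "'i \<times> 'j \<Rightarrow> complex"
      by (intro sum.cong) (auto simp: merge_def)
    have m2: "(\<Sum>j\<in>J. merge ({a} \<times> J) (A \<times> J) (x, y) (i, j) * v j) = (\<Sum>j\<in>J. y (i, j) * v j)"
      if "i \<in> A" for i and x y :: "'i \<times> 'j \<Rightarrow> complex"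
      using that insert.hyps by (intro sum.cong) (auto simp: merge_def)
    have "(\<integral>\<^sup>+x. (\<Prod>i\<in>insert a A. h i (\<Sum>j\<in>J. x (i, j) * v j)) \<partial>PiM (insert a A \<times> J) (\<lambda>_. \<mu>))
      = (\<integral>\<^sup>+x. \<integral>\<^sup>+y. (\<Prod>i\<in>insert a A. h i (\<Sum>j\<in>J. merge ({a} \<times> J) (A \<times> J) (x, y) (i, j) * v j))
           \<partial>PiM (A \<times> J) (\<lambda>_. \<mu>) \<partial>PiM ({a} \<times> J) (\<lambda>_. \<mu>))"
      unfolding split using insert.hyps J
      by (subst product_nn_integral_fold) (auto intro!: borel_measurable_prod measurable_compose[OF _ h]
          borel_measurable_sum borel_measurable_times measurable_component_singleton)
    also have "\<dots> = (\<integral>\<^sup>+x. \<integral>\<^sup>+y. h a (\<Sum>j\<in>J. x (a, j) * v j) * (\<Prod>i\<in>A. h i (\<Sum>j\<in>J. y (i, j) * v j))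
           \<partial>PiM (A \<times> J) (\<lambda>_. \<mu>) \<partial>PiM ({a} \<times> J) (\<lambda>_. \<mu>))"
      using insert.hyps by (simp add: m1 m2 cong: prod.cong)
    also have "\<dots> = (\<integral>\<^sup>+x. h a (\<Sum>j\<in>J. x (a, j) * v j) \<partial>PiM ({a} \<times> J) (\<lambda>_. \<mu>)) *
        (\<integral>\<^sup>+y. (\<Prod>i\<in>A. h i (\<Sum>j\<in>J. y (i, j) * v j)) \<partial>PiM (A \<times> J) (\<lambda>_. \<mu>))"
      by (subst nn_integral_cmult) (auto intro!: nn_integral_multc measurable_compose[OF _ h]
          borel_measurable_sum borel_measurable_times borel_measurable_prod measurable_component_singleton)
    finally show ?case using insert by (simp add: row)
  qed
qed

text \<open>The Gram determinant of the real part and the imaginary part of \<open>v\<close>.\<close>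
definition gram_det :: "nat \<Rightarrow> (nat \<Rightarrow> complex) \<Rightarrow> real" where
  "gram_det n v = (\<Sum>j<n. (Re (v j))\<^sup>2) * (\<Sum>j<n. (Im (v j))\<^sup>2) - (\<Sum>j<n. Re (v j) * Im (v j))\<^sup>2"

lemma gram_det_nonneg: "gram_det n v \<ge> 0"
  unfolding gram_det_def using Cauchy_Schwarz_ineq_sum[of "\<lambda>j. Re (v j)" "\<lambda>j. Im (v j)" "{..<n}"] by simp

text \<open>The full exponent \<open>n\<close> can be lowered to \<open>2 q\<close> because \<open>y\<close> does not exceed \<open>1\<close>; this is true even where
  \<open>c / sqrt (4 D)\<close> is large.\<close>
lemma power_le_intermediate_power:
  fixes c y D :: real
  assumes "0 \<le> y" "y \<le> 1" "y \<le> c / sqrt (4 * D)" "D > 0" "2 * q \<le> n"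
  shows "y ^ n \<le> (c\<^sup>2 / (4 * D)) ^ q"
proof -
  have "y ^ n \<le> y ^ (2 * q)" using assms by (intro power_decreasing) simp_all
  also have "\<dots> \<le> (c / sqrt (4 * D)) ^ (2 * q)" using assms by (intro power_mono) simp_all
  also have "\<dots> = (c\<^sup>2 / (4 * D)) ^ q" using assms(4) by (simp add: power_mult power_divide)
  finally show ?thesis .
qed

text \<open>In terms of the eigenvalues \<open>\<lambda>\<^sub>1, \<lambda>\<^sub>2\<close> of the Gram matrix one has \<open>\<tau> = \<lambda>\<^sub>1 + \<lambda>\<^sub>2\<close> and \<open>D = \<lambda>\<^sub>1 \<lambda>\<^sub>2\<close>, and with
  \<open>t\<^sub>i = 2 \<lambda>\<^sub>i / (1 + 2 \<lambda>\<^sub>i)\<close> the exponent contains the arithmetic mean of \<open>t\<^sub>1\<close> and \<open>t\<^sub>2\<close>. Replacing it by their geometric mean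
  \<open>t\<close> leaves \<open>t exp (- \<rho> t) / sqrt (4 D)\<close>, which is where the constant \<open>c\<close> comes from.\<close>
lemma kernel_factor_bound:
  fixes \<tau> D \<rho> c :: real
  assumes D: "D > 0" "4 * D \<le> \<tau>\<^sup>2" "\<tau> \<ge> 0" and "\<rho> \<ge> 0"
    and c: "\<And>t. 0 \<le> t \<Longrightarrow> t \<le> 1 \<Longrightarrow> t * exp (- \<rho> * t) \<le> c"
  shows "sqrt (1 / (1 + 2 * \<tau> + 4 * D)) * exp (- \<rho> * ((\<tau> + 4 * D) / (1 + 2 * \<tau> + 4 * D))) \<le> c / sqrt (4 * D)"
proof -
  define Q where "Q = 1 + 2 * \<tau> + 4 * D"
  have Q: "Q > 0" "4 * D \<le> Q" using D by (simp_all add: Q_def)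
  define t where "t = sqrt (4 * D / Q)"
  have t: "0 \<le> t" "t \<le> 1" using D Q by (simp_all add: t_def)
  have "t \<le> (\<tau> + 4 * D) / Q"
  proof -
    have "4 * D * Q = 4 * D + 8 * D * \<tau> + 16 * D\<^sup>2" by (simp add: Q_def power2_eq_square algebra_simps)
    also have "\<dots> \<le> (\<tau> + 4 * D)\<^sup>2" using D by (simp add: power2_eq_square algebra_simps)
    finally have "4 * D / Q \<le> ((\<tau> + 4 * D) / Q)\<^sup>2" using Q by (simp add: field_simps power2_eq_square)
    then show ?thesis unfolding t_def using D Q by (intro real_le_lsqrt) simp_all
  qed
  then have "exp (- \<rho> * ((\<tau> + 4 * D) / Q)) \<le> exp (- \<rho> * t)"
    using mult_left_mono[OF _ \<open>\<rho> \<ge> 0\<close>] by fastforce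
  then have "sqrt (1 / Q) * exp (- \<rho> * ((\<tau> + 4 * D) / Q)) \<le> sqrt (1 / Q) * exp (- \<rho> * t)"
    using Q by (intro mult_left_mono) simp_all
  also have "\<dots> = t * exp (- \<rho> * t) / sqrt (4 * D)"
    using D Q by (simp add: t_def real_sqrt_divide)
  also have "\<dots> \<le> c / sqrt (4 * D)" using c[OF t] D by (intro divide_right_mono) simp_all
  finally show ?thesis by (simp add: Q_def)
qed

text \<open>For each \<open>i\<close> the row contributes \<open>sqrt (1 / Q) exp (- F (w v\<^sub>i))\<close>, where \<open>F\<close> is the form of the inverse of \<open>1 + 2 \<Sigma>\<close> and
  \<open>\<Sigma>\<close> is the Gram matrix of the real and imaginary parts of \<open>v\<close>. Multiplication by \<open>w\<close> rotates the plane, so the sum of the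
  exponents depends on the angle between \<open>\<Sigma>\<close> and its rotated copy; it is smallest when the two are aligned.\<close>
lemma kernel_bound_real:
  fixes v :: "nat \<Rightarrow> complex" and w :: complex and c \<rho> :: real
  assumes D: "gram_det n v > 0" and w: "(cmod w)\<^sup>2 = real n * \<rho>" and "\<rho> \<ge> 0"
    and c: "\<And>t. 0 \<le> t \<Longrightarrow> t \<le> 1 \<Longrightarrow> t * exp (- \<rho> * t) \<le> c" "c > 0" and q: "2 * q \<le> n"
  shows "(\<integral>\<^sup>+x. ennreal (exp (- (\<Sum>i<n. (cmod ((\<Sum>j<n. x (i, j) * v j) - w * v i))\<^sup>2)))
            \<partial>PiM ({..<n} \<times> {..<n}) (\<lambda>_. real_gaussian)) \<le> ennreal ((c\<^sup>2 / (4 * gram_det n v)) ^ q)"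
proof -
  define a b g where "a = (\<Sum>j<n. (Re (v j))\<^sup>2)" and "b = (\<Sum>j<n. Re (v j) * Im (v j))"
    and "g = (\<Sum>j<n. (Im (v j))\<^sup>2)"
  define Q where "Q = 1 + 2 * (a + g) + 4 * gram_det n v"
  have ag: "a \<ge> 0" "g \<ge> 0" by (simp_all add: a_def g_def sum_nonneg)
  have Dabg: "gram_det n v = a * g - b\<^sup>2" by (simp add: gram_det_def a_def b_def g_def)
  have Q: "(1 + 2 * a) * (1 + 2 * g) - (2 * b)\<^sup>2 = Q"
    by (simp add: Q_def Dabg power2_eq_square algebra_simps)
  have Qpos: "Q > 0" using D ag by (simp add: Q_def)
  have Q1: "1 / Q \<le> 1" using D ag by (simp add: Q_def)
  define F where "F z = inv_form (1 + 2 * a) (2 * b) (1 + 2 * g) z" for z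
  have norm1: "(cmod z)\<^sup>2 = inv_form 1 0 1 z" for z by (simp add: inv_form_def cmod_power2)
  have row: "(\<integral>\<^sup>+x. ennreal (exp (- (cmod ((\<Sum>k\<in>{i} \<times> {..<n}. x k * v (snd k)) + - w * v i))\<^sup>2))
      \<partial>PiM ({i} \<times> {..<n}) (\<lambda>_. real_gaussian)) = ennreal (sqrt (1 / Q) * exp (- F (- w * v i)))" for i :: nat
    unfolding norm1
    by (subst nn_integral_row_real)
      (simp_all add: F_def Q[symmetric] a_def b_def g_def sum.cartesian_product')
  have "(\<integral>\<^sup>+x. ennreal (exp (- (\<Sum>i<n. (cmod ((\<Sum>j<n. x (i, j) * v j) - w * v i))\<^sup>2))) \<partial>PiM ({..<n} \<times> {..<n}) (\<lambda>_. real_gaussian))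
     = (\<integral>\<^sup>+x. (\<Prod>i<n. (\<lambda>i z. ennreal (exp (- (cmod (z + - w * v i))\<^sup>2))) i (\<Sum>j<n. x (i, j) * v j)) \<partial>PiM ({..<n} \<times> {..<n}) (\<lambda>_. real_gaussian))"
    by (simp add: prod_ennreal exp_sum sum_negf[symmetric])
  also have "\<dots> = (\<Prod>i<n. ennreal (sqrt (1 / Q) * exp (- F (- w * v i))))"
    by (subst nn_integral_prod_rows) (simp_all only: row prob_space_real_gaussian sets_real_gaussian finite_lessThan, measurable)
  also have "\<dots> = ennreal (sqrt (1 / Q) ^ n * exp (- (\<Sum>i<n. F (- w * v i))))"
    using Qpos by (simp add: prod_ennreal prod.distrib exp_sum sum_negf[symmetric])
  also have "\<dots> \<le> ennreal ((c\<^sup>2 / (4 * gram_det n v)) ^ q)"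
  proof (rule ennreal_leI)
    define w1 w2 where "w1 = Re w" and "w2 = Im w"
    have F_sum: "(\<Sum>i<n. F (- w * v i)) \<ge> (cmod w)\<^sup>2 * ((a + g + 4 * gram_det n v) / Q)"
    proof -
      define A' B' G' where "A' = (\<Sum>i<n. (Re (- w * v i))\<^sup>2)" and "B' = (\<Sum>i<n. Re (- w * v i) * Im (- w * v i))"
        and "G' = (\<Sum>i<n. (Im (- w * v i))\<^sup>2)"
      have A': "A' = w1\<^sup>2 * a - 2 * w1 * w2 * b + w2\<^sup>2 * g"
        and B': "B' = w1 * w2 * (a - g) + (w1\<^sup>2 - w2\<^sup>2) * b"
        and G': "G' = w1\<^sup>2 * g + 2 * w1 * w2 * b + w2\<^sup>2 * a"
        unfolding A'_def B'_def G'_def a_def b_def g_def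
        by (simp_all add: w1_def w2_def sum_distrib_left sum_distrib_right sum.distrib[symmetric] sum_subtractf[symmetric]
            power2_eq_square algebra_simps)
      have "(\<Sum>i<n. F (- w * v i)) = ((1 + 2 * g) * A' - 2 * (2 * b) * B' + (1 + 2 * a) * G') / Q"
        unfolding F_def inv_form_def Q sum_divide_distrib[symmetric] A'_def B'_def G'_def
        by (simp only: sum.distrib sum_subtractf sum_distrib_left mult.assoc)
      also have "(1 + 2 * g) * A' - 2 * (2 * b) * B' + (1 + 2 * a) * G'
          = (w1\<^sup>2 + w2\<^sup>2) * (a + g + 4 * gram_det n v) + 2 * w2\<^sup>2 * ((a - g)\<^sup>2 + (2 * b)\<^sup>2)"
        unfolding A' B' G' Dabg by (simp add: power2_eq_square algebra_simps)
      finally have "(\<Sum>i<n. F (- w * v i)) = ((w1\<^sup>2 + w2\<^sup>2) * (a + g + 4 * gram_det n v) + 2 * w2\<^sup>2 * ((a - g)\<^sup>2 + (2 * b)\<^sup>2)) / Q" .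
      moreover have "2 * w2\<^sup>2 * ((a - g)\<^sup>2 + (2 * b)\<^sup>2) \<ge> 0" by simp
      ultimately show ?thesis
        using Qpos by (simp add: cmod_power2 w1_def[symmetric] w2_def[symmetric] divide_right_mono)
    qed
    have "sqrt (1 / Q) ^ n * exp (- (\<Sum>i<n. F (- w * v i)))
        \<le> sqrt (1 / Q) ^ n * exp (- ((cmod w)\<^sup>2 * ((a + g + 4 * gram_det n v) / Q)))"
      using F_sum Qpos by (intro mult_left_mono) simp_all
    also have "\<dots> = (sqrt (1 / Q) * exp (- \<rho> * ((a + g + 4 * gram_det n v) / Q))) ^ n"
      unfolding w power_mult_distrib exp_of_nat_mult[symmetric] by (simp add: mult.assoc)
    finally have le: "sqrt (1 / Q) ^ n * exp (- (\<Sum>i<n. F (- w * v i)))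
        \<le> (sqrt (1 / Q) * exp (- \<rho> * ((a + g + 4 * gram_det n v) / Q))) ^ n" .
    have ub1: "sqrt (1 / Q) * exp (- \<rho> * ((a + g + 4 * gram_det n v) / Q)) \<le> 1 * 1"
      using Q1 Qpos \<open>\<rho> \<ge> 0\<close> ag D by (intro mult_mono) (simp_all add: mult_nonneg_nonneg)
    have "4 * (a * g - b\<^sup>2) = (a + g)\<^sup>2 - (a - g)\<^sup>2 - 4 * b\<^sup>2"
      by (simp add: power2_eq_square algebra_simps)
    then have "4 * (a * g - b\<^sup>2) \<le> (a + g)\<^sup>2"
      using zero_le_power2[of "a - g"] zero_le_power2[of b] by linarith
    then have ub2: "sqrt (1 / Q) * exp (- \<rho> * ((a + g + 4 * gram_det n v) / Q)) \<le> c / sqrt (4 * gram_det n v)"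
      unfolding Q_def using D ag \<open>\<rho> \<ge> 0\<close> c by (intro kernel_factor_bound) (simp_all add: Dabg)
    show "sqrt (1 / Q) ^ n * exp (- (\<Sum>i<n. F (- w * v i))) \<le> (c\<^sup>2 / (4 * gram_det n v)) ^ q"
      by (rule order_trans[OF le], rule power_le_intermediate_power[OF _ _ ub2 D q]) (use ub1 Qpos in simp_all)
  qed
  finally show ?thesis .
qed

text \<open>Complex entries give the stronger bound \<open>(c / |v|^2)^n\<close>. The weaker one in terms of the Gram determinant
  is what both ensembles share.\<close>
lemma kernel_bound_complex:
  fixes v :: "nat \<Rightarrow> complex" and w :: complex and c \<rho> :: real
  assumes D: "gram_det n v > 0" and w: "(cmod w)\<^sup>2 = real n * \<rho>" and "\<rho> \<ge> 0"
    and c: "\<And>t. 0 \<le> t \<Longrightarrow> t \<le> 1 \<Longrightarrow> t * exp (- \<rho> * t) \<le> c" "c > 0" and q: "2 * q \<le> n"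
  shows "(\<integral>\<^sup>+x. ennreal (exp (- (\<Sum>i<n. (cmod ((\<Sum>j<n. x (i, j) * v j) - w * v i))\<^sup>2)))
            \<partial>PiM ({..<n} \<times> {..<n}) (\<lambda>_. complex_gaussian)) \<le> ennreal ((c\<^sup>2 / (4 * gram_det n v)) ^ q)"
proof -
  define a b g where "a = (\<Sum>j<n. (Re (v j))\<^sup>2)" and "b = (\<Sum>j<n. Re (v j) * Im (v j))"
    and "g = (\<Sum>j<n. (Im (v j))\<^sup>2)"
  define \<tau> where "\<tau> = (\<Sum>j<n. (cmod (v j))\<^sup>2)"
  have \<tau>: "\<tau> = a + g" by (simp add: \<tau>_def a_def g_def cmod_power2 sum.distrib)
  have ag: "a \<ge> 0" "g \<ge> 0" by (simp_all add: a_def g_def sum_nonneg)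
  have Dabg: "gram_det n v = a * g - b\<^sup>2" by (simp add: gram_det_def a_def b_def g_def)
  have "4 * gram_det n v = \<tau>\<^sup>2 - (a - g)\<^sup>2 - 4 * b\<^sup>2"
    unfolding \<tau> Dabg by (simp add: power2_eq_square algebra_simps)
  then have D\<tau>: "4 * gram_det n v \<le> \<tau>\<^sup>2"
    using zero_le_power2[of "a - g"] zero_le_power2[of b] by linarith
  have "\<tau> \<noteq> 0" using D D\<tau> by auto
  then have \<tau>pos: "\<tau> > 0" using ag \<tau> by simp
  have row: "(\<integral>\<^sup>+x. ennreal (exp (- (cmod ((\<Sum>k\<in>{i} \<times> {..<n}. x k * v (snd k)) + - w * v i))\<^sup>2 / 1))
      \<partial>PiM ({i} \<times> {..<n}) (\<lambda>_. complex_gaussian)) = ennreal (1 / (1 + \<tau>) * exp (- (cmod (w * v i))\<^sup>2 / (1 + \<tau>)))" for i :: nat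
    by (subst nn_integral_row_complex) (simp_all add: \<tau>_def sum.cartesian_product')
  have "(\<integral>\<^sup>+x. ennreal (exp (- (\<Sum>i<n. (cmod ((\<Sum>j<n. x (i, j) * v j) - w * v i))\<^sup>2))) \<partial>PiM ({..<n} \<times> {..<n}) (\<lambda>_. complex_gaussian))
     = (\<integral>\<^sup>+x. (\<Prod>i<n. (\<lambda>i z. ennreal (exp (- (cmod (z + - w * v i))\<^sup>2 / 1))) i (\<Sum>j<n. x (i, j) * v j)) \<partial>PiM ({..<n} \<times> {..<n}) (\<lambda>_. complex_gaussian))"
    by (simp add: prod_ennreal exp_sum sum_negf[symmetric])
  also have "\<dots> = (\<Prod>i<n. ennreal (1 / (1 + \<tau>) * exp (- (cmod (w * v i))\<^sup>2 / (1 + \<tau>))))"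
    by (subst nn_integral_prod_rows) (simp_all only: row prob_space_complex_gaussian sets_complex_gaussian finite_lessThan, measurable)
  also have "\<dots> = ennreal ((1 / (1 + \<tau>)) ^ n * exp (- (\<Sum>i<n. (cmod (w * v i))\<^sup>2 / (1 + \<tau>))))"
    using \<tau>pos by (simp add: prod_ennreal prod.distrib exp_sum sum_negf[symmetric] power_divide prod_dividef)
  also have "(\<Sum>i<n. (cmod (w * v i))\<^sup>2 / (1 + \<tau>)) = real n * (\<rho> * (\<tau> / (1 + \<tau>)))"
    by (simp add: norm_mult power_mult_distrib w sum_divide_distrib[symmetric] sum_distrib_left[symmetric] \<tau>_def)
  also have "(1 / (1 + \<tau>)) ^ n * exp (- (real n * (\<rho> * (\<tau> / (1 + \<tau>))))) = (1 / (1 + \<tau>) * exp (- \<rho> * (\<tau> / (1 + \<tau>)))) ^ n"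
    unfolding power_mult_distrib exp_of_nat_mult[symmetric] by simp
  also have "ennreal \<dots> \<le> ennreal ((c\<^sup>2 / (4 * gram_det n v)) ^ q)"
  proof (rule ennreal_leI)
    let ?y = "1 / (1 + \<tau>) * exp (- \<rho> * (\<tau> / (1 + \<tau>)))"
    have y0: "0 \<le> ?y" using \<tau>pos by simp
    have y1: "?y \<le> 1 * 1"
      using \<tau>pos \<open>\<rho> \<ge> 0\<close> by (intro mult_mono) simp_all
    have "?y = \<tau> / (1 + \<tau>) * exp (- \<rho> * (\<tau> / (1 + \<tau>))) / \<tau>" using \<tau>pos by simp
    also have "\<dots> \<le> c / \<tau>" using \<tau>pos by (intro divide_right_mono c(1)) simp_all
    also have "\<dots> \<le> c / sqrt (4 * gram_det n v)"
      using D D\<tau> \<tau>pos c(2) by (intro divide_left_mono real_le_lsqrt) simp_all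
    finally have y2: "?y \<le> c / sqrt (4 * gram_det n v)" .
    show "?y ^ n \<le> (c\<^sup>2 / (4 * gram_det n v)) ^ q"
      by (rule power_le_intermediate_power[OF y0 _ y2 D q]) (use y1 in simp)
  qed
  finally show ?thesis .
qed

section \<open>The determinant as a Gaussian integral\<close>

lemma cofactor_corner:
  "cofactor (Matrix.mat (Suc m) (Suc m) f) m m = Determinant.det (Matrix.mat m m f)"
proof -
  have "mat_delete (Matrix.mat (Suc m) (Suc m) f) m m = Matrix.mat m m f"
    by (rule eq_matI) (auto simp: mat_delete_def)
  then show ?thesis by (simp add: cofactor_def)
qed

text \<open>Subtracting multiples of the last column from the others clears the last row.\<close>
lemma det_schur_complement:
  fixes h :: "nat \<Rightarrow> nat \<Rightarrow> 'a :: field"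
  assumes "h m m \<noteq> 0"
  shows "Determinant.det (Matrix.mat (Suc m) (Suc m) (\<lambda>(i, j). h i j))
    = h m m * Determinant.det (Matrix.mat m m (\<lambda>(i, j). h i j - h i m * h m j / h m m))"
proof -
  let ?H = "Matrix.mat (Suc m) (Suc m) (\<lambda>(i, j). h i j)"
  define E where "E = Matrix.mat (Suc m) (Suc m) (\<lambda>(i, j). if i = j then 1 else if i = m then - h m j / h m m else 0)"
  define K where "K = Matrix.mat (Suc m) (Suc m) (\<lambda>(i, j). if j = m then h i m else h i j - h i m * h m j / h m m)"
  have E: "E \<in> carrier_mat (Suc m) (Suc m)" and K: "K \<in> carrier_mat (Suc m) (Suc m)"
    by (simp_all add: E_def K_def)
  have HE: "?H * E = K"
  proof (rule eq_matI)
    fix i j assume "i < dim_row K" "j < dim_col K"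
    then have ij: "i < Suc m" "j < Suc m" by (simp_all add: K_def)
    have "(?H * E) $$ (i, j) = (\<Sum>k<Suc m. h i k * E $$ (k, j))"
      using ij E by (simp add: scalar_prod_def E_def atLeast0LessThan del: sum.lessThan_Suc)
    also have "\<dots> = (\<Sum>k<m. h i k * E $$ (k, j)) + h i m * E $$ (m, j)" by simp
    also have "(\<Sum>k<m. h i k * E $$ (k, j)) = (\<Sum>k<m. if k = j then h i k else 0)"
      using ij by (intro sum.cong) (auto simp: E_def)
    also have "\<dots> = (if j < m then h i j else 0)" by simp
    also have "\<dots> + h i m * E $$ (m, j) = K $$ (i, j)"
      using ij by (auto simp: E_def K_def)
    finally show "(?H * E) $$ (i, j) = K $$ (i, j)" .
  qed (simp_all add: E_def K_def)
  have "Determinant.det E = prod_list (diag_mat E)"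
    by (rule det_lower_triangular[OF _ E]) (auto simp: E_def)
  also have "diag_mat E = map (\<lambda>i. 1) [0..<Suc m]"
    by (auto simp: diag_mat_def E_def intro!: map_cong simp del: upt_Suc)
  also have "prod_list \<dots> = 1" by (simp add: prod_list_replicate map_replicate_const del: upt_Suc)
  finally have detE: "Determinant.det E = 1" .
  have "Determinant.det ?H = Determinant.det ?H * Determinant.det E" by (simp add: detE)
  also have "\<dots> = Determinant.det K" using E by (subst det_mult[symmetric]) (simp_all add: HE)
  also have "\<dots> = (\<Sum>j<Suc m. K $$ (m, j) * cofactor K m j)"
    by (rule laplace_expansion_row[OF K]) simp
  also have "\<dots> = h m m * cofactor K m m"
    using assms by (simp add: K_def)
  also have "cofactor K m m = Determinant.det (Matrix.mat m m (\<lambda>(i, j). h i j - h i m * h m j / h m m))"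
    unfolding K_def cofactor_corner by (rule arg_cong[where f = Determinant.det]) (auto intro!: eq_matI)
  finally show ?thesis .
qed

text \<open>For hermitian \<open>h\<close> the sum is real, and \<open>Re\<close> only changes its type.\<close>
definition qform :: "nat \<Rightarrow> (nat \<Rightarrow> nat \<Rightarrow> complex) \<Rightarrow> (nat \<Rightarrow> complex) \<Rightarrow> real" where
  "qform n h v = Re (\<Sum>i<n. \<Sum>j<n. cnj (v i) * h i j * v j)"

lemma qform_cong: "(\<And>i. i < n \<Longrightarrow> v i = v' i) \<Longrightarrow> qform n h v = qform n h v'"
  by (simp add: qform_def)

lemma qform_complete_square:
  assumes herm: "\<And>i j. h j i = cnj (h i j)" and r: "h m m = of_real r" "r \<noteq> 0"
  shows "qform (Suc m) h v = r * (cmod (v m + (\<Sum>j<m. h m j * v j) / r))\<^sup>2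
      + qform m (\<lambda>i j. h i j - h i m * h m j / h m m) v"
proof -
  define L where "L = (\<Sum>j<m. h m j * v j)"
  define S where "S = (\<Sum>i<m. \<Sum>j<m. cnj (v i) * h i j * v j)"
  have cL: "(\<Sum>i<m. cnj (v i) * h i m) = cnj L"
    unfolding L_def cnj_sum by (intro sum.cong) (simp_all add: herm[of m])
  have "(\<Sum>i<Suc m. \<Sum>j<Suc m. cnj (v i) * h i j * v j)
      = S + (\<Sum>i<m. cnj (v i) * h i m) * v m + cnj (v m) * L + cnj (v m) * h m m * v m"
    by (simp add: S_def L_def sum.distrib sum_distrib_right sum_distrib_left algebra_simps)
  also have "\<dots> = S + (cnj L * v m + cnj (v m) * L + of_real r * (v m * cnj (v m)))"
    by (simp add: cL r algebra_simps)
  also have "\<dots> = of_real r * ((v m + L / r) * cnj (v m + L / r)) + (S - cnj L * L / r)"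
    using r by (simp add: field_simps)
  also have "S - cnj L * L / r = (\<Sum>i<m. \<Sum>j<m. cnj (v i) * (h i j - h i m * h m j / h m m) * v j)"
  proof -
    have "cnj L * L / r = (\<Sum>i<m. \<Sum>j<m. (cnj (v i) * h i m) * (h m j * v j)) / r"
      by (simp add: L_def[symmetric] sum_distrib_left[symmetric] sum_distrib_right[symmetric] cL)
    then show ?thesis
      by (simp add: S_def sum_divide_distrib sum_subtractf[symmetric] r algebra_simps)
  qed
  finally show ?thesis
    unfolding qform_def L_def[symmetric]
    by (simp only: complex_norm_square[symmetric] of_real_mult[symmetric] plus_complex.sel Re_complex_of_real)
qed

text \<open>Integrating out the last variable replaces the matrix by its Schur complement and contributes \<open>pi / r\<close>,
  and the same pivot \<open>r\<close> is what the determinant loses. The induction also shows that the determinant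
  is a positive real number.\<close>
lemma nn_integral_gauss_hermitian:
  assumes "\<And>i j. h j i = cnj (h i j)"
    and "\<And>v. (\<exists>i<n. v i \<noteq> 0) \<Longrightarrow> qform n h v > 0"
  shows "\<exists>d>0. Determinant.det (Matrix.mat n n (\<lambda>(i, j). h i j)) = of_real d
    \<and> (\<integral>\<^sup>+v. ennreal (exp (- qform n h v)) \<partial>lborel_pow {..<n}) = ennreal (pi ^ n / d)"
  using assms
proof (induction n arbitrary: h)
  case 0
  interpret product_sigma_finite "\<lambda>_::nat. lborel :: complex measure" by standard
  show ?case
    unfolding lessThan_0 by (subst nn_integral_empty) (simp_all add: qform_def exI[of _ 1])
next
  case (Suc m)
  interpret product_sigma_finite "\<lambda>_::nat. lborel :: complex measure" by standard
  define r where "r = Re (h m m)"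
  have "Im (h m m) = 0" using arg_cong[OF Suc.prems(1)[of m m], of Im] by simp
  then have r: "h m m = of_real r" by (simp add: r_def complex_eq_iff)
  have "qform (Suc m) h (\<lambda>i. if i = m then 1 else 0) = r"
    by (simp add: qform_def r_def if_distrib cong: if_cong)
  then have rpos: "r > 0" using Suc.prems(2)[of "\<lambda>i. if i = m then 1 else 0"] by auto
  define S where "S = (\<lambda>i j. h i j - h i m * h m j / h m m)"
  note sq = qform_complete_square[where h = h and m = m, OF Suc.prems(1) r, folded S_def]
  have "\<exists>d>0. Determinant.det (Matrix.mat m m (\<lambda>(i, j). S i j)) = of_real d
    \<and> (\<integral>\<^sup>+v. ennreal (exp (- qform m S v)) \<partial>lborel_pow {..<m}) = ennreal (pi ^ m / d)"
  proof (rule Suc.IH)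
    show "S j i = cnj (S i j)" for i j
      using Suc.prems(1)[of j i] Suc.prems(1)[of j m] Suc.prems(1)[of m i]
      by (simp add: S_def r mult.commute)
    fix v :: "nat \<Rightarrow> complex" assume v: "\<exists>i<m. v i \<noteq> 0"
    \<comment> \<open>This choice of the last coordinate makes the square in \<open>sq\<close> vanish.\<close>
    define v' where "v' = v(m := - (\<Sum>j<m. h m j * v j) / r)"
    have "qform (Suc m) h v' > 0" using v by (intro Suc.prems(2)) (auto simp: v'_def)
    also have "qform (Suc m) h v' = qform m S v'"
    proof -
      have "(\<Sum>j<m. h m j * v' j) = (\<Sum>j<m. h m j * v j)" by (intro sum.cong) (simp_all add: v'_def)
      then have "v' m + (\<Sum>j<m. h m j * v' j) / r = 0" by (simp add: v'_def)
      then show ?thesis using rpos by (subst sq) simp_all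
    qed
    also have "\<dots> = qform m S v" by (rule qform_cong) (simp add: v'_def)
    finally show "qform m S v > 0" .
  qed
  then obtain d where d: "d > 0" "Determinant.det (Matrix.mat m m (\<lambda>(i, j). S i j)) = of_real d"
    "(\<integral>\<^sup>+v. ennreal (exp (- qform m S v)) \<partial>lborel_pow {..<m}) = ennreal (pi ^ m / d)" by blast
  have sq': "qform (Suc m) h (v(m := y)) = r * (cmod (y + (\<Sum>j<m. h m j * v j) / r))\<^sup>2 + qform m S v" for v y
  proof -
    have "(\<Sum>j<m. h m j * (v(m := y)) j) = (\<Sum>j<m. h m j * v j)" by (intro sum.cong) simp_all
    moreover have "qform m S (v(m := y)) = qform m S v" by (rule qform_cong) simp
    ultimately show ?thesis using rpos by (subst sq) simp_all
  qed
  have [measurable]: "cnj \<in> borel_measurable borel"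
    by (intro borel_measurable_continuous_onI continuous_intros)
  have meas: "(\<lambda>v. qform k h v) \<in> borel_measurable (lborel_pow {..<k})" for k h
    unfolding qform_def by measurable
  have "(\<integral>\<^sup>+v. ennreal (exp (- qform (Suc m) h v)) \<partial>PiM {..<Suc m} (\<lambda>_. lborel))
    = (\<integral>\<^sup>+v. \<integral>\<^sup>+y. ennreal (exp (- qform (Suc m) h (v(m := y)))) \<partial>lborel \<partial>lborel_pow {..<m})"
    unfolding lessThan_Suc
    by (rule product_nn_integral_insert) (use meas[of "Suc m" h] in \<open>simp_all add: lessThan_Suc\<close>)
  also have "\<dots> = (\<integral>\<^sup>+v. ennreal (exp (- qform m S v)) * ennreal (pi / r) \<partial>lborel_pow {..<m})"
  proof (intro nn_integral_cong)
    fix v :: "nat \<Rightarrow> complex"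
    have "(\<integral>\<^sup>+y. ennreal (exp (- qform (Suc m) h (v(m := y)))) \<partial>lborel)
      = (\<integral>\<^sup>+y. ennreal (exp (- qform m S v)) * ennreal (exp (- r * (cmod (y + (\<Sum>j<m. h m j * v j) / r))\<^sup>2)) \<partial>lborel)"
      unfolding sq' by (intro nn_integral_cong) (simp add: ennreal_mult[symmetric] exp_add[symmetric])
    also have "\<dots> = ennreal (exp (- qform m S v)) * ennreal (pi / r)"
      by (subst nn_integral_cmult, simp, subst nn_integral_gauss_complex[OF rpos]) simp
    finally show "(\<integral>\<^sup>+y. ennreal (exp (- qform (Suc m) h (v(m := y)))) \<partial>lborel) = ennreal (exp (- qform m S v)) * ennreal (pi / r)" .
  qed
  also have "\<dots> = ennreal (pi ^ m / d) * ennreal (pi / r)"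
    by (subst nn_integral_multc) (use meas[of m S] d in simp_all)
  also have "\<dots> = ennreal (pi ^ Suc m / (r * d))"
    using d rpos by (simp add: ennreal_mult[symmetric] field_simps)
  finally have "(\<integral>\<^sup>+v. ennreal (exp (- qform (Suc m) h v)) \<partial>PiM {..<Suc m} (\<lambda>_. lborel)) = ennreal (pi ^ Suc m / (r * d))" .
  moreover have "Determinant.det (Matrix.mat (Suc m) (Suc m) (\<lambda>(i, j). h i j)) = of_real (r * d)"
    using rpos d(2) by (subst det_schur_complement) (simp_all add: r S_def)
  ultimately show ?case using rpos d(1) by (intro exI[of _ "r * d"]) simp
qed

text \<open>Cramer's rule, without dividing by the determinant.\<close>
lemma cramer_sum:
  fixes A :: "complex mat"
  assumes A: "A \<in> carrier_mat n n" and i: "i < n"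
  shows "(\<Sum>k<n. cofactor A k i * (\<Sum>j<n. A $$ (k, j) * v j)) = Determinant.det A * v i"
proof -
  have e: "(\<Sum>k<n. cofactor A k i * A $$ (k, j)) = Determinant.det A * (if i = j then 1 else 0)" if "j < n" for j
  proof -
    have "(adj_mat A * A) $$ (i, j) = (Determinant.det A \<cdot>\<^sub>m 1\<^sub>m n) $$ (i, j)"
      using adj_mat(3)[OF A] by simp
    then show ?thesis using A i that
      by (simp add: scalar_prod_def adj_mat_def atLeast0LessThan)
  qed
  have "(\<Sum>k<n. cofactor A k i * (\<Sum>j<n. A $$ (k, j) * v j)) = (\<Sum>j<n. (\<Sum>k<n. cofactor A k i * A $$ (k, j)) * v j)"
    unfolding sum_distrib_left sum_distrib_right by (subst sum.swap) (simp add: mult.assoc)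
  also have "\<dots> = (\<Sum>j<n. if i = j then Determinant.det A * v j else 0)"
    by (intro sum.cong) (simp_all add: e)
  also have "\<dots> = Determinant.det A * v i" using i by simp
  finally show ?thesis .
qed

abbreviation sq_norm_image :: "nat \<Rightarrow> complex mat \<Rightarrow> (nat \<Rightarrow> complex) \<Rightarrow> real" where
  "sq_norm_image n A v \<equiv> (\<Sum>k<n. (cmod (\<Sum>j<n. A $$ (k, j) * v j))\<^sup>2)"

text \<open>The exponent is the hermitian form of \<open>c A\<^sup>* A\<close>, whose determinant is \<open>c ^ n |det A|^2\<close>.\<close>
lemma nn_integral_gauss_image:
  fixes A :: "complex mat"
  assumes A: "A \<in> carrier_mat n n" and det: "Determinant.det A \<noteq> 0" and c: "c > 0"
  shows "(\<integral>\<^sup>+v. ennreal (exp (- c * sq_norm_image n A v)) \<partial>lborel_pow {..<n})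
    = ennreal ((pi / c) ^ n / (cmod (Determinant.det A))\<^sup>2)"
proof -
  define h where "h = (\<lambda>i j. of_real c * (\<Sum>k<n. cnj (A $$ (k, i)) * A $$ (k, j)))"
  have qf: "qform n h v = c * sq_norm_image n A v" for v
  proof -
    have "(\<Sum>i<n. \<Sum>j<n. cnj (v i) * h i j * v j)
        = of_real c * (\<Sum>i<n. \<Sum>j<n. \<Sum>k<n. cnj (A $$ (k, i) * v i) * (A $$ (k, j) * v j))"
      by (simp add: h_def sum_distrib_left sum_distrib_right algebra_simps)
    also have "(\<Sum>i<n. \<Sum>j<n. \<Sum>k<n. cnj (A $$ (k, i) * v i) * (A $$ (k, j) * v j))
        = (\<Sum>k<n. \<Sum>i<n. \<Sum>j<n. cnj (A $$ (k, i) * v i) * (A $$ (k, j) * v j))"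
      by (subst (2) sum.swap, subst sum.swap) simp
    also have "\<dots> = (\<Sum>k<n. cnj (\<Sum>j<n. A $$ (k, j) * v j) * (\<Sum>j<n. A $$ (k, j) * v j))"
      by (simp only: sum_product cnj_sum)
    also have "\<dots> = of_real (sq_norm_image n A v)"
      by (simp only: of_real_sum complex_norm_square mult.commute)
    finally show ?thesis by (simp add: qform_def del: of_real_sum of_real_power)
  qed
  have herm: "h j i = cnj (h i j)" for i j
    by (simp add: h_def cnj_sum mult.commute)
  have pos: "qform n h v > 0" if v: "\<exists>i<n. v i \<noteq> 0" for v
  proof -
    from v obtain i where i: "i < n" "v i \<noteq> 0" by blast
    have "\<exists>k<n. (\<Sum>j<n. A $$ (k, j) * v j) \<noteq> 0"
    proof (rule ccontr)
      assume "\<not> ?thesis"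
      then have "(\<Sum>k<n. cofactor A k i * (\<Sum>j<n. A $$ (k, j) * v j)) = 0" by simp
      then show False using cramer_sum[OF A i(1), of v] det i(2) by simp
    qed
    then obtain k where k: "k < n" "(\<Sum>j<n. A $$ (k, j) * v j) \<noteq> 0" by blast
    have "sq_norm_image n A v > 0" using k by (intro sum_pos2[of _ k]) simp_all
    then show ?thesis using c by (simp add: qf)
  qed
  obtain d where d: "d > 0" "Determinant.det (Matrix.mat n n (\<lambda>(i, j). h i j)) = of_real d"
      "(\<integral>\<^sup>+v. ennreal (exp (- qform n h v)) \<partial>lborel_pow {..<n}) = ennreal (pi ^ n / d)"
    using nn_integral_gauss_hermitian[OF herm pos] by blast
  have "complex_of_real d = of_real (c ^ n * (cmod (Determinant.det A))\<^sup>2)"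
  proof -
    let ?B = "map_mat cnj (transpose_mat A)"
    interpret cnj: comm_ring_hom cnj by standard simp_all
    have B: "?B \<in> carrier_mat n n" using A by simp
    have "Matrix.mat n n (\<lambda>(i, j). h i j) = of_real c \<cdot>\<^sub>m (?B * A)"
      by (rule eq_matI) (use A in \<open>auto simp: h_def scalar_prod_def atLeast0LessThan\<close>)
    then have "Determinant.det (Matrix.mat n n (\<lambda>(i, j). h i j)) = of_real c ^ n * (Determinant.det ?B * Determinant.det A)"
      using A B by (simp add: det_mult[OF B A])
    also have "Determinant.det ?B = cnj (Determinant.det A)"
      using cnj.hom_det[of "transpose_mat A"] det_transpose[OF A] by simp
    also have "cnj (Determinant.det A) * Determinant.det A = of_real ((cmod (Determinant.det A))\<^sup>2)"
      by (simp only: complex_norm_square mult.commute)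
    finally show ?thesis
      unfolding d(2) by simp
  qed
  then have "d = c ^ n * (cmod (Determinant.det A))\<^sup>2" using of_real_eq_iff by blast
  then show ?thesis using d(3) by (simp add: qf power_divide)
qed

text \<open>By Cramer's rule the hypothesis says that the entries of the inverse of \<open>A\<close> are at most \<open>T\<close>.\<close>
lemma sq_norm_le_image:
  fixes A :: "complex mat"
  assumes A: "A \<in> carrier_mat n n" and det: "Determinant.det A \<noteq> 0" and T: "T \<ge> 0"
    and cof: "\<And>i j. i < n \<Longrightarrow> j < n \<Longrightarrow> cmod (cofactor A i j) \<le> T * cmod (Determinant.det A)"
  shows "(\<Sum>i<n. (cmod (v i))\<^sup>2) \<le> (real n * T)\<^sup>2 * sq_norm_image n A v"
proof -
  have "(cmod (v i))\<^sup>2 \<le> real n * T\<^sup>2 * sq_norm_image n A v" if i: "i < n" for i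
  proof -
    define y where "y k = cmod (\<Sum>j<n. A $$ (k, j) * v j)" for k
    have "cmod (Determinant.det A) * cmod (v i) \<le> (\<Sum>k<n. cmod (cofactor A k i) * y k)"
      unfolding norm_mult[symmetric] cramer_sum[OF A i, of v, symmetric] y_def
      by (rule order_trans[OF norm_sum]) (simp add: norm_mult)
    also have "\<dots> \<le> (\<Sum>k<n. (T * cmod (Determinant.det A)) * y k)"
      using cof i by (intro sum_mono mult_right_mono) (simp_all add: y_def)
    also have "\<dots> = cmod (Determinant.det A) * (T * (\<Sum>k<n. y k))"
      by (simp add: sum_distrib_left[symmetric])
    finally have "cmod (v i) \<le> T * (\<Sum>k<n. y k)" using det by simp
    then have "(cmod (v i))\<^sup>2 \<le> T\<^sup>2 * (\<Sum>k<n. y k)\<^sup>2"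
      unfolding power_mult_distrib[symmetric] by (intro power_mono) simp_all
    also have "(\<Sum>k<n. y k)\<^sup>2 \<le> real n * (\<Sum>k<n. (y k)\<^sup>2)"
      using Cauchy_Schwarz_ineq_sum[of "\<lambda>_. 1" y "{..<n}"] by simp
    finally show ?thesis by (simp add: y_def mult_left_mono mult.assoc mult.left_commute)
  qed
  then have "(\<Sum>i<n. (cmod (v i))\<^sup>2) \<le> (\<Sum>i<n. real n * T\<^sup>2 * sq_norm_image n A v)"
    by (intro sum_mono) simp
  then show ?thesis by (simp add: power2_eq_square mult.assoc mult.left_commute)
qed

text \<open>When the inverse of \<open>A\<close> is bounded, the regularising term is at most \<open>|A v|^2 / n\<close>. Rescaling the quadratic form by
  \<open>1 + 1 / n\<close> changes a Gaussian integral in \<open>n\<close> complex variables by no more than the factor \<open>e\<close>.\<close>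
lemma nn_integral_regularised_ge:
  fixes A :: "complex mat"
  assumes A: "A \<in> carrier_mat n n" and det: "Determinant.det A \<noteq> 0" and T: "T > 0" and n: "n > 0"
    and cof: "\<And>i j. i < n \<Longrightarrow> j < n \<Longrightarrow> cmod (cofactor A i j) \<le> T * cmod (Determinant.det A)"
    and \<delta>: "\<delta> \<ge> 0" "\<delta> * (real n ^ 3 * T\<^sup>2) \<le> 1"
  shows "ennreal (pi ^ n * exp (-1) / (cmod (Determinant.det A))\<^sup>2)
    \<le> (\<integral>\<^sup>+v. ennreal (exp (- sq_norm_image n A v - \<delta> * (\<Sum>i<n. (cmod (v i))\<^sup>2))) \<partial>lborel_pow {..<n})"
proof -
  define c where "c = 1 + 1 / real n"
  have c: "c > 0" using n by (simp add: c_def add_pos_pos)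
  have "c ^ n \<le> exp (1 / real n) ^ n" unfolding c_def by (intro power_mono exp_ge_add_one_self) simp
  also have "\<dots> = exp 1" using n by (simp add: exp_of_nat_mult[symmetric])
  finally have cn: "c ^ n \<le> exp 1" .
  have "pi ^ n * exp (-1) \<le> (pi / c) ^ n"
    using cn c by (simp add: power_divide exp_minus field_simps)
  then have "ennreal (pi ^ n * exp (-1) / (cmod (Determinant.det A))\<^sup>2) \<le> ennreal ((pi / c) ^ n / (cmod (Determinant.det A))\<^sup>2)"
    by (intro ennreal_leI divide_right_mono) simp_all
  also have "\<dots> = (\<integral>\<^sup>+v. ennreal (exp (- c * sq_norm_image n A v)) \<partial>lborel_pow {..<n})"
    using nn_integral_gauss_image[OF A det c] by simp
  also have "\<dots> \<le> (\<integral>\<^sup>+v. ennreal (exp (- sq_norm_image n A v - \<delta> * (\<Sum>i<n. (cmod (v i))\<^sup>2))) \<partial>lborel_pow {..<n})"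
  proof (intro nn_integral_mono ennreal_leI)
    fix v :: "nat \<Rightarrow> complex"
    have "\<delta> * (\<Sum>i<n. (cmod (v i))\<^sup>2) \<le> \<delta> * ((real n * T)\<^sup>2 * sq_norm_image n A v)"
      using sq_norm_le_image[OF A det _ cof] T \<delta> by (intro mult_left_mono) simp_all
    also have "\<dots> = (\<delta> * (real n ^ 3 * T\<^sup>2)) * (sq_norm_image n A v / real n)"
      using n by (simp add: power2_eq_square power3_eq_cube)
    also have "\<dots> \<le> 1 * (sq_norm_image n A v / real n)"
      using \<delta> by (intro mult_right_mono) (simp_all add: sum_nonneg)
    finally show "exp (- c * sq_norm_image n A v) \<le> exp (- sq_norm_image n A v - \<delta> * (\<Sum>i<n. (cmod (v i))\<^sup>2))"
      by (simp add: c_def algebra_simps)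
  qed
  finally show ?thesis .
qed

section \<open>A negative moment of the Gram determinant\<close>

text \<open>It is enough to compare the two measures on boxes, where both sides factor over the coordinates.\<close>
lemma distr_PiM_complex:
  fixes J :: "'j set"
  assumes J: "finite J"
  shows "distr (lborel_pow J \<Otimes>\<^sub>M lborel_pow J) (lborel_pow J)
      (\<lambda>(x, y). \<lambda>j\<in>J. Complex (x j) (y j)) = PiM J (\<lambda>_. lborel :: complex measure)"
proof -
  let ?D = "distr (lborel_pow J \<Otimes>\<^sub>M lborel_pow J) (lborel_pow J)
    (\<lambda>(x, y). \<lambda>j\<in>J. Complex (x j) (y j))"
  interpret R: product_sigma_finite "\<lambda>_::'j. lborel :: real measure" by standard
  interpret C: product_sigma_finite "\<lambda>_::'j. lborel :: complex measure" by standard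
  interpret RJ: finite_product_sigma_finite "\<lambda>_::'j. lborel :: real measure" J by standard (rule J)
  have [measurable]: "(\<lambda>(x, y). \<lambda>j\<in>J. Complex (x j) (y j)) \<in>
      PiM J (\<lambda>_. lborel :: real measure) \<Otimes>\<^sub>M PiM J (\<lambda>_. lborel :: real measure) \<rightarrow>\<^sub>M PiM J (\<lambda>_. lborel :: complex measure)"
    unfolding case_prod_beta Complex_eq by (intro measurable_restrict) measurable
  show ?thesis
  proof (rule C.PiM_eqI[OF J])
    fix A :: "'j \<Rightarrow> complex set" assume "\<And>i. i \<in> J \<Longrightarrow> A i \<in> sets lborel"
    then have A [measurable]: "\<And>i. i \<in> J \<Longrightarrow> A i \<in> sets borel" by simp
    have sec [measurable]: "(\<lambda>b. indicator (A j) (Complex a b) :: ennreal) \<in> borel_measurable borel" if "j \<in> J" for j a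
      unfolding Complex_eq using A[OF that] by measurable
    have sec2 [measurable]: "(\<lambda>a. \<integral>\<^sup>+b. indicator (A j) (Complex a b) \<partial>lborel :: ennreal) \<in> borel_measurable borel" if "j \<in> J" for j
      unfolding Complex_eq using A[OF that] by measurable
    have ind: "indicator (Pi\<^sub>E J A) (\<lambda>j\<in>J. Complex (x j) (y j)) = (\<Prod>j\<in>J. indicator (A j) (Complex (x j) (y j)) :: ennreal)" for x y :: "'j \<Rightarrow> real"
    proof (cases "\<forall>j\<in>J. Complex (x j) (y j) \<in> A j")
      case True then show ?thesis by (simp add: indicator_def PiE_iff)
    next
      case False
      then have "\<exists>j\<in>J. indicator (A j) (Complex (x j) (y j)) = (0 :: ennreal)" by (auto simp: indicator_def)
      then have "(\<Prod>j\<in>J. indicator (A j) (Complex (x j) (y j)) :: ennreal) = 0" using J by (simp add: prod_zero)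
      then show ?thesis using False by (auto simp: indicator_def PiE_iff)
    qed
    have "emeasure ?D (Pi\<^sub>E J A)
      = (\<integral>\<^sup>+v. indicator (Pi\<^sub>E J A) v \<partial>?D)"
      using J by (intro nn_integral_indicator[symmetric]) (simp add: sets_PiM_I_finite)
    also have "\<dots> = (\<integral>\<^sup>+z. indicator (Pi\<^sub>E J A) ((\<lambda>(x, y). \<lambda>j\<in>J. Complex (x j) (y j)) z) \<partial>(lborel_pow J \<Otimes>\<^sub>M lborel_pow J))"
      using J by (intro nn_integral_distr) (simp_all add: sets_PiM_I_finite)
    also have "\<dots> = (\<integral>\<^sup>+x. \<integral>\<^sup>+y. indicator (Pi\<^sub>E J A) (\<lambda>j\<in>J. Complex (x j) (y j)) \<partial>lborel_pow J \<partial>lborel_pow J)"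
      using J by (subst RJ.nn_integral_fst[symmetric])
        (auto intro!: measurable_compose[OF _ borel_measurable_indicator] simp: sets_PiM_I_finite)
    also have "\<dots> = (\<integral>\<^sup>+x. (\<Prod>j\<in>J. \<integral>\<^sup>+b. indicator (A j) (Complex (x j) b) \<partial>lborel) \<partial>lborel_pow J)"
      unfolding ind by (intro nn_integral_cong R.product_nn_integral_prod J) simp
    also have "\<dots> = (\<Prod>j\<in>J. \<integral>\<^sup>+a. \<integral>\<^sup>+b. indicator (A j) (Complex a b) \<partial>lborel \<partial>lborel)"
      by (intro R.product_nn_integral_prod J) simp
    also have "\<dots> = (\<Prod>j\<in>J. emeasure lborel (A j))"
      by (intro prod.cong refl, subst nn_integral_lborel_complex[symmetric]) simp_all
    finally show "emeasure ?D (Pi\<^sub>E J A) = (\<Prod>j\<in>J. emeasure lborel (A j))" .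
  qed simp
qed

lemma nn_integral_PiM_complex:
  fixes f :: "('j \<Rightarrow> complex) \<Rightarrow> ennreal"
  assumes J: "finite J" and f: "f \<in> borel_measurable (lborel_pow J)"
  shows "(\<integral>\<^sup>+v. f v \<partial>lborel_pow J)
    = (\<integral>\<^sup>+x. \<integral>\<^sup>+y. f (\<lambda>j\<in>J. Complex (x j) (y j)) \<partial>lborel_pow J \<partial>lborel_pow J)"
proof -
  interpret RJ: finite_product_sigma_finite "\<lambda>_::'j. lborel :: real measure" J by standard (rule J)
  have m [measurable]: "(\<lambda>(x, y). \<lambda>j\<in>J. Complex (x j) (y j)) \<in>
      PiM J (\<lambda>_. lborel :: real measure) \<Otimes>\<^sub>M PiM J (\<lambda>_. lborel :: real measure) \<rightarrow>\<^sub>M PiM J (\<lambda>_. lborel :: complex measure)"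
    unfolding case_prod_beta Complex_eq by (intro measurable_restrict) measurable
  have "(\<integral>\<^sup>+v. f v \<partial>lborel_pow J) = (\<integral>\<^sup>+z. f ((\<lambda>(x, y). \<lambda>j\<in>J. Complex (x j) (y j)) z) \<partial>(lborel_pow J \<Otimes>\<^sub>M lborel_pow J))"
    by (subst distr_PiM_complex[OF J, symmetric], rule nn_integral_distr) (simp_all add: f)
  also have "\<dots> = (\<integral>\<^sup>+x. \<integral>\<^sup>+y. f (\<lambda>j\<in>J. Complex (x j) (y j)) \<partial>lborel_pow J \<partial>lborel_pow J)"
    by (subst RJ.nn_integral_fst[symmetric]) (use measurable_compose[OF m f] in simp_all)
  finally show ?thesis .
qed

text \<open>For \<open>q \<ge> 1\<close> and \<open>D > 0\<close> this is the Gamma integral \<open>(q - 1)! / D ^ q\<close>. Writing \<open>1 / D ^ q\<close> as a superposition of exponentials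
  makes Gaussian integration over \<open>v\<close> possible, and the value \<open>\<infinity>\<close> at \<open>D = 0\<close> is the right one.\<close>
definition gamma_kernel :: "nat \<Rightarrow> real \<Rightarrow> ennreal" where
  "gamma_kernel q D = (\<integral>\<^sup>+s. indicator {0<..} s * ennreal (s ^ (q - 1) * exp (- s * D)) \<partial>lborel)"

lemma gamma_kernel_0: "gamma_kernel q 0 = \<infinity>"
proof -
  have "of_nat k \<le> emeasure lborel {1::real..}" for k
  proof -
    have "of_nat k = emeasure lborel {1..1 + real k}" by (simp add: ennreal_of_nat_eq_real_of_nat)
    also have "\<dots> \<le> emeasure lborel {1::real..}" by (intro emeasure_mono) auto
    finally show ?thesis .
  qed
  then have "(SUP k. of_nat k) \<le> emeasure lborel {1::real..}" by (rule SUP_least)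
  then have "\<infinity> \<le> (\<integral>\<^sup>+s. indicator {1::real..} s \<partial>lborel)" by (simp add: ennreal_SUP_of_nat_eq_top)
  also have "\<dots> \<le> gamma_kernel q 0"
    unfolding gamma_kernel_def by (intro nn_integral_mono) (auto simp: indicator_def one_le_power)
  finally show ?thesis by (simp add: top_unique)
qed

text \<open>For \<open>s \<ge> q / D\<close> the power of \<open>s\<close> is at least \<open>(q / D) ^ (q - 1)\<close>, and the exponential alone then gives
  \<open>(q - 1)! / D ^ q\<close> up to a factor of order \<open>sqrt q\<close>.\<close>
lemma gamma_kernel_lower:
  assumes q: "q \<ge> 1" and D: "D > 0"
  shows "ennreal ((1 / D) ^ q) \<le> ennreal (exp (real q) / real q ^ (q - 1)) * gamma_kernel q D"
proof -
  define a where "a = real q / D"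
  have a: "a > 0" using q D by (simp add: a_def)
  have "(\<integral>\<^sup>+s. ennreal (exp (- s * D)) * indicator {a..} s \<partial>lborel) = ennreal (0 - (- exp (- a * D) / D))"
  proof (rule nn_integral_FTC_atLeast)
    show "((\<lambda>s. - exp (- s * D) / D) has_real_derivative exp (- s * D)) (at s)" for s
      using D by (auto intro!: derivative_eq_intros)
    show "((\<lambda>s. - exp (- s * D) / D) \<longlongrightarrow> 0) at_top"
      using D by real_asymp
  qed simp_all
  then have e: "(\<integral>\<^sup>+s. ennreal (exp (- s * D)) * indicator {a..} s \<partial>lborel) = ennreal (exp (- real q) / D)"
    using D by (simp add: a_def)
  have "ennreal (a ^ (q - 1)) * ennreal (exp (- real q) / D)
      = (\<integral>\<^sup>+s. ennreal (a ^ (q - 1)) * (ennreal (exp (- s * D)) * indicator {a..} s) \<partial>lborel)"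
    unfolding e[symmetric] by (rule nn_integral_cmult[symmetric]) simp
  also have "\<dots> \<le> gamma_kernel q D"
    unfolding gamma_kernel_def using a
    by (intro nn_integral_mono)
       (auto simp: indicator_def ennreal_mult[symmetric] intro!: ennreal_leI power_mono)
  finally have le: "ennreal (a ^ (q - 1)) * ennreal (exp (- real q) / D) \<le> gamma_kernel q D" .
  have "(1 / D) ^ q = exp (real q) / real q ^ (q - 1) * (a ^ (q - 1) * (exp (- real q) / D))"
  proof -
    have "a ^ (q - 1) = real q ^ (q - 1) * (1 / D) ^ (q - 1)" by (simp add: a_def power_divide)
    moreover have "(1 / D) ^ q = (1 / D) ^ (q - 1) * (1 / D)" using q by (metis One_nat_def Suc_diff_le diff_Suc_1 diff_Suc_Suc power_Suc2)
    ultimately show ?thesis using q by (simp add: exp_minus)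
  qed
  then have "ennreal ((1 / D) ^ q) = ennreal (exp (real q) / real q ^ (q - 1)) * (ennreal (a ^ (q - 1)) * ennreal (exp (- real q) / D))"
    using a D by (simp add: ennreal_mult[symmetric])
  also have "\<dots> \<le> ennreal (exp (real q) / real q ^ (q - 1)) * gamma_kernel q D"
    by (intro mult_left_mono le) simp
  finally show ?thesis .
qed

text \<open>The integrand is the derivative of \<open>(s / (\<delta> + s X)) ^ q\<close> divided by \<open>q \<delta>\<close>.\<close>
lemma nn_integral_beta:
  assumes q: "q \<ge> 1" and \<delta>: "\<delta> > 0" and X: "X > 0"
  shows "(\<integral>\<^sup>+s. indicator {0<..} s * ennreal (s ^ (q - 1) * (1 / (\<delta> + s * X)) ^ (q + 1)) \<partial>lborel)
    \<le> ennreal ((1 / X) ^ q / (real q * \<delta>))"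
proof -
  have "(\<integral>\<^sup>+s. indicator {0<..} s * ennreal (s ^ (q - 1) * (1 / (\<delta> + s * X)) ^ (q + 1)) \<partial>lborel)
     \<le> (\<integral>\<^sup>+s. ennreal (s ^ (q - 1) * (1 / (\<delta> + s * X)) ^ (q + 1)) * indicator {0..} s \<partial>lborel)"
    by (intro nn_integral_mono) (auto simp: indicator_def)
  also have "\<dots> = ennreal ((1 / X) ^ q / (real q * \<delta>) - (0 / (\<delta> + 0 * X)) ^ q / (real q * \<delta>))"
  proof (rule nn_integral_FTC_atLeast)
    fix s :: real assume s: "0 \<le> s"
    then have p: "\<delta> + s * X > 0" using \<delta> X by (simp add: add_pos_nonneg)
    show "0 \<le> s ^ (q - 1) * (1 / (\<delta> + s * X)) ^ (q + 1)" using s p by simp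
    have "((\<lambda>s. s / (\<delta> + s * X)) has_real_derivative \<delta> * (1 / (\<delta> + s * X))\<^sup>2) (at s)"
      using p by (auto intro!: derivative_eq_intros simp: field_simps power2_eq_square)
    from DERIV_cdivide[OF DERIV_power[OF this, of q], of "real q * \<delta>"]
    have "((\<lambda>s. (s / (\<delta> + s * X)) ^ q / (real q * \<delta>)) has_real_derivative
       (real q * ((\<delta> * (1 / (\<delta> + s * X))\<^sup>2) * (s / (\<delta> + s * X)) ^ (q - 1))) / (real q * \<delta>)) (at s)"
      by (simp add: mult.assoc)
    moreover have "(real q * ((\<delta> * (1 / (\<delta> + s * X))\<^sup>2) * (s / (\<delta> + s * X)) ^ (q - 1))) / (real q * \<delta>)
       = s ^ (q - 1) * (1 / (\<delta> + s * X)) ^ (q + 1)"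
    proof -
      have "(1 / (\<delta> + s * X)) ^ (q + 1) = (1 / (\<delta> + s * X))\<^sup>2 * (1 / (\<delta> + s * X)) ^ (q - 1)"
        using q by (simp only: power_add[symmetric]) simp
      then show ?thesis using q \<delta> by (simp add: power_divide)
    qed
    ultimately show "((\<lambda>s. (s / (\<delta> + s * X)) ^ q / (real q * \<delta>)) has_real_derivative s ^ (q - 1) * (1 / (\<delta> + s * X)) ^ (q + 1)) (at s)"
      by simp
  next
    have "((\<lambda>s. s / (\<delta> + s * X)) \<longlongrightarrow> inverse X) at_top" using X \<delta> by real_asymp
    then have "((\<lambda>s. s / (\<delta> + s * X)) \<longlongrightarrow> 1 / X) at_top" by (simp add: inverse_eq_divide)
    from tendsto_divide[OF tendsto_power[OF this, of q] tendsto_const[of "real q * \<delta>"]]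
    show "((\<lambda>s. (s / (\<delta> + s * X)) ^ q / (real q * \<delta>)) \<longlongrightarrow> (1 / X) ^ q / (real q * \<delta>)) at_top"
      using q \<delta> by simp
  qed simp
  also have "\<dots> = ennreal ((1 / X) ^ q / (real q * \<delta>))" using q by (simp add: power_0_left)
  finally show ?thesis .
qed

text \<open>The square of the linear form \<open>x \<cdot> y\<close> couples the coordinates. It is linearised with an auxiliary Gaussian variable
  \<open>h\<close>, after which the integral over \<open>y\<close> factors, and \<open>h\<close> is integrated last.\<close>
lemma nn_integral_gauss_rank_one:
  fixes x :: "nat \<Rightarrow> real" and n :: nat and s \<delta> :: real
  assumes \<delta>: "\<delta> > 0" and s: "s \<ge> 0"
  defines "X \<equiv> (\<Sum>j<n. (x j)\<^sup>2)"
  shows "(\<integral>\<^sup>+y. ennreal (exp (- \<delta> * (\<Sum>j<n. (y j)\<^sup>2) - s * (X * (\<Sum>j<n. (y j)\<^sup>2) - (\<Sum>j<n. x j * y j)\<^sup>2))) \<partial>lborel_pow {..<n})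
    = ennreal (sqrt (pi / (\<delta> + s * X)) ^ n * sqrt ((\<delta> + s * X) / \<delta>))"
proof -
  interpret product_sigma_finite "\<lambda>_::nat. lborel :: real measure" by standard
  interpret P: finite_product_sigma_finite "\<lambda>_::nat. lborel :: real measure" "{..<n}" by standard simp
  interpret pair_sigma_finite "lborel_pow {..<n} :: (nat \<Rightarrow> real) measure" "lborel :: real measure" ..
  define \<alpha> where "\<alpha> = \<delta> + s * X"
  have X: "X \<ge> 0" by (simp add: X_def sum_nonneg)
  have \<alpha>: "\<alpha> > 0" using \<delta> s X by (simp add: \<alpha>_def add_pos_nonneg)
  let ?V = "PiM {..<n} (\<lambda>_. lborel :: real measure)"
  let ?P = "\<lambda>h (y :: nat \<Rightarrow> real). \<Prod>j<n. ennreal (exp (- \<alpha> * (y j)\<^sup>2 + 2 * (sqrt s * h * x j) * y j))"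
  let ?q = "\<lambda>y :: nat \<Rightarrow> real. ennreal (exp (- \<delta> * (\<Sum>j<n. (y j)\<^sup>2) - s * (X * (\<Sum>j<n. (y j)\<^sup>2) - (\<Sum>j<n. x j * y j)\<^sup>2)))"
  have lin: "?q y
      = (\<integral>\<^sup>+h. ennreal (1 / sqrt pi) * ennreal (exp (- h\<^sup>2)) * ?P h y \<partial>lborel)" for y
  proof -
    define b where "b = (\<Sum>j<n. x j * y j)"
    have "(\<integral>\<^sup>+h. ennreal (1 / sqrt pi) * ennreal (exp (- h\<^sup>2)) * ?P h y \<partial>lborel)
      = (\<integral>\<^sup>+h. ennreal (1 / sqrt pi * exp (- \<alpha> * (\<Sum>j<n. (y j)\<^sup>2))) * ennreal (exp (- 1 * h\<^sup>2 + 2 * (sqrt s * b) * h)) \<partial>lborel)"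
    proof (intro nn_integral_cong)
      fix h
      have "?P h y = ennreal (exp (\<Sum>j<n. - \<alpha> * (y j)\<^sup>2 + 2 * (sqrt s * h * x j) * y j))"
        by (simp add: prod_ennreal exp_sum)
      also have "(\<Sum>j<n. - \<alpha> * (y j)\<^sup>2 + 2 * (sqrt s * h * x j) * y j) = - \<alpha> * (\<Sum>j<n. (y j)\<^sup>2) + 2 * (sqrt s * b) * h"
        unfolding b_def sum.distrib sum_distrib_left sum_distrib_right by (simp add: mult_ac)
      finally show "ennreal (1 / sqrt pi) * ennreal (exp (- h\<^sup>2)) * ?P h y
        = ennreal (1 / sqrt pi * exp (- \<alpha> * (\<Sum>j<n. (y j)\<^sup>2))) * ennreal (exp (- 1 * h\<^sup>2 + 2 * (sqrt s * b) * h))"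
        by (simp add: ennreal_mult[symmetric] exp_add[symmetric] exp_diff[symmetric] algebra_simps)
    qed
    also have "\<dots> = ennreal (1 / sqrt pi * exp (- \<alpha> * (\<Sum>j<n. (y j)\<^sup>2))) * ennreal (sqrt (pi / 1) * exp ((sqrt s * b)\<^sup>2 / 1))"
      by (subst nn_integral_cmult, simp, subst nn_integral_gauss_real) simp_all
    also have "\<dots> = ennreal (exp (- \<alpha> * (\<Sum>j<n. (y j)\<^sup>2) + s * b\<^sup>2))"
      using s by (simp add: ennreal_mult[symmetric] exp_add[symmetric] power_mult_distrib)
    also have "- \<alpha> * (\<Sum>j<n. (y j)\<^sup>2) + s * b\<^sup>2 = - \<delta> * (\<Sum>j<n. (y j)\<^sup>2) - s * (X * (\<Sum>j<n. (y j)\<^sup>2) - b\<^sup>2)"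
      by (simp add: \<alpha>_def algebra_simps)
    finally show ?thesis by (simp add: b_def)
  qed
  have "(\<integral>\<^sup>+y. ?q y \<partial>?V)
     = (\<integral>\<^sup>+h. \<integral>\<^sup>+y. ennreal (1 / sqrt pi) * ennreal (exp (- h\<^sup>2)) * ?P h y \<partial>?V \<partial>lborel)"
    unfolding lin by (rule Fubini'[symmetric]) measurable
  also have "\<dots> = (\<integral>\<^sup>+h. ennreal (1 / sqrt pi * sqrt (pi / \<alpha>) ^ n) * ennreal (exp (- (\<delta> / \<alpha>) * h\<^sup>2 + 2 * 0 * h)) \<partial>lborel)"
  proof (intro nn_integral_cong)
    fix h
    have "(\<integral>\<^sup>+y. ?P h y \<partial>?V)
      = (\<Prod>j<n. ennreal (sqrt (pi / \<alpha>) * exp ((sqrt s * h * x j)\<^sup>2 / \<alpha>)))"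
      by (subst product_nn_integral_prod[where f = "\<lambda>j t. ennreal (exp (- \<alpha> * t\<^sup>2 + 2 * (sqrt s * h * x j) * t))"])
         (simp_all only: nn_integral_gauss_real[OF \<alpha>], simp_all)
    also have "\<dots> = ennreal (sqrt (pi / \<alpha>) ^ n * exp (\<Sum>j<n. (sqrt s * h * x j)\<^sup>2 / \<alpha>))"
      using \<alpha> by (simp add: prod_ennreal exp_sum prod.distrib)
    also have "(\<Sum>j<n. (sqrt s * h * x j)\<^sup>2 / \<alpha>) = s * X / \<alpha> * h\<^sup>2"
      using s by (simp add: X_def power_mult_distrib sum_distrib_left sum_divide_distrib sum_distrib_right algebra_simps)
    finally have e: "(\<integral>\<^sup>+y. ?P h y \<partial>?V)
        = ennreal (sqrt (pi / \<alpha>) ^ n * exp (s * X / \<alpha> * h\<^sup>2))" .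
    have "- h\<^sup>2 + s * X / \<alpha> * h\<^sup>2 = - (\<delta> / \<alpha>) * h\<^sup>2"
      using \<alpha> by (simp add: \<alpha>_def field_simps)
    then have "exp (- h\<^sup>2) * exp (s * X / \<alpha> * h\<^sup>2) = exp (- (\<delta> / \<alpha>) * h\<^sup>2)"
      by (simp only: exp_add[symmetric])
    then have "1 / sqrt pi * exp (- h\<^sup>2) * (sqrt (pi / \<alpha>) ^ n * exp (s * X / \<alpha> * h\<^sup>2))
        = 1 / sqrt pi * sqrt (pi / \<alpha>) ^ n * exp (- (\<delta> / \<alpha>) * h\<^sup>2 + 2 * 0 * h)" by (simp add: mult_ac)
    then have "ennreal (1 / sqrt pi) * ennreal (exp (- h\<^sup>2)) * ennreal (sqrt (pi / \<alpha>) ^ n * exp (s * X / \<alpha> * h\<^sup>2))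
        = ennreal (1 / sqrt pi * sqrt (pi / \<alpha>) ^ n) * ennreal (exp (- (\<delta> / \<alpha>) * h\<^sup>2 + 2 * 0 * h))"
      using \<alpha> by (subst ennreal_mult[symmetric], simp, simp, subst ennreal_mult[symmetric], simp, simp,
          subst ennreal_mult[symmetric], simp_all)
    then show "(\<integral>\<^sup>+y. ennreal (1 / sqrt pi) * ennreal (exp (- h\<^sup>2)) * ?P h y \<partial>?V)
      = ennreal (1 / sqrt pi * sqrt (pi / \<alpha>) ^ n) * ennreal (exp (- (\<delta> / \<alpha>) * h\<^sup>2 + 2 * 0 * h))"
      by (subst nn_integral_cmult) (measurable, simp only: e)
  qed
  also have "\<dots> = ennreal (1 / sqrt pi * sqrt (pi / \<alpha>) ^ n) * ennreal (sqrt (pi / (\<delta> / \<alpha>)) * exp (0\<^sup>2 / (\<delta> / \<alpha>)))"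
    by (subst nn_integral_cmult, simp, subst nn_integral_gauss_real) (use \<delta> \<alpha> in simp_all)
  also have "\<dots> = ennreal (sqrt (pi / \<alpha>) ^ n * sqrt (\<alpha> / \<delta>))"
    using \<delta> \<alpha> by (simp add: ennreal_mult[symmetric] real_sqrt_divide real_sqrt_mult)
  finally show ?thesis by (simp add: \<alpha>_def)
qed

text \<open>Absorbs the parity of the dimension: up to two surplus half powers of \<open>1 / \<alpha>\<close> are traded for \<open>1 / \<delta>\<close>.\<close>
lemma sqrt_inverse_power_le:
  fixes \<alpha> \<delta> :: real
  assumes "0 < \<delta>" "\<delta> \<le> 1" "\<delta> \<le> \<alpha>" "2 * (q + 1) \<le> k" "k \<le> 2 * (q + 1) + 2"
  shows "sqrt (1 / \<alpha>) ^ k \<le> (1 / \<alpha>) ^ (q + 1) * (1 / \<delta>)"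
proof -
  obtain e where k: "k = 2 * (q + 1) + e" "e \<le> 2"
    using assms(4,5) by (metis add_le_cancel_left le_Suc_ex)
  have "sqrt (1 / \<alpha>) ^ e \<le> sqrt (1 / \<delta>) ^ e"
    using assms by (intro power_mono real_sqrt_le_mono) (simp_all add: frac_le)
  also have "\<dots> \<le> sqrt (1 / \<delta>) ^ 2"
    using assms k by (intro power_increasing) simp_all
  also have "\<dots> = 1 / \<delta>" using assms by simp
  finally have "sqrt (1 / \<alpha>) ^ e \<le> 1 / \<delta>" .
  then have "(sqrt (1 / \<alpha>) ^ 2) ^ (q + 1) * sqrt (1 / \<alpha>) ^ e \<le> (1 / \<alpha>) ^ (q + 1) * (1 / \<delta>)"
    using assms by (intro mult_mono) simp_all
  then show ?thesis unfolding k(1) power_add power_mult .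
qed

lemma borel_measurable_gamma_kernel [measurable]: "gamma_kernel q \<in> borel_measurable borel"
  unfolding gamma_kernel_def[abs_def] by measurable

lemma borel_measurable_gram_det [measurable]:
  "gram_det n \<in> borel_measurable (lborel_pow {..<n})"
  unfolding gram_det_def[abs_def] by measurable

text \<open>The bound is stated with the Gamma kernel of \<open>X\<close> instead of a negative power so that it also covers \<open>X = 0\<close>, where the
  integral on the left may diverge.\<close>
lemma nn_integral_beta_gamma_kernel:
  assumes q: "q \<ge> 1" and \<delta>: "\<delta> > 0" and X: "X \<ge> 0"
  shows "(\<integral>\<^sup>+s. indicator {0<..} s * ennreal (s ^ (q - 1) * (1 / (\<delta> + s * X)) ^ (q + 1)) \<partial>lborel)
    \<le> ennreal (exp (real q) / real q ^ (q - 1) / (real q * \<delta>)) * gamma_kernel q X"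
proof (cases "X = 0")
  case True
  have "exp (real q) / real q ^ (q - 1) / (real q * \<delta>) > 0" using q \<delta> by simp
  then show ?thesis using True q by (simp add: gamma_kernel_0 ennreal_mult_top)
next
  case False
  then have X: "X > 0" using X by simp
  have "(\<integral>\<^sup>+s. indicator {0<..} s * ennreal (s ^ (q - 1) * (1 / (\<delta> + s * X)) ^ (q + 1)) \<partial>lborel)
    \<le> ennreal ((1 / X) ^ q / (real q * \<delta>))" by (rule nn_integral_beta[OF q \<delta> X])
  also have "\<dots> = ennreal (1 / (real q * \<delta>)) * ennreal ((1 / X) ^ q)"
    using q \<delta> X by (simp add: ennreal_mult[symmetric])
  also have "\<dots> \<le> ennreal (1 / (real q * \<delta>)) * (ennreal (exp (real q) / real q ^ (q - 1)) * gamma_kernel q X)"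
    by (intro mult_left_mono gamma_kernel_lower q X) simp
  also have "\<dots> = ennreal (exp (real q) / real q ^ (q - 1) / (real q * \<delta>)) * gamma_kernel q X"
    using q \<delta> by (simp add: mult.assoc[symmetric] ennreal_mult[symmetric]) (simp add: mult_ac)
  finally show ?thesis .
qed

text \<open>The exponent \<open>q\<close> lies below the critical value \<open>n / 2\<close>, so the singularity at the origin of \<open>R^n\<close> is integrable.\<close>
lemma nn_integral_gamma_kernel_real:
  assumes q: "q \<ge> 1" "2 * q + 3 \<le> n" "n \<le> 2 * q + 4" and \<delta>: "0 < \<delta>" "\<delta> \<le> 1"
  shows "(\<integral>\<^sup>+x. ennreal (exp (- \<delta> * (\<Sum>j<n. (x j)\<^sup>2))) * gamma_kernel q (\<Sum>j<n. (x j)\<^sup>2) \<partial>lborel_pow {..<n})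
    \<le> ennreal (sqrt pi ^ n / (real q * \<delta>\<^sup>2))"
proof -
  let ?V = "PiM {..<n} (\<lambda>_. lborel :: real measure)"
  let ?X = "\<lambda>x :: nat \<Rightarrow> real. \<Sum>j<n. (x j)\<^sup>2"
  let ?g = "\<lambda>(x :: nat \<Rightarrow> real) s :: real. ennreal (exp (- \<delta> * (\<Sum>j<n. (x j)\<^sup>2))) * (indicator {0<..} s * ennreal (s ^ (q - 1) * exp (- s * (\<Sum>j<n. (x j)\<^sup>2))))"
  let ?h = "\<lambda>s :: real. indicator {0<..} s * ennreal (s ^ (q - 1) * (1 / (\<delta> + s * 1)) ^ (q + 1))"
  let ?p = "\<lambda>s t. ennreal (exp (- (\<delta> + s) * t\<^sup>2 + 2 * 0 * t))"
  interpret product_sigma_finite "\<lambda>_::nat. lborel :: real measure" by standard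
  interpret P: finite_product_sigma_finite "\<lambda>_::nat. lborel :: real measure" "{..<n}" by standard simp
  interpret pair_sigma_finite "lborel_pow {..<n} :: (nat \<Rightarrow> real) measure" "lborel :: real measure" ..
  have "(\<integral>\<^sup>+x. ennreal (exp (- \<delta> * ?X x)) * gamma_kernel q (?X x) \<partial>?V)
     = (\<integral>\<^sup>+x. \<integral>\<^sup>+s. ?g x s \<partial>lborel \<partial>?V)"
    unfolding gamma_kernel_def by (intro nn_integral_cong nn_integral_cmult[symmetric]) measurable
  also have "\<dots> = (\<integral>\<^sup>+s. \<integral>\<^sup>+x. ?g x s \<partial>?V \<partial>lborel)"
    by (rule Fubini'[symmetric]) measurable
  also have "\<dots> \<le> (\<integral>\<^sup>+s. ennreal (sqrt pi ^ n * (1 / \<delta>)) * ?h s \<partial>lborel)"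
  proof (intro nn_integral_mono)
    fix s :: real
    show "(\<integral>\<^sup>+x. ?g x s \<partial>?V)
      \<le> ennreal (sqrt pi ^ n * (1 / \<delta>)) * ?h s"
    proof (cases "s > 0")
      case True
      have "(\<integral>\<^sup>+x. ?g x s \<partial>?V)
        = (\<integral>\<^sup>+x. ennreal (s ^ (q - 1)) * (\<Prod>j<n. ?p s (x j)) \<partial>?V)"
      proof (intro nn_integral_cong)
        fix x :: "nat \<Rightarrow> real"
        have "exp (- \<delta> * ?X x) * exp (- s * ?X x) = (\<Prod>j<n. exp (- (\<delta> + s) * (x j)\<^sup>2 + 2 * 0 * x j))"
          unfolding exp_add[symmetric] exp_sum[OF finite_lessThan, symmetric]
          by (simp add: sum_distrib_left sum_negf sum_subtractf algebra_simps sum.distrib)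
        then show "?g x s
          = ennreal (s ^ (q - 1)) * (\<Prod>j<n. ?p s (x j))"
          using True by (simp add: prod_ennreal ennreal_mult[symmetric] mult.left_commute prod_nonneg)
      qed
      also have "\<dots> = ennreal (s ^ (q - 1)) * (\<Prod>j<n. ennreal (sqrt (pi / (\<delta> + s)) * exp (0\<^sup>2 / (\<delta> + s))))"
        using True \<delta>
        by (subst nn_integral_cmult, measurable, subst product_nn_integral_prod[where f = "\<lambda>j t. ennreal (exp (- (\<delta> + s) * t\<^sup>2 + 2 * 0 * t))"])
           (simp_all only: nn_integral_gauss_real[of "\<delta> + s"] add_pos_pos, simp_all)
      also have "\<dots> = ennreal (s ^ (q - 1)) * ennreal (sqrt pi ^ n * sqrt (1 / (\<delta> + s)) ^ n)"
        using True \<delta> by (simp add: ennreal_power real_sqrt_divide power_divide)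
      also have "\<dots> \<le> ennreal (s ^ (q - 1)) * ennreal (sqrt pi ^ n * ((1 / (\<delta> + s)) ^ (q + 1) * (1 / \<delta>)))"
        using True \<delta> q by (intro mult_left_mono ennreal_leI sqrt_inverse_power_le) simp_all
      also have "\<dots> = ennreal (sqrt pi ^ n * (1 / \<delta>)) * ?h s"
        using True \<delta> by (simp add: ennreal_mult[symmetric] mult_ac)
      finally show ?thesis .
    qed simp
  qed
  also have "\<dots> = ennreal (sqrt pi ^ n * (1 / \<delta>)) * (\<integral>\<^sup>+s. ?h s \<partial>lborel)"
    by (rule nn_integral_cmult) measurable
  also have "\<dots> \<le> ennreal (sqrt pi ^ n * (1 / \<delta>)) * ennreal ((1 / 1) ^ q / (real q * \<delta>))"
    using q \<delta> by (intro mult_left_mono nn_integral_beta) simp_all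
  also have "\<dots> = ennreal (sqrt pi ^ n / (real q * \<delta>\<^sup>2))"
    using \<delta> by (simp add: ennreal_mult[symmetric] power2_eq_square mult_ac)
  finally show ?thesis .
qed

text \<open>For a fixed real part \<open>x\<close> the Gram determinant is \<open>|x|^2\<close> times the squared distance of \<open>y\<close> from the line
  through \<open>x\<close>. The \<open>y\<close>-integral thus sees a singularity in dimension \<open>n - 1\<close>, whence \<open>2 q < n - 1\<close>, and it returns the
  Gamma kernel of \<open>|x|^2\<close>, which remains to be integrated over \<open>x\<close>.\<close>
lemma nn_integral_gamma_kernel_gram_det:
  assumes q: "q \<ge> 1" "2 * q + 3 \<le> n" "n \<le> 2 * q + 4" and \<delta>: "0 < \<delta>" "\<delta> \<le> 1"
  shows "(\<integral>\<^sup>+v. ennreal (exp (- \<delta> * (\<Sum>j<n. (cmod (v j))\<^sup>2))) * gamma_kernel q (gram_det n v) \<partial>lborel_pow {..<n})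
    \<le> ennreal (exp (real q) / real q ^ (q - 1) * pi ^ n / ((real q)\<^sup>2 * \<delta> ^ 5))"
proof -
  let ?V = "PiM {..<n} (\<lambda>_. lborel :: real measure)"
  interpret product_sigma_finite "\<lambda>_::nat. lborel :: real measure" by standard
  interpret P: finite_product_sigma_finite "\<lambda>_::nat. lborel :: real measure" "{..<n}" by standard simp
  interpret pair_sigma_finite "lborel_pow {..<n} :: (nat \<Rightarrow> real) measure" "lborel :: real measure" ..
  define \<kappa> where "\<kappa> = exp (real q) / real q ^ (q - 1) / (real q * \<delta>)"
  have \<kappa>: "\<kappa> \<ge> 0" using q \<delta> by (simp add: \<kappa>_def)
  define X where "X x = (\<Sum>j<n. (x j)\<^sup>2)" for x :: "nat \<Rightarrow> real"
  define b where "b x y = (\<Sum>j<n. x j * y j)" for x y :: "nat \<Rightarrow> real"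
  have X0: "X x \<ge> 0" for x by (simp add: X_def sum_nonneg)
  have Xm [measurable]: "X \<in> borel_measurable (lborel_pow {..<n})"
    unfolding X_def[abs_def] by measurable
  have bm [measurable]: "b x \<in> borel_measurable (lborel_pow {..<n})" for x
    unfolding b_def[abs_def] by measurable
  have inner: "(\<integral>\<^sup>+y. ennreal (exp (- \<delta> * (X x + X y))) * gamma_kernel q (X x * X y - (b x y)\<^sup>2) \<partial>?V)
     \<le> ennreal (sqrt pi ^ n * (1 / \<delta>\<^sup>2) * \<kappa>) * (ennreal (exp (- \<delta> * X x)) * gamma_kernel q (X x))" for x
  proof -
    let ?g = "\<lambda>(y :: nat \<Rightarrow> real) s :: real. ennreal (exp (- \<delta> * (X x + X y))) * (indicator {0<..} s * ennreal (s ^ (q - 1) * exp (- s * (X x * X y - (b x y)\<^sup>2))))"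
    let ?h = "\<lambda>s :: real. indicator {0<..} s * ennreal (s ^ (q - 1) * (1 / (\<delta> + s * X x)) ^ (q + 1))"
    have "(\<integral>\<^sup>+y. ennreal (exp (- \<delta> * (X x + X y))) * gamma_kernel q (X x * X y - (b x y)\<^sup>2) \<partial>?V)
      = (\<integral>\<^sup>+y. \<integral>\<^sup>+s. ?g y s \<partial>lborel \<partial>?V)"
      unfolding gamma_kernel_def by (intro nn_integral_cong nn_integral_cmult[symmetric]) measurable
    also have "\<dots> = (\<integral>\<^sup>+s. \<integral>\<^sup>+y. ?g y s \<partial>?V \<partial>lborel)"
      by (rule Fubini'[symmetric]) measurable
    also have "\<dots> \<le> (\<integral>\<^sup>+s. ennreal (sqrt pi ^ n * (1 / \<delta>\<^sup>2) * exp (- \<delta> * X x)) * ?h s \<partial>lborel)"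
    proof (intro nn_integral_mono)
      fix s :: real
      show "(\<integral>\<^sup>+y. ?g y s \<partial>?V)
        \<le> ennreal (sqrt pi ^ n * (1 / \<delta>\<^sup>2) * exp (- \<delta> * X x)) * ?h s"
      proof (cases "s > 0")
        case True
        define \<alpha> where "\<alpha> = \<delta> + s * X x"
        have \<alpha>: "\<alpha> \<ge> \<delta>" "\<alpha> > 0" using True \<delta> X0[of x] by (simp_all add: \<alpha>_def add_pos_nonneg)
        have bound: "sqrt (pi / \<alpha>) ^ n * sqrt (\<alpha> / \<delta>) \<le> sqrt pi ^ n * (1 / \<delta>\<^sup>2) * (1 / \<alpha>) ^ (q + 1)"
        proof -
          have "n = Suc (n - 1)" using q by simp
          then have "sqrt (pi / \<alpha>) ^ n = sqrt pi ^ n * (sqrt (1 / \<alpha>) ^ (n - 1) * sqrt (1 / \<alpha>))"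
            by (metis power_Suc2 power_mult_distrib real_sqrt_mult mult.right_neutral times_divide_eq_right)
          moreover have "sqrt (1 / \<alpha>) * sqrt (\<alpha> / \<delta>) = sqrt (1 / \<delta>)"
            using \<alpha> \<delta> by (simp add: real_sqrt_mult[symmetric])
          ultimately have "sqrt (pi / \<alpha>) ^ n * sqrt (\<alpha> / \<delta>) = sqrt pi ^ n * (sqrt (1 / \<alpha>) ^ (n - 1) * sqrt (1 / \<delta>))"
            by (simp only: mult.assoc)
          also have "\<dots> \<le> sqrt pi ^ n * ((1 / \<alpha>) ^ (q + 1) * (1 / \<delta>) * (1 / \<delta>))"
          proof (intro mult_left_mono mult_mono sqrt_inverse_power_le)
            show "sqrt (1 / \<delta>) \<le> 1 / \<delta>" using \<delta> by (intro real_le_lsqrt) (simp_all add: power2_eq_square field_simps)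
          qed (use \<alpha> \<delta> q in simp_all)
          finally show ?thesis by (simp add: power2_eq_square mult_ac)
        qed
        have "(\<integral>\<^sup>+y. ?g y s \<partial>?V)
          = (\<integral>\<^sup>+y. ennreal (exp (- \<delta> * X x) * s ^ (q - 1)) * ennreal (exp (- \<delta> * X y - s * (X x * X y - (b x y)\<^sup>2))) \<partial>?V)"
        proof (intro nn_integral_cong)
          fix y
          have "exp (- \<delta> * (X x + X y)) * exp (- s * (X x * X y - (b x y)\<^sup>2)) = exp (- \<delta> * X x) * exp (- \<delta> * X y - s * (X x * X y - (b x y)\<^sup>2))"
            unfolding exp_add[symmetric] by (simp add: algebra_simps)
          then show "?g y s
            = ennreal (exp (- \<delta> * X x) * s ^ (q - 1)) * ennreal (exp (- \<delta> * X y - s * (X x * X y - (b x y)\<^sup>2)))"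
            using True by (simp add: ennreal_mult[symmetric] mult_ac)
        qed
        also have "\<dots> = ennreal (exp (- \<delta> * X x) * s ^ (q - 1)) * ennreal (sqrt (pi / \<alpha>) ^ n * sqrt (\<alpha> / \<delta>))"
          by (subst nn_integral_cmult, measurable)
             (use nn_integral_gauss_rank_one[of \<delta> s n x] \<delta> True in \<open>simp add: X_def b_def \<alpha>_def\<close>)
        also have "\<dots> \<le> ennreal (exp (- \<delta> * X x) * s ^ (q - 1)) * ennreal (sqrt pi ^ n * (1 / \<delta>\<^sup>2) * (1 / \<alpha>) ^ (q + 1))"
          by (intro mult_left_mono ennreal_leI bound) simp
        also have "\<dots> = ennreal (sqrt pi ^ n * (1 / \<delta>\<^sup>2) * exp (- \<delta> * X x)) * ?h s"
          using True \<alpha> \<delta> by (simp add: ennreal_mult[symmetric] mult_ac \<alpha>_def[symmetric])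
        finally show ?thesis .
      qed simp
    qed
    also have "\<dots> = ennreal (sqrt pi ^ n * (1 / \<delta>\<^sup>2) * exp (- \<delta> * X x)) * (\<integral>\<^sup>+s. ?h s \<partial>lborel)"
      by (rule nn_integral_cmult) measurable
    also have "\<dots> \<le> ennreal (sqrt pi ^ n * (1 / \<delta>\<^sup>2) * exp (- \<delta> * X x)) * (ennreal \<kappa> * gamma_kernel q (X x))"
      unfolding \<kappa>_def by (intro mult_left_mono nn_integral_beta_gamma_kernel q \<delta> X0) simp
    also have "\<dots> = ennreal (sqrt pi ^ n * (1 / \<delta>\<^sup>2) * \<kappa>) * (ennreal (exp (- \<delta> * X x)) * gamma_kernel q (X x))"
      using \<kappa> by (simp add: mult.assoc[symmetric] ennreal_mult[symmetric]) (simp add: mult_ac)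
    finally show ?thesis .
  qed
  have meas: "(\<lambda>v. ennreal (exp (- \<delta> * (\<Sum>j<n. (cmod (v j))\<^sup>2))) * gamma_kernel q (gram_det n v)) \<in> borel_measurable (lborel_pow {..<n})"
    by measurable
  have "(\<integral>\<^sup>+v. ennreal (exp (- \<delta> * (\<Sum>j<n. (cmod (v j))\<^sup>2))) * gamma_kernel q (gram_det n v) \<partial>lborel_pow {..<n})
    = (\<integral>\<^sup>+x. \<integral>\<^sup>+y. ennreal (exp (- \<delta> * (X x + X y))) * gamma_kernel q (X x * X y - (b x y)\<^sup>2) \<partial>?V \<partial>?V)"
    by (subst nn_integral_PiM_complex[OF finite_lessThan meas])
       (simp add: gram_det_def cmod_power2 sum.distrib X_def b_def)
  also have "\<dots> \<le> (\<integral>\<^sup>+x. ennreal (sqrt pi ^ n * (1 / \<delta>\<^sup>2) * \<kappa>) * (ennreal (exp (- \<delta> * X x)) * gamma_kernel q (X x)) \<partial>?V)"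
    by (intro nn_integral_mono inner)
  also have "\<dots> = ennreal (sqrt pi ^ n * (1 / \<delta>\<^sup>2) * \<kappa>) * (\<integral>\<^sup>+x. ennreal (exp (- \<delta> * X x)) * gamma_kernel q (X x) \<partial>?V)"
    by (rule nn_integral_cmult) measurable
  also have "\<dots> \<le> ennreal (sqrt pi ^ n * (1 / \<delta>\<^sup>2) * \<kappa>) * ennreal (sqrt pi ^ n / (real q * \<delta>\<^sup>2))"
    unfolding X_def by (intro mult_left_mono nn_integral_gamma_kernel_real q \<delta>) simp
  also have "\<dots> = ennreal (exp (real q) / real q ^ (q - 1) * pi ^ n / ((real q)\<^sup>2 * \<delta> ^ 5))"
  proof -
    have "sqrt pi ^ n * sqrt pi ^ n = pi ^ n" by (simp add: power_mult_distrib[symmetric])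
    then have "sqrt pi ^ n * (1 / \<delta>\<^sup>2) * \<kappa> * (sqrt pi ^ n / (real q * \<delta>\<^sup>2)) = exp (real q) / real q ^ (q - 1) * pi ^ n / ((real q)\<^sup>2 * \<delta> ^ 5)"
      using q \<delta> by (simp add: \<kappa>_def field_simps power2_eq_square eval_nat_numeral)
    then show ?thesis using \<kappa> by (simp add: ennreal_mult[symmetric])
  qed
  finally show ?thesis .
qed

section \<open>The second moment of the determinant\<close>

lemma fact_le_exp: "n \<ge> 1 \<Longrightarrow> fact n \<le> exp 1 * real n * (real n / exp 1) ^ n"
proof (induction n rule: nat_induct_at_least)
  case base
  then show ?case by simp
next
  case (Suc n)
  have n: "real n > 0" using Suc.hyps by simp
  have "real n / (real n + 1) = 1 - 1 / (real n + 1)" using n by (simp add: field_simps)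
  also have "\<dots> \<le> exp (- (1 / (real n + 1)))" using exp_ge_add_one_self[of "- (1 / (real n + 1))"] by simp
  finally have "(real n / (real n + 1)) ^ (n + 1) \<le> exp (- (1 / (real n + 1))) ^ (n + 1)"
    using n by (intro power_mono) simp_all
  also have "\<dots> = exp (-1)" unfolding exp_of_nat_mult[symmetric] by simp
  finally have "real n ^ (n + 1) \<le> exp (-1) * (real n + 1) ^ (n + 1)"
    using n by (simp only: power_divide pos_divide_le_eq zero_less_power add_pos_pos zero_less_one)
  then have "exp 1 * (real n ^ (n + 1) / exp 1 ^ n) \<le> exp 1 * (exp (-1) * (real n + 1) ^ (n + 1) / exp 1 ^ n)"
    by (intro mult_left_mono divide_right_mono) simp_all
  also have "\<dots> = exp 1 * ((real n + 1) / exp 1) ^ Suc n"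
    by (simp add: exp_minus divide_inverse power_mult_distrib power_inverse mult_ac)
  finally have step: "exp 1 * real n * (real n / exp 1) ^ n \<le> exp 1 * ((real n + 1) / exp 1) ^ Suc n"
    by (simp add: power_divide)
  have "fact (Suc n) = (real n + 1) * fact n" by (simp add: algebra_simps)
  also have "\<dots> \<le> (real n + 1) * (exp 1 * ((real n + 1) / exp 1) ^ Suc n)"
    using Suc.IH step by (intro mult_left_mono) simp_all
  finally show ?case by (simp add: mult_ac add.commute)
qed

text \<open>Expanding the product chooses a set \<open>S\<close> of fixed points, and \<open>(n - card S)!\<close> permutations fix \<open>S\<close>.\<close>
lemma sum_permutes_fixed_points:
  fixes x :: real
  shows "(\<Sum>p | p permutes {..<n}. \<Prod>i<n. 1 + (if p i = i then x else 0)) = fact n * (\<Sum>k\<le>n. x ^ k / fact k)"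
proof -
  have fixes_card: "card {p. p permutes {..<n} \<and> (\<forall>i\<in>S. p i = i)} = fact (n - card S)" if "S \<subseteq> {..<n}" for S
  proof -
    have "{p. p permutes {..<n} \<and> (\<forall>i\<in>S. p i = i)} = {p. p permutes ({..<n} - S)}"
      by (auto intro: permutes_superset permutes_subset simp: permutes_not_in)
    then show ?thesis using that by (simp add: card_permutations[OF refl] card_Diff_subset finite_subset)
  qed
  have "(\<Sum>p | p permutes {..<n}. \<Prod>i<n. 1 + (if p i = i then x else 0))
      = (\<Sum>p | p permutes {..<n}. \<Sum>S\<in>Pow {..<n}. if \<forall>i\<in>S. p i = i then x ^ card S else 0)"
  proof (intro sum.cong refl)
    fix p
    have "(\<Prod>i<n. 1 + (if p i = i then x else 0)) = (\<Prod>i<n. (if p i = i then x else 0) + 1)"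
      by (simp add: add.commute)
    also have "\<dots> = (\<Sum>S\<in>Pow {..<n}. (\<Prod>i\<in>S. if p i = i then x else 0) * (\<Prod>i\<in>{..<n} - S. 1))"
      by (rule prod_add) simp
    also have "\<dots> = (\<Sum>S\<in>Pow {..<n}. if \<forall>i\<in>S. p i = i then x ^ card S else 0)"
    proof (intro sum.cong refl)
      fix S assume "S \<in> Pow {..<n}"
      then have "finite S" by (auto intro: finite_subset)
      then show "(\<Prod>i\<in>S. if p i = i then x else 0) * (\<Prod>i\<in>{..<n} - S. 1) = (if \<forall>i\<in>S. p i = i then x ^ card S else 0)"
        by (auto simp: prod_zero)
    qed
    finally show "(\<Prod>i<n. 1 + (if p i = i then x else 0)) = (\<Sum>S\<in>Pow {..<n}. if \<forall>i\<in>S. p i = i then x ^ card S else 0)" .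
  qed
  also have "\<dots> = (\<Sum>S\<in>Pow {..<n}. \<Sum>p | p permutes {..<n}. if \<forall>i\<in>S. p i = i then x ^ card S else 0)"
    by (rule sum.swap)
  also have "\<dots> = (\<Sum>S\<in>Pow {..<n}. fact (n - card S) * x ^ card S)"
  proof (intro sum.cong refl)
    fix S assume "S \<in> Pow {..<n}"
    then show "(\<Sum>p | p permutes {..<n}. if \<forall>i\<in>S. p i = i then x ^ card S else 0) = fact (n - card S) * x ^ card S"
      using fixes_card[of S] finite_permutations[of "{..<n}"]
      by (simp add: sum.If_cases Int_def conj_commute)
  qed
  also have "\<dots> = (\<Sum>k\<le>n. \<Sum>S\<in>{S \<in> Pow {..<n}. card S = k}. fact (n - card S) * x ^ card S)"
    by (rule sum.group[symmetric]) (auto dest: card_mono[rotated])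
  also have "\<dots> = (\<Sum>k\<le>n. real (n choose k) * (fact (n - k) * x ^ k))"
    by (intro sum.cong refl) (simp add: n_subsets Pow_def)
  also have "\<dots> = fact n * (\<Sum>k\<le>n. x ^ k / fact k)"
    unfolding sum_distrib_left by (intro sum.cong refl) (simp add: binomial_fact)
  finally show ?thesis .
qed

text \<open>The matrix with entries \<open>x\<close>, minus \<open>w\<close> times the identity. The size is a separate argument because minors
  of one and the same array \<open>x\<close> are compared.\<close>
definition shifted :: "nat \<Rightarrow> complex \<Rightarrow> (nat \<times> nat \<Rightarrow> complex) \<Rightarrow> complex mat" where
  "shifted k w x = Matrix.mat k k (\<lambda>(i, j). x (i, j) - (if i = j then w else 0))"

lemma shifted_carrier [simp]: "shifted k w x \<in> carrier_mat k k"
  by (simp add: shifted_def)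

lemma shifted_index [simp]:
  "i < k \<Longrightarrow> j < k \<Longrightarrow> shifted k w x $$ (i, j) = x (i, j) - (if i = j then w else 0)"
  by (simp add: shifted_def)

text \<open>Laws of one matrix entry for which the second moment of the determinant can be computed.\<close>
locale centred_unit_law = prob_space \<mu> for \<mu> :: "complex measure" +
  assumes sets_eq [simp, measurable_cong]: "sets \<mu> = sets borel"
    and integrable_id: "integrable \<mu> (\<lambda>z. z)"
    and integrable_sq: "integrable \<mu> (\<lambda>z. (cmod z)\<^sup>2)"
    and mean_zero: "(\<integral>z. z \<partial>\<mu>) = 0"
    and second_moment: "(\<integral>z. (cmod z)\<^sup>2 \<partial>\<mu>) = 1"
begin

sublocale product: product_prob_space "\<lambda>_::nat \<times> nat. \<mu>"
  by (intro product_prob_spaceI prob_space_axioms)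

abbreviation law :: "nat \<Rightarrow> (nat \<times> nat \<Rightarrow> complex) measure" where
  "law n \<equiv> PiM ({..<n} \<times> {..<n}) (\<lambda>_. \<mu>)"

lemma covariance:
  fixes a b :: complex
  shows "integrable \<mu> (\<lambda>z. (z - a) * cnj (z - b))" "(\<integral>z. (z - a) * cnj (z - b) \<partial>\<mu>) = 1 + a * cnj b"
proof -
  have c: "integrable \<mu> (\<lambda>z. cnj z)" "(\<integral>z. cnj z \<partial>\<mu>) = 0"
    using integrable_id mean_zero by (simp_all add: integrable_cnj)
  have s: "integrable \<mu> (\<lambda>z. complex_of_real ((cmod z)\<^sup>2))" "(\<integral>z. complex_of_real ((cmod z)\<^sup>2) \<partial>\<mu>) = 1"
    using integrable_sq second_moment by (simp_all only: integrable_of_real integral_complex_of_real of_real_1)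
  have e: "(z - a) * cnj (z - b) = complex_of_real ((cmod z)\<^sup>2) - z * cnj b - a * cnj z + a * cnj b" for z
    unfolding complex_norm_square by (simp add: algebra_simps)
  show "integrable \<mu> (\<lambda>z. (z - a) * cnj (z - b))"
    unfolding e using c s integrable_id by (intro Bochner_Integration.integrable_add Bochner_Integration.integrable_diff) simp_all
  show "(\<integral>z. (z - a) * cnj (z - b) \<partial>\<mu>) = 1 + a * cnj b"
    unfolding e using c s integrable_id mean_zero by (simp add: prob_space del: of_real_power)
qed

lemma affine_mean:
  fixes a :: complex
  shows "integrable \<mu> (\<lambda>z. z - a)" "(\<integral>z. z - a \<partial>\<mu>) = - a"
    "integrable \<mu> (\<lambda>z. cnj (z - a))" "(\<integral>z. cnj (z - a) \<partial>\<mu>) = - cnj a"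
proof -
  show 1: "integrable \<mu> (\<lambda>z. z - a)" "(\<integral>z. z - a \<partial>\<mu>) = - a"
    using integrable_id mean_zero by (simp_all add: prob_space)
  show "integrable \<mu> (\<lambda>z. cnj (z - a))" by (intro integrable_cnj 1)
  have "(\<integral>z. cnj (z - a) \<partial>\<mu>) = cnj (\<integral>z. z - a \<partial>\<mu>)" by (rule Bochner_Integration.integral_cnj)
  then show "(\<integral>z. cnj (z - a) \<partial>\<mu>) = - cnj a" unfolding 1(2) by simp
qed

text \<open>If \<open>s\<close> and \<open>t\<close> differ at \<open>i\<close>, then one of the positions \<open>(i, s i)\<close>, \<open>(i, t i)\<close> lies off the diagonal. Its entry is centred
  and appears in only one of the two products, so the expectation vanishes.\<close>
lemma permutation_products_orthogonal:
  fixes n :: nat and w :: complex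
  assumes s: "s permutes {..<n}" and t: "t permutes {..<n}"
  defines "A \<equiv> shifted n w"
  shows "integrable (law n) (\<lambda>x. (\<Prod>i<n. A x $$ (i, s i)) * cnj (\<Prod>i<n. A x $$ (i, t i)))"
    and "(\<integral>x. (\<Prod>i<n. A x $$ (i, s i)) * cnj (\<Prod>i<n. A x $$ (i, t i)) \<partial>law n)
      = (if s = t then (\<Prod>i<n. of_real (1 + (if s i = i then (cmod w)\<^sup>2 else 0))) else 0)"
proof -
  let ?f = "\<lambda>x. (\<Prod>i<n. A x $$ (i, s i)) * cnj (\<Prod>i<n. A x $$ (i, t i))"
  let ?v = "(if s = t then (\<Prod>i<n. of_real (1 + (if s i = i then (cmod w)\<^sup>2 else 0))) else 0) :: complex"
  define d where "d i j = (if i = j then w else 0)" for i j :: nat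
  \<comment> \<open>The factor that the single entry \<open>(i, j)\<close> contributes to the product.\<close>
  define f where "f = (\<lambda>(i, j) z. (if j = s i then z - d i j else 1) * (if j = t i then cnj (z - d i j) else 1))"
  have st: "s i < n" "t i < n" if "i < n" for i
    using that permutes_in_image[OF s, of i] permutes_in_image[OF t, of i] by auto
  have f_int: "integrable \<mu> (f k)" for k
  proof (cases k)
    case (Pair i j)
    then show ?thesis
      using covariance(1)[of "d i j" "d i j"] affine_mean(1,3)[of "d i j"]
      by (cases "j = s i"; cases "j = t i") (simp_all add: f_def)
  qed
  have f_val: "(\<integral>z. f (i, j) z \<partial>\<mu>) = (if j = s i then if j = t i then 1 + d i j * cnj (d i j) else - d i j else if j = t i then - cnj (d i j) else 1)" for i j
    using covariance(2)[of "d i j" "d i j"] affine_mean(2,4)[of "d i j"]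
    by (cases "j = s i"; cases "j = t i") (simp_all add: f_def prob_space)
  have prod_f: "?f x = (\<Prod>k\<in>{..<n} \<times> {..<n}. f k (x k))" for x
  proof -
    have "(\<Prod>k\<in>{..<n} \<times> {..<n}. f k (x k)) = (\<Prod>i<n. \<Prod>j<n. f (i, j) (x (i, j)))"
      by (simp add: prod.cartesian_product)
    also have "\<dots> = (\<Prod>i<n. (x (i, s i) - d i (s i)) * cnj (x (i, t i) - d i (t i)))"
      using st by (intro prod.cong refl) (simp add: f_def prod.distrib prod.delta')
    also have "\<dots> = (\<Prod>i<n. A x $$ (i, s i) * cnj (A x $$ (i, t i)))"
      using st by (intro prod.cong refl) (simp add: A_def d_def)
    finally show ?thesis by (simp add: prod.distrib cnj_prod)
  qed
  show "integrable (law n) (\<lambda>x. ?f x)"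
    unfolding prod_f by (rule product.product_integrable_prod) (simp_all add: f_int)
  have "(\<integral>x. ?f x \<partial>law n) = (\<Prod>k\<in>{..<n} \<times> {..<n}. \<integral>z. f k z \<partial>\<mu>)"
    unfolding prod_f by (rule product.product_integral_prod) (simp_all add: f_int)
  also have "\<dots> = ?v"
  proof (cases "s = t")
    case True
    have "(\<Prod>k\<in>{..<n} \<times> {..<n}. \<integral>z. f k z \<partial>\<mu>) = (\<Prod>i<n. \<Prod>j<n. if j = s i then 1 + d i j * cnj (d i j) else 1)"
      unfolding f_val True by (subst prod.cartesian_product) (intro prod.cong refl, clarsimp simp: f_val True)
    also have "\<dots> = (\<Prod>i<n. of_real (1 + (if s i = i then (cmod w)\<^sup>2 else 0)))"
      using st by (intro prod.cong refl) (auto simp: prod.delta' d_def complex_norm_square simp del: of_real_power)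
    finally show ?thesis using True by simp
  next
    case False
    have "\<exists>i. s i \<noteq> t i" using False by auto
    then obtain i where i: "s i \<noteq> t i" by blast
    have "i < n" using i s t by (metis lessThan_iff permutes_not_in)
    \<comment> \<open>An off-diagonal position hit by exactly one of the two permutations.\<close>
    define j where "j = (if s i \<noteq> i then s i else t i)"
    have "j < n" using st \<open>i < n\<close> by (simp add: j_def)
    have "(\<integral>z. f (i, j) z \<partial>\<mu>) = 0" using i by (auto simp: f_val j_def d_def)
    then have "(\<Prod>k\<in>{..<n} \<times> {..<n}. \<integral>z. f k z \<partial>\<mu>) = 0"
      using \<open>i < n\<close> \<open>j < n\<close> by (intro prod_zero) (auto intro!: bexI[of _ "(i, j)"])
    then show ?thesis using False by simp
  qed
  finally show "(\<integral>x. ?f x \<partial>law n)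
      = ?v" .
qed

text \<open>Only the diagonal terms of the squared Leibniz expansion survive; they are counted by fixed points.\<close>
lemma second_moment_det:
  "(\<integral>\<^sup>+x. ennreal ((cmod (Determinant.det (shifted n w x)))\<^sup>2) \<partial>law n)
    = ennreal (fact n * (\<Sum>k\<le>n. ((cmod w)\<^sup>2) ^ k / fact k))"
proof -
  let ?d = "\<lambda>x. (cmod (Determinant.det (shifted n w x)))\<^sup>2"
  let ?P = "{p. p permutes {..<n}}"
  define g where "g p x = (\<Prod>i<n. shifted n w x $$ (i, p i))" for p x
  have fin: "finite ?P" by (simp add: finite_permutations)
  have det: "Determinant.det (shifted n w x) = (\<Sum>p\<in>?P. of_int (sign p) * g p x)" for x
    by (simp add: det_def'[of _ n] g_def atLeast0LessThan)
  have sq: "complex_of_real (?d x)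
      = (\<Sum>s\<in>?P. \<Sum>t\<in>?P. of_int (sign s) * of_int (sign t) * (g s x * cnj (g t x)))" for x
    unfolding complex_norm_square det cnj_sum sum_product by (simp add: mult_ac)
  have int: "integrable (law n) (\<lambda>x. g s x * cnj (g t x))" if "s \<in> ?P" "t \<in> ?P" for s t
    using permutation_products_orthogonal(1)[of s n t w] that by (simp add: g_def)
  have int_sq: "integrable (law n) (\<lambda>x. complex_of_real (?d x))"
    unfolding sq by (intro Bochner_Integration.integrable_sum integrable_mult_right int)
  have "complex_of_real (\<integral>x. ?d x \<partial>law n)
      = (\<integral>x. complex_of_real (?d x) \<partial>law n)"
    by (rule integral_complex_of_real[symmetric])
  also have "\<dots> = (\<Sum>s\<in>?P. \<Sum>t\<in>?P. of_int (sign s) * of_int (sign t) * (\<integral>x. g s x * cnj (g t x) \<partial>law n))"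
    unfolding sq using int
    by (subst Bochner_Integration.integral_sum[OF Bochner_Integration.integrable_sum[OF integrable_mult_right]])
       (simp_all add: Bochner_Integration.integral_sum[OF integrable_mult_right])
  also have "\<dots> = (\<Sum>s\<in>?P. \<Sum>t\<in>?P. if s = t then (\<Prod>i<n. complex_of_real (1 + (if s i = i then (cmod w)\<^sup>2 else 0))) else 0)"
    using permutation_products_orthogonal(2)[of _ n _ w]
    by (intro sum.cong refl) (auto simp: g_def sign_def)
  also have "\<dots> = (\<Sum>s\<in>?P. (\<Prod>i<n. complex_of_real (1 + (if s i = i then (cmod w)\<^sup>2 else 0))))"
    using fin by (intro sum.cong refl) simp
  also have "\<dots> = complex_of_real (\<Sum>s\<in>?P. \<Prod>i<n. 1 + (if s i = i then (cmod w)\<^sup>2 else 0))"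
    by (simp only: of_real_sum of_real_prod)
  also have "\<dots> = complex_of_real (fact n * (\<Sum>k\<le>n. ((cmod w)\<^sup>2) ^ k / fact k))"
    by (simp only: sum_permutes_fixed_points)
  finally have val: "(\<integral>x. ?d x \<partial>law n) = fact n * (\<Sum>k\<le>n. ((cmod w)\<^sup>2) ^ k / fact k)"
    by (simp only: of_real_eq_iff)
  show ?thesis
    unfolding val[symmetric]
    by (rule nn_integral_eq_integral) (use int_sq integrable_Re[OF int_sq] in simp_all)
qed

end

section \<open>Small ball bounds for the inverse matrix\<close>

lemma borel_measurable_det:
  assumes "\<And>x. B x \<in> carrier_mat k k"
    and "\<And>i j. i < k \<Longrightarrow> j < k \<Longrightarrow> (\<lambda>x. B x $$ (i, j) :: complex) \<in> borel_measurable N"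
  shows "(\<lambda>x. Determinant.det (B x)) \<in> borel_measurable N"
proof -
  have "(\<lambda>x. \<Sum>p | p permutes {0..<k}. signof p * (\<Prod>i = 0..<k. B x $$ (i, p i))) \<in> borel_measurable N"
  proof (intro borel_measurable_sum borel_measurable_times borel_measurable_const borel_measurable_prod assms(2))
    fix p i assume "p \<in> {p. p permutes {0..<k}}" "i \<in> {0..<k}"
    then show "i < k" "p i < k" using permutes_in_image[of p "{0..<k}" i] by auto
  qed
  then show ?thesis using assms(1) by (simp add: det_def'[of _ k])
qed

lemma cofactor_row_update:
  assumes "i < k" "j < k" "l < k"
  shows "cofactor (shifted k w (x((i, j) := y))) i l = cofactor (shifted k w x) i l"
proof -
  have "mat_delete (shifted k w (x((i, j) := y))) i l = mat_delete (shifted k w x) i l"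
    using assms by (auto simp: mat_delete_def shifted_def intro!: eq_matI)
  then show ?thesis by (simp add: cofactor_def)
qed

text \<open>Laplace expansion along row \<open>i\<close>: the cofactors of that row do not see its entries.\<close>
lemma det_entry_update:
  assumes ij: "i < k" "j < k"
  shows "Determinant.det (shifted k w (x((i, j) := y)))
    = y * cofactor (shifted k w x) i j + Determinant.det (shifted k w (x((i, j) := 0)))"
proof -
  have "Determinant.det (shifted k w (x((i, j) := y)))
      = (\<Sum>l<k. shifted k w (x((i, j) := y)) $$ (i, l) * cofactor (shifted k w x) i l)" for y
    by (subst laplace_expansion_row[OF shifted_carrier ij(1)]) (use ij in \<open>simp add: cofactor_row_update\<close>)
  then have "Determinant.det (shifted k w (x((i, j) := y))) - Determinant.det (shifted k w (x((i, j) := 0)))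
      = (\<Sum>l<k. (shifted k w (x((i, j) := y)) $$ (i, l) - shifted k w (x((i, j) := 0)) $$ (i, l)) * cofactor (shifted k w x) i l)"
    by (simp only: sum_subtractf[symmetric] left_diff_distrib[symmetric])
  also have "\<dots> = (\<Sum>l<k. if l = j then y * cofactor (shifted k w x) i j else 0)"
    using ij by (intro sum.cong) auto
  finally show ?thesis using ij by (simp add: algebra_simps)
qed

context centred_unit_law
begin

lemma borel_measurable_entry:
  "i < k \<Longrightarrow> j < k \<Longrightarrow> k \<le> n \<Longrightarrow> (\<lambda>x. shifted k w x $$ (i, j)) \<in> borel_measurable (law n)"
proof -
  assume ij: "i < k" "j < k" "k \<le> n"
  have "(\<lambda>x. x (i, j) - (if i = j then w else 0)) \<in> borel_measurable (law n)"
    using ij by (intro borel_measurable_diff borel_measurable_const) (auto intro!: measurable_PiM_component_rev)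
  then show ?thesis using ij by simp
qed

lemma borel_measurable_det_shifted [measurable]:
  "k \<le> n \<Longrightarrow> (\<lambda>x. Determinant.det (shifted k w x)) \<in> borel_measurable (law n)"
  by (rule borel_measurable_det[of _ k]) (simp, rule borel_measurable_entry)

lemma borel_measurable_cofactor_shifted [measurable]:
  assumes "k \<le> n" "i < k" "j < k"
  shows "(\<lambda>x. cofactor (shifted k w x) i j) \<in> borel_measurable (law n)"
  unfolding cofactor_def
proof (intro borel_measurable_times borel_measurable_const borel_measurable_det[of _ "k - 1"])
  fix i' j' assume ij: "i' < k - 1" "j' < k - 1"
  have "(\<lambda>x. mat_delete (shifted k w x) i j $$ (i', j'))
      = (\<lambda>x. shifted k w x $$ (if i' < i then i' else Suc i', if j' < j then j' else Suc j'))"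
    using ij by (simp add: mat_delete_def shifted_def)
  then show "(\<lambda>x. mat_delete (shifted k w x) i j $$ (i', j')) \<in> borel_measurable (law n)"
    using ij assms by (simp only:) (rule borel_measurable_entry; auto)
qed (rule mat_delete_carrier[OF shifted_carrier])

end

text \<open>Anti-concentration of the entries keeps the inverse matrix polynomially bounded.\<close>
locale entry_law = centred_unit_law +
  assumes small_ball: "\<And>a r. r > 0 \<Longrightarrow> emeasure \<mu> (cball a r) \<le> ennreal (2 * r)"
begin

text \<open>As a function of the entry \<open>y\<close> at \<open>(i, j)\<close>, with the others fixed, the determinant is \<open>c y + r\<close> with \<open>c\<close> the cofactor.
  It is smaller than \<open>|c| / T\<close> only for \<open>y\<close> in a ball of radius \<open>1 / T\<close>, and the entry rarely falls there.\<close>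
lemma cofactor_over_det_tail:
  assumes k: "k \<le> n" and ij: "i < k" "j < k" and T: "T > 0"
  shows "emeasure (law n) {x \<in> space (law n). cmod (cofactor (shifted k w x) i j) > T * cmod (Determinant.det (shifted k w x))}
    \<le> ennreal (2 / T)"
proof -
  let ?I = "{..<n} \<times> {..<n}"
  define B where "B = {x \<in> space (law n). cmod (cofactor (shifted k w x) i j) > T * cmod (Determinant.det (shifted k w x))}"
  have B [measurable]: "B \<in> sets (law n)"
    unfolding B_def using borel_measurable_cofactor_shifted[OF k ij] borel_measurable_det_shifted[OF k] by measurable
  have I: "?I = insert (i, j) (?I - {(i, j)})" using k ij by auto
  have "emeasure (law n) B = (\<integral>\<^sup>+x. indicator B x \<partial>law n)" by (rule nn_integral_indicator[symmetric]) measurable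
  also have "\<dots> = (\<integral>\<^sup>+x. \<integral>\<^sup>+y. indicator B (x((i, j) := y)) \<partial>\<mu> \<partial>PiM (?I - {(i, j)}) (\<lambda>_. \<mu>))"
  proof (subst (1) I, rule product.product_nn_integral_insert)
    show "indicator B \<in> borel_measurable (PiM (insert (i, j) (?I - {(i, j)})) (\<lambda>_. \<mu>))"
      unfolding I[symmetric] by measurable
  qed auto
  also have "\<dots> \<le> (\<integral>\<^sup>+x. ennreal (2 / T) \<partial>PiM (?I - {(i, j)}) (\<lambda>_. \<mu>))"
  proof (intro nn_integral_mono)
    fix x
    define c where "c = cofactor (shifted k w x) i j"
    define r where "r = Determinant.det (shifted k w (x((i, j) := 0)))"
    have "indicator B (x((i, j) := y)) \<le> (indicator (if c = 0 then {} else cball (- r / c) (1 / T)) y :: ennreal)" for y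
    proof (cases "x((i, j) := y) \<in> B")
      case True
      then have "cmod c > T * cmod (y * c + r)"
        using cofactor_row_update[OF ij(1,2,2), of w x y] det_entry_update[OF ij, of w x y] by (simp add: B_def c_def r_def)
      moreover from this have c0: "c \<noteq> 0" using T by (auto simp: mult_less_0_iff dest: less_le_trans)
      moreover have "y * c + r = c * (y - (- r / c))" using c0 by (simp add: field_simps)
      ultimately have "cmod c * (T * cmod (y - (- r / c))) < cmod c * 1" by (simp add: norm_mult mult_ac)
      then have "T * cmod (y - (- r / c)) < 1" using c0 by (subst (asm) mult_less_cancel_left_pos) simp_all
      then have "dist (- r / c) y \<le> 1 / T" using T by (simp add: dist_norm norm_minus_commute field_simps)
      then show ?thesis using c0 by (auto simp: indicator_def)
    qed (simp add: indicator_def)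
    then have "(\<integral>\<^sup>+y. indicator B (x((i, j) := y)) \<partial>\<mu>) \<le> (\<integral>\<^sup>+y. indicator (if c = 0 then {} else cball (- r / c) (1 / T)) y \<partial>\<mu>)"
      by (intro nn_integral_mono)
    also have "\<dots> = emeasure \<mu> (if c = 0 then {} else cball (- r / c) (1 / T))"
      by (rule nn_integral_indicator) simp
    also have "\<dots> \<le> ennreal (2 / T)" using small_ball[of "1 / T" "- r / c"] T by simp
    finally show "(\<integral>\<^sup>+y. indicator B (x((i, j) := y)) \<partial>\<mu>) \<le> ennreal (2 / T)" .
  qed
  also have "\<dots> = ennreal (2 / T)"
    using prob_space.emeasure_space_1[OF prob_space_PiM[of "?I - {(i, j)}" "\<lambda>_. \<mu>"]] prob_space_axioms by simp
  finally show ?thesis by (simp add: B_def)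
qed

text \<open>The corner cofactor is the determinant of the leading minor, which is almost surely nonzero by induction. A vanishing
  determinant would then make the quotient of the two exceed every \<open>T\<close>.\<close>
lemma AE_det_nonzero: "k \<le> n \<Longrightarrow> AE x in law n. Determinant.det (shifted k w x) \<noteq> 0"
proof (induction k)
  case 0
  then show ?case by (simp add: shifted_def)
next
  case (Suc k)
  let ?N = "{x \<in> space (law n). Determinant.det (shifted (Suc k) w x) = 0 \<and> cofactor (shifted (Suc k) w x) k k \<noteq> 0}"
  have N: "?N \<in> sets (law n)"
    using borel_measurable_cofactor_shifted[OF Suc.prems, of k k w] borel_measurable_det_shifted[OF Suc.prems, of w] by measurable
  have small: "emeasure (law n) ?N \<le> ennreal \<epsilon>" if "\<epsilon> > 0" for \<epsilon>
  proof -
    have "emeasure (law n) ?N \<le> emeasure (law n) {x \<in> space (law n). cmod (cofactor (shifted (Suc k) w x) k k) > (2 / \<epsilon>) * cmod (Determinant.det (shifted (Suc k) w x))}"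
      using borel_measurable_cofactor_shifted[OF Suc.prems, of k k w] borel_measurable_det_shifted[OF Suc.prems, of w]
      by (intro emeasure_mono) auto
    also have "\<dots> \<le> ennreal (2 / (2 / \<epsilon>))" using that by (intro cofactor_over_det_tail Suc.prems) simp_all
    finally show ?thesis by simp
  qed
  have "emeasure (law n) ?N \<le> 0"
  proof (rule ennreal_le_epsilon)
    fix \<epsilon> :: real assume "0 < \<epsilon>"
    then show "emeasure (law n) ?N \<le> 0 + ennreal \<epsilon>" by (simp only: add_0_left small)
  qed
  then have "emeasure (law n) ?N = 0" by (rule le_zero_eq[THEN iffD1])
  then have "AE x in law n. x \<notin> ?N" using N by (intro AE_not_in) auto
  moreover have "AE x in law n. Determinant.det (shifted k w x) \<noteq> 0" using Suc by simp
  moreover have "AE x in law n. x \<in> space (law n)" by (rule AE_space)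
  ultimately show ?case
  proof (eventually_elim)
    case (elim x)
    then show ?case by (auto simp: shifted_def cofactor_corner)
  qed
qed

end

section \<open>Tails of the determinant\<close>

lemma emeasure_one_le_mult:
  assumes "f \<in> borel_measurable N"
  shows "emeasure N {x \<in> space N. 1 \<le> c * f x} \<le> c * (\<integral>\<^sup>+x. f x \<partial>N)"
proof -
  have "emeasure N {x \<in> space N. 1 \<le> c * f x} \<le> c * (\<integral>\<^sup>+x. f x * indicator (space N) x \<partial>N)"
    using assms by (intro nn_integral_Markov_inequality) simp_all
  also have "(\<integral>\<^sup>+x. f x * indicator (space N) x \<partial>N) = (\<integral>\<^sup>+x. f x \<partial>N)"
    by (rule nn_integral_cong) simp
  finally show ?thesis .
qed

lemma sq_norm_image_shifted:
  "sq_norm_image n (shifted n w x) v = (\<Sum>i<n. (cmod ((\<Sum>j<n. x (i, j) * v j) - w * v i))\<^sup>2)"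
proof (intro sum.cong refl)
  fix k assume "k \<in> {..<n}"
  then have "(\<Sum>j<n. shifted n w x $$ (k, j) * v j) = (\<Sum>j<n. x (k, j) * v j - (if k = j then w * v j else 0))"
    by (intro sum.cong refl) (simp add: left_diff_distrib)
  also have "\<dots> = (\<Sum>j<n. x (k, j) * v j) - w * v k"
    using \<open>k \<in> {..<n}\<close> by (simp add: sum_subtractf)
  finally show "(cmod (\<Sum>j<n. shifted n w x $$ (k, j) * v j))\<^sup>2 = (cmod ((\<Sum>j<n. x (k, j) * v j) - w * v k))\<^sup>2" by simp
qed

definition regularised_integral :: "nat \<Rightarrow> real \<Rightarrow> complex \<Rightarrow> (nat \<times> nat \<Rightarrow> complex) \<Rightarrow> ennreal" where
  "regularised_integral n \<delta> w x = (\<integral>\<^sup>+v. ennreal (exp (- sq_norm_image n (shifted n w x) v - \<delta> * (\<Sum>i<n. (cmod (v i))\<^sup>2)))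
     \<partial>lborel_pow {..<n})"

text \<open>The last assumption is the common form of \<open>kernel_bound_real\<close> and \<open>kernel_bound_complex\<close>.\<close>
locale gaussian_kernel_law = entry_law +
  assumes kernel_bound: "\<And>n v w c \<rho> q. gram_det n v > 0 \<Longrightarrow> (cmod w)\<^sup>2 = real n * \<rho> \<Longrightarrow> \<rho> \<ge> 0
    \<Longrightarrow> (\<And>t. 0 \<le> t \<Longrightarrow> t \<le> 1 \<Longrightarrow> t * exp (- \<rho> * t) \<le> c) \<Longrightarrow> c > 0 \<Longrightarrow> 2 * q \<le> n
    \<Longrightarrow> (\<integral>\<^sup>+x. ennreal (exp (- (\<Sum>i<n. (cmod ((\<Sum>j<n. x (i, j) * v j) - w * v i))\<^sup>2))) \<partial>law n)
      \<le> ennreal ((c\<^sup>2 / (4 * gram_det n v)) ^ q)"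
begin

text \<open>The Gamma kernel replaces the negative power of the Gram determinant, so the degenerate vectors \<open>v\<close> need no separate
  treatment later.\<close>
lemma expected_kernel_le_gamma_kernel:
  assumes w: "(cmod w)\<^sup>2 = real n * \<rho>" "\<rho> \<ge> 0" and q: "q \<ge> 1" "2 * q \<le> n"
    and c: "\<And>t. 0 \<le> t \<Longrightarrow> t \<le> 1 \<Longrightarrow> t * exp (- \<rho> * t) \<le> c" "c > 0"
  shows "(\<integral>\<^sup>+x. ennreal (exp (- sq_norm_image n (shifted n w x) v)) \<partial>law n)
    \<le> ennreal ((c\<^sup>2 / 4) ^ q * (exp (real q) / real q ^ (q - 1))) * gamma_kernel q (gram_det n v)"
proof (cases "gram_det n v = 0")
  case True
  have "0 < (c\<^sup>2 / 4) ^ q * (exp (real q) / real q ^ (q - 1))" using c q by simp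
  then have "ennreal ((c\<^sup>2 / 4) ^ q * (exp (real q) / real q ^ (q - 1))) * gamma_kernel q (gram_det n v) = \<infinity>"
    by (simp only: True gamma_kernel_0) (simp add: ennreal_mult_top ennreal_eq_0_iff not_le)
  then show ?thesis by simp
next
  case False
  then have D: "gram_det n v > 0" using gram_det_nonneg[of n v] by simp
  have "(\<integral>\<^sup>+x. ennreal (exp (- sq_norm_image n (shifted n w x) v)) \<partial>law n) \<le> ennreal ((c\<^sup>2 / (4 * gram_det n v)) ^ q)"
    unfolding sq_norm_image_shifted by (rule kernel_bound[OF D w c q(2)])
  also have "\<dots> = ennreal ((c\<^sup>2 / 4) ^ q) * ennreal ((1 / gram_det n v) ^ q)"
    using D by (simp add: ennreal_mult[symmetric] power_divide power_mult_distrib)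
  also have "\<dots> \<le> ennreal ((c\<^sup>2 / 4) ^ q) * (ennreal (exp (real q) / real q ^ (q - 1)) * gamma_kernel q (gram_det n v))"
    by (intro mult_left_mono gamma_kernel_lower q D) simp
  also have "\<dots> = ennreal ((c\<^sup>2 / 4) ^ q * (exp (real q) / real q ^ (q - 1))) * gamma_kernel q (gram_det n v)"
    by (subst ennreal_mult) (simp_all add: mult.assoc del: times_divide_eq_right)
  finally show ?thesis .
qed

lemma borel_measurable_kernel [measurable]:
  "(\<lambda>(x, v). ennreal (exp (- sq_norm_image n (shifted n w x) v - \<delta> * (\<Sum>i<n. (cmod (v i))\<^sup>2))))
    \<in> borel_measurable (law n \<Otimes>\<^sub>M lborel_pow {..<n})"
proof -
  have [measurable]: "(\<lambda>p. fst p (i, j)) \<in> borel_measurable (law n \<Otimes>\<^sub>M PiM {..<n} (\<lambda>_. lborel :: complex measure))"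
    if "i < n" "j < n" for i j
    using that by (intro measurable_compose[OF measurable_fst measurable_PiM_component_rev]) auto
  have [measurable]: "(\<lambda>p. snd p i) \<in> borel_measurable (law n \<Otimes>\<^sub>M PiM {..<n} (\<lambda>_. lborel :: complex measure))"
    if "i < n" for i
    using that by (intro measurable_compose[OF measurable_snd measurable_PiM_component_rev]) auto
  have [measurable]: "(\<lambda>p. cmod ((\<Sum>j<n. fst p (i, j) * snd p j) - w * snd p i)) \<in> borel_measurable (law n \<Otimes>\<^sub>M lborel_pow {..<n})"
    if "i < n" for i
    using that by (intro measurable_compose[OF _ borel_measurable_norm] borel_measurable_diff borel_measurable_sum borel_measurable_times borel_measurable_const) simp_all
  show ?thesis
    unfolding sq_norm_image_shifted case_prod_beta
    by (intro measurable_compose[OF _ measurable_ennreal] borel_measurable_exp borel_measurable_diff borel_measurable_uminus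
        borel_measurable_times borel_measurable_sum borel_measurable_power borel_measurable_const) simp_all
qed

lemma borel_measurable_regularised_integral [measurable]:
  "regularised_integral n \<delta> w \<in> borel_measurable (law n)"
proof -
  interpret product_sigma_finite "\<lambda>_::nat. lborel :: complex measure" by standard
  interpret P: finite_product_sigma_finite "\<lambda>_::nat. lborel :: complex measure" "{..<n}" by standard simp
  show ?thesis
    unfolding regularised_integral_def[abs_def] by (rule P.borel_measurable_nn_integral[OF borel_measurable_kernel])
qed

text \<open>By Tonelli the matrix is averaged first and \<open>v\<close> is integrated afterwards. The two Stirling factors from the Gamma kernels
  combine to \<open>(e / q) ^ (2 q)\<close>.\<close>
lemma expected_regularised_integral:
  assumes w: "(cmod w)\<^sup>2 = real n * \<rho>" "\<rho> \<ge> 0" and q: "q \<ge> 1" "2 * q + 3 \<le> n" "n \<le> 2 * q + 4"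
    and c: "\<And>t. 0 \<le> t \<Longrightarrow> t \<le> 1 \<Longrightarrow> t * exp (- \<rho> * t) \<le> c" "c > 0" and \<delta>: "0 < \<delta>" "\<delta> \<le> 1"
  shows "(\<integral>\<^sup>+x. regularised_integral n \<delta> w x \<partial>law n)
    \<le> ennreal (pi ^ n / \<delta> ^ 5 * (c * exp 1 / (2 * real q)) ^ (2 * q))"
proof -
  let ?k = "\<lambda>x v. ennreal (exp (- sq_norm_image n (shifted n w x) v - \<delta> * (\<Sum>i<n. (cmod (v i))\<^sup>2)))"
  let ?g = "\<lambda>v. ennreal (exp (- \<delta> * (\<Sum>j<n. (cmod (v j))\<^sup>2))) * gamma_kernel q (gram_det n v)"
  interpret product_sigma_finite "\<lambda>_::nat. lborel :: complex measure" by standard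
  interpret P: finite_product_sigma_finite "\<lambda>_::nat. lborel :: complex measure" "{..<n}" by standard simp
  interpret G: prob_space "law n" by (intro prob_space_PiM prob_space_axioms)
  interpret pair_sigma_finite "law n" "lborel_pow {..<n} :: (nat \<Rightarrow> complex) measure" ..
  define \<kappa> where "\<kappa> = exp (real q) / real q ^ (q - 1)"
  have \<kappa>: "\<kappa> \<ge> 0" by (simp add: \<kappa>_def)
  have "(\<integral>\<^sup>+x. regularised_integral n \<delta> w x \<partial>law n)
    = (\<integral>\<^sup>+v. \<integral>\<^sup>+x. ?k x v \<partial>law n \<partial>lborel_pow {..<n})"
    unfolding regularised_integral_def using Fubini'[OF borel_measurable_kernel] by simp
  also have "\<dots> \<le> (\<integral>\<^sup>+v. ennreal ((c\<^sup>2 / 4) ^ q * \<kappa>) * ?g v \<partial>lborel_pow {..<n})"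
  proof (intro nn_integral_mono)
    fix v :: "nat \<Rightarrow> complex"
    let ?e = "exp (- \<delta> * (\<Sum>j<n. (cmod (v j))\<^sup>2))"
    have sm: "(\<lambda>x. sq_norm_image n (shifted n w x) v) \<in> borel_measurable (law n)"
      unfolding sq_norm_image_shifted by measurable
    have "ennreal (exp (- t - \<delta> * (\<Sum>i<n. (cmod (v i))\<^sup>2))) = ennreal ?e * ennreal (exp (- t))" for t
      by (simp add: ennreal_mult[symmetric] exp_add[symmetric])
    then have "(\<integral>\<^sup>+x. ?k x v \<partial>law n)
      = ennreal ?e * (\<integral>\<^sup>+x. ennreal (exp (- sq_norm_image n (shifted n w x) v)) \<partial>law n)"
      by (simp only:) (rule nn_integral_cmult[OF measurable_compose[OF measurable_compose[OF borel_measurable_uminus[OF sm] borel_measurable_exp] measurable_ennreal]])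
    also have "\<dots> \<le> ennreal ?e * (ennreal ((c\<^sup>2 / 4) ^ q * \<kappa>) * gamma_kernel q (gram_det n v))"
      unfolding \<kappa>_def using q by (intro mult_left_mono expected_kernel_le_gamma_kernel[where \<rho> = \<rho>] w c) simp_all
    finally show "(\<integral>\<^sup>+x. ?k x v \<partial>law n)
      \<le> ennreal ((c\<^sup>2 / 4) ^ q * \<kappa>) * (ennreal ?e * gamma_kernel q (gram_det n v))"
      by (simp only: mult_ac)
  qed
  also have "\<dots> = ennreal ((c\<^sup>2 / 4) ^ q * \<kappa>) * (\<integral>\<^sup>+v. ?g v \<partial>lborel_pow {..<n})"
    by (rule nn_integral_cmult) measurable
  also have "\<dots> \<le> ennreal ((c\<^sup>2 / 4) ^ q * \<kappa>) * ennreal (\<kappa> * pi ^ n / ((real q)\<^sup>2 * \<delta> ^ 5))"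
    unfolding \<kappa>_def by (intro mult_left_mono nn_integral_gamma_kernel_gram_det q \<delta>) simp
  also have "\<dots> = ennreal (pi ^ n / \<delta> ^ 5 * (c * exp 1 / (2 * real q)) ^ (2 * q))"
  proof -
    have "real q ^ q = real q ^ (q - 1) * real q" using q power_Suc2[of "real q" "q - 1"] by simp
    moreover have "exp (real q) = exp 1 ^ q" by (simp add: exp_of_nat_mult[symmetric])
    ultimately have "\<kappa> / real q = (exp 1 / real q) ^ q" by (simp add: \<kappa>_def power_divide)
    then have "(\<kappa> / real q)\<^sup>2 = ((exp 1 / real q)\<^sup>2) ^ q" by (metis power_mult mult.commute)
    then have "(c\<^sup>2 / 4) ^ q * (\<kappa> / real q)\<^sup>2 = ((c\<^sup>2 / 4) * (exp 1 / real q)\<^sup>2) ^ q"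
      by (simp only: power_mult_distrib)
    also have "(c\<^sup>2 / 4) * (exp 1 / real q)\<^sup>2 = (c * exp 1 / (2 * real q))\<^sup>2"
      by (simp add: power_mult_distrib power_divide)
    finally have "(c\<^sup>2 / 4) ^ q * (\<kappa> / real q)\<^sup>2 = (c * exp 1 / (2 * real q)) ^ (2 * q)"
      by (simp only: power_mult)
    moreover have "(c\<^sup>2 / 4) ^ q * \<kappa> * (\<kappa> * pi ^ n / ((real q)\<^sup>2 * \<delta> ^ 5)) = pi ^ n / \<delta> ^ 5 * ((c\<^sup>2 / 4) ^ q * (\<kappa> / real q)\<^sup>2)"
      by (simp add: power2_eq_square mult_ac)
    ultimately show ?thesis using \<kappa> \<delta> by (simp add: ennreal_mult[symmetric])
  qed
  finally show ?thesis .
qed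

text \<open>The exceptional set consists of the singular matrices, the matrices with a large entry in the inverse, and those on which the
  regularised integral exceeds its mean by the factor \<open>m\<close>. Off this set the integral controls \<open>1 / |det A|^2\<close> from above.\<close>
lemma det_lower_tail:
  assumes w: "(cmod w)\<^sup>2 = real n * \<rho>" "\<rho> \<ge> 0" and q: "q \<ge> 1" "2 * q + 3 \<le> n" "n \<le> 2 * q + 4"
    and c: "\<And>t. 0 \<le> t \<Longrightarrow> t \<le> 1 \<Longrightarrow> t * exp (- \<rho> * t) \<le> c" "c > 0" and T: "T \<ge> 1" and m: "m > 0"
  defines "\<delta> \<equiv> 1 / (real n ^ 3 * T\<^sup>2)"
  shows "\<exists>B\<in>sets (law n). measure (law n) B \<le> 2 * (real n)\<^sup>2 / T + 1 / m \<and>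
    (\<forall>x\<in>space (law n) - B. Determinant.det (shifted n w x) \<noteq> 0 \<and>
       exp (-1) * \<delta> ^ 5 / m * (2 * real q / (c * exp 1)) ^ (2 * q) \<le> (cmod (Determinant.det (shifted n w x)))\<^sup>2)"
proof -
  interpret G: prob_space "law n" by (intro prob_space_PiM prob_space_axioms)
  have n: "real n \<ge> 1" using q by simp
  have nT: "real n ^ 3 * T\<^sup>2 \<ge> 1"
    using mult_mono[OF one_le_power[OF n, of 3] one_le_power[OF T, of 2]] by simp
  then have \<delta>: "0 < \<delta>" "\<delta> \<le> 1" by (simp_all add: \<delta>_def)
  define R where "R = pi ^ n / \<delta> ^ 5 * (c * exp 1 / (2 * real q)) ^ (2 * q)"
  have R: "R > 0" using \<delta> c q by (simp add: R_def)
  let ?I = "{..<n} \<times> {..<n}"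
  let ?det = "\<lambda>x. Determinant.det (shifted n w x)"
  define B0 where "B0 = {x \<in> space (law n). ?det x = 0}"
  define B1 where "B1 k = {x \<in> space (law n). cmod (cofactor (shifted n w x) (fst k) (snd k)) > T * cmod (?det x)}" for k
  define B2 where "B2 = {x \<in> space (law n). 1 \<le> ennreal (1 / (m * R)) * regularised_integral n \<delta> w x}"
  have B0: "B0 \<in> sets (law n)" unfolding B0_def using borel_measurable_det_shifted[of n n w] by measurable
  have B1: "B1 k \<in> sets (law n)" if k: "k \<in> ?I" for k
  proof -
    have [measurable]: "(\<lambda>x. cofactor (shifted n w x) (fst k) (snd k)) \<in> borel_measurable (law n)"
      using k by (intro borel_measurable_cofactor_shifted) auto
    show ?thesis unfolding B1_def using borel_measurable_det_shifted[of n n w] by measurable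
  qed
  have B2: "B2 \<in> sets (law n)" unfolding B2_def by measurable
  have p0: "measure (law n) B0 = 0"
    using AE_det_nonzero[of n n w] unfolding B0_def
    by (subst G.prob_Collect_eq_0) (use B0[unfolded B0_def] in simp_all)
  have p1: "measure (law n) (\<Union>k\<in>?I. B1 k) \<le> 2 * (real n)\<^sup>2 / T"
  proof -
    have "measure (law n) (\<Union>k\<in>?I. B1 k) \<le> (\<Sum>k\<in>?I. measure (law n) (B1 k))"
      using B1 by (intro G.finite_measure_subadditive_finite) auto
    also have "\<dots> \<le> (\<Sum>k\<in>?I. 2 / T)"
    proof (intro sum_mono)
      fix k assume "k \<in> ?I"
      then have "emeasure (law n) (B1 k) \<le> ennreal (2 / T)"
        unfolding B1_def using T by (intro cofactor_over_det_tail) auto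
      then show "measure (law n) (B1 k) \<le> 2 / T" using T by (simp add: G.emeasure_eq_measure)
    qed
    finally show ?thesis by (simp add: power2_eq_square mult_ac)
  qed
  have p2: "measure (law n) B2 \<le> 1 / m"
  proof -
    have "emeasure (law n) B2 \<le> ennreal (1 / (m * R)) * (\<integral>\<^sup>+x. regularised_integral n \<delta> w x \<partial>law n)"
      unfolding B2_def by (rule emeasure_one_le_mult) measurable
    also have "\<dots> \<le> ennreal (1 / (m * R)) * ennreal R"
      unfolding R_def by (intro mult_left_mono expected_regularised_integral[OF w q c \<delta>]) simp_all
    also have "\<dots> = ennreal (1 / m)" using m R by (simp add: ennreal_mult[symmetric])
    finally show ?thesis using m by (simp add: G.emeasure_eq_measure)
  qed
  define B where "B = B0 \<union> (\<Union>k\<in>?I. B1 k) \<union> B2"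
  have B1U: "(\<Union>k\<in>?I. B1 k) \<in> sets (law n)" using B1 by (intro sets.finite_UN) auto
  have "measure (law n) B \<le> measure (law n) B0 + measure (law n) (\<Union>k\<in>?I. B1 k) + measure (law n) B2"
    unfolding B_def using B0 B1U B2
    by (intro order_trans[OF measure_Un_le] add_mono order_refl measure_Un_le) auto
  then have pB: "measure (law n) B \<le> 2 * (real n)\<^sup>2 / T + 1 / m" using p0 p1 p2 by simp
  have "?det x \<noteq> 0 \<and> exp (-1) * \<delta> ^ 5 / m * (2 * real q / (c * exp 1)) ^ (2 * q) \<le> (cmod (?det x))\<^sup>2"
    if x: "x \<in> space (law n) - B" for x
  proof
    show det: "?det x \<noteq> 0" using x by (auto simp: B_def B0_def)
    have cof: "cmod (cofactor (shifted n w x) i j) \<le> T * cmod (?det x)" if "i < n" "j < n" for i j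
    proof -
      have "x \<notin> B1 (i, j)" using x that by (auto simp: B_def)
      then show ?thesis using x by (simp add: B1_def not_less)
    qed
    have "ennreal (pi ^ n * exp (-1) / (cmod (?det x))\<^sup>2) \<le> regularised_integral n \<delta> w x"
      unfolding regularised_integral_def
    proof (rule nn_integral_regularised_ge[OF shifted_carrier det _ _ cof])
      show "\<delta> * (real n ^ 3 * T\<^sup>2) \<le> 1" using nT by (simp add: \<delta>_def)
    qed (use T n \<delta> in simp_all)
    then have "ennreal (1 / (m * R)) * ennreal (pi ^ n * exp (-1) / (cmod (?det x))\<^sup>2) \<le> ennreal (1 / (m * R)) * regularised_integral n \<delta> w x"
      by (intro mult_left_mono) simp_all
    also have "\<dots> < 1" using x by (auto simp: B_def B2_def not_le)
    finally have "1 / (m * R) * (pi ^ n * exp (-1) / (cmod (?det x))\<^sup>2) < 1"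
      using m R by (simp add: ennreal_mult[symmetric] ennreal_less_one_iff)
    then have "pi ^ n * exp (-1) < m * R * (cmod (?det x))\<^sup>2"
      using m R det by (simp add: field_simps)
    then have "pi ^ n * exp (-1) / (m * R) \<le> (cmod (?det x))\<^sup>2"
      using m R by (simp add: field_simps)
    also have "pi ^ n * exp (-1) / (m * R) = exp (-1) * \<delta> ^ 5 / m * (2 * real q / (c * exp 1)) ^ (2 * q)"
      using \<delta> c q m by (simp add: R_def power_divide)
    finally show "exp (-1) * \<delta> ^ 5 / m * (2 * real q / (c * exp 1)) ^ (2 * q) \<le> (cmod (?det x))\<^sup>2" .
  qed
  then show ?thesis using pB B0 B1U B2 by (intro bexI[of _ B]) (auto simp: B_def)
qed

lemma det_upper_tail:
  assumes S: "fact n * (\<Sum>k\<le>n. ((cmod w)\<^sup>2) ^ k / fact k) \<le> S" "S > 0" and m: "m > 0"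
  shows "\<exists>B\<in>sets (law n). measure (law n) B \<le> 1 / m \<and>
    (\<forall>x\<in>space (law n) - B. (cmod (Determinant.det (shifted n w x)))\<^sup>2 \<le> m * S)"
proof -
  interpret G: prob_space "law n" by (intro prob_space_PiM prob_space_axioms)
  let ?f = "\<lambda>x. ennreal ((cmod (Determinant.det (shifted n w x)))\<^sup>2)"
  define B where "B = {x \<in> space (law n). 1 \<le> ennreal (1 / (m * S)) * ?f x}"
  have f: "?f \<in> borel_measurable (law n)" using borel_measurable_det_shifted[of n n w] by measurable
  have B: "B \<in> sets (law n)" unfolding B_def using f by measurable
  have "emeasure (law n) B \<le> ennreal (1 / (m * S)) * (\<integral>\<^sup>+x. ?f x \<partial>law n)"
    unfolding B_def by (rule emeasure_one_le_mult[OF f])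
  also have "\<dots> \<le> ennreal (1 / (m * S)) * ennreal S"
    unfolding second_moment_det by (intro mult_left_mono ennreal_leI S) simp
  also have "\<dots> = ennreal (1 / m)" using m S(2) by (simp add: ennreal_mult[symmetric])
  finally have "measure (law n) B \<le> 1 / m" using m by (simp add: G.emeasure_eq_measure)
  moreover have "(cmod (Determinant.det (shifted n w x)))\<^sup>2 \<le> m * S" if "x \<in> space (law n) - B" for x
  proof -
    have "ennreal (1 / (m * S)) * ?f x < 1" using that by (auto simp: B_def not_le)
    then show ?thesis using m S(2) by (simp add: ennreal_mult[symmetric] ennreal_less_one_iff field_simps)
  qed
  ultimately show ?thesis using B by blast
qed

end

text \<open>The partial sum is bounded by the full exponential series, which loses little as long as \<open>\<rho> \<le> 1\<close>.\<close>
lemma second_moment_bound_inside: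
  fixes \<rho> :: real
  assumes n: "n \<ge> 1" and \<rho>: "0 \<le> \<rho>"
  shows "fact n * (\<Sum>k\<le>n. (real n * \<rho>) ^ k / fact k) \<le> exp 1 * real n * (real n / (exp (- \<rho>) * exp 1)) ^ n"
proof -
  have "(\<Sum>k\<le>n. (real n * \<rho>) ^ k / fact k) \<le> (\<Sum>k. (real n * \<rho>) ^ k / fact k)"
    using summable_exp[of "real n * \<rho>"] \<rho>
    by (intro sum_le_suminf) (auto simp: field_simps inverse_eq_divide)
  also have "\<dots> = exp (real n * \<rho>)"
    using exp_converges[of "real n * \<rho>"] by (simp add: sums_iff divide_inverse mult.commute)
  finally have "fact n * (\<Sum>k\<le>n. (real n * \<rho>) ^ k / fact k) \<le> (exp 1 * real n * (real n / exp 1) ^ n) * exp (real n * \<rho>)"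
    using fact_le_exp[OF n] \<rho> by (intro mult_mono) (simp_all add: sum_nonneg)
  also have "\<dots> = exp 1 * real n * (real n / (exp (- \<rho>) * exp 1)) ^ n"
    by (simp add: power_divide power_mult_distrib exp_of_nat_mult[symmetric] exp_minus field_simps)
  finally show ?thesis .
qed

text \<open>For \<open>\<rho> \<ge> 1\<close> the last term of the sum dominates all the others.\<close>
lemma second_moment_bound_outside:
  fixes \<rho> :: real
  assumes n: "n \<ge> 1" and \<rho>: "1 \<le> \<rho>"
  shows "fact n * (\<Sum>k\<le>n. (real n * \<rho>) ^ k / fact k) \<le> exp 1 * real n * (real n / (1 / (exp 1 * \<rho>) * exp 1)) ^ n"
proof -
  have "fact n * (\<Sum>k\<le>n. (real n * \<rho>) ^ k / fact k) = (\<Sum>k\<le>n. fact n / fact k * (real n * \<rho>) ^ k)"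
    by (simp add: sum_distrib_left)
  also have "\<dots> \<le> (\<Sum>k\<le>n. (real n * \<rho>) ^ n)"
  proof (intro sum_mono)
    fix k assume "k \<in> {..n}"
    then have k: "k \<le> n" by simp
    have "(fact n / fact k :: real) \<le> real n ^ (n - k)"
      using fact_div_fact_le_pow[of "n - k" n] k
      by (metis (no_types, opaque_lifting) diff_diff_cancel diff_le_self fact_dvd of_nat_fact of_nat_le_iff of_nat_power real_of_nat_div)
    moreover have "\<rho> ^ k \<le> \<rho> ^ n" using k \<rho> by (intro power_increasing) simp_all
    ultimately have "fact n / fact k * (real n ^ k * \<rho> ^ k) \<le> real n ^ (n - k) * (real n ^ k * \<rho> ^ n)"
      using \<rho> by (intro mult_mono) simp_all
    also have "\<dots> = (real n * \<rho>) ^ n"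
      using k by (simp add: power_mult_distrib mult.assoc[symmetric] power_add[symmetric])
    finally show "fact n / fact k * (real n * \<rho>) ^ k \<le> (real n * \<rho>) ^ n" by (simp add: power_mult_distrib)
  qed
  also have "\<dots> = (real n + 1) * (real n * \<rho>) ^ n" by simp
  also have "\<dots> \<le> exp 1 * real n * (real n * \<rho>) ^ n"
  proof (intro mult_right_mono)
    have "real n + 1 \<le> 2 * real n" using n by simp
    also have "\<dots> \<le> exp 1 * real n" using exp_ge_add_one_self[of "1::real"] by (intro mult_right_mono) simp_all
    finally show "real n + 1 \<le> exp 1 * real n" .
  qed (use \<rho> in simp)
  finally show ?thesis by simp
qed

text \<open>The lower bound comes with the exponent \<open>2 q\<close> instead of \<open>n\<close>; the missing three or four factors cost a polynomial.\<close>
lemma power_deficit_bound: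
  fixes a M :: real
  assumes q: "q \<ge> 1" "2 * q + 3 \<le> n" "n \<le> 2 * q + 4" and a: "0 < a" "a \<le> M" "M \<ge> 1"
  shows "(real n * a) ^ n \<le> exp 4 * (real n * M) ^ 4 * (2 * real q * a) ^ (2 * q)"
proof -
  define e where "e = n - 2 * q"
  have e: "n = 2 * q + e" "e \<le> 4" using q by (simp_all add: e_def)
  have "real n / (2 * real q) = 1 + real e / real (2 * q)" using q by (simp add: e field_simps)
  also have "\<dots> \<le> exp (real e / real (2 * q))" by (rule exp_ge_add_one_self)
  finally have "(real n / (2 * real q)) ^ (2 * q) \<le> exp (real e / real (2 * q)) ^ (2 * q)"
    by (intro power_mono) simp_all
  also have "\<dots> = exp (real e)" using q by (simp add: exp_of_nat_mult[symmetric])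
  also have "\<dots> \<le> exp 4" using e by simp
  finally have 1: "real n ^ (2 * q) \<le> exp 4 * (2 * real q) ^ (2 * q)"
    using q by (simp add: power_divide field_simps)
  have "(real n * a) ^ e \<le> (real n * M) ^ e" using a by (intro power_mono mult_left_mono) simp_all
  also have "\<dots> \<le> (real n * M) ^ 4"
    using e q a mult_mono[of 1 "real n" 1 M] by (intro power_increasing) simp_all
  finally have 2: "(real n * a) ^ e \<le> (real n * M) ^ 4" .
  have "(real n * a) ^ n = (real n ^ (2 * q) * a ^ (2 * q)) * (real n * a) ^ e"
    by (subst (2) e(1)) (simp only: power_add power_mult_distrib mult.assoc)
  also have "\<dots> \<le> (exp 4 * (2 * real q) ^ (2 * q) * a ^ (2 * q)) * (real n * M) ^ 4"
    using 1 2 a by (intro mult_mono) simp_all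
  also have "\<dots> = exp 4 * (real n * M) ^ 4 * (2 * real q * a) ^ (2 * q)"
    by (simp only: power_mult_distrib mult_ac)
  finally show ?thesis .
qed

context gaussian_kernel_law
begin

text \<open>The centre is \<open>ln W / 2\<close> with \<open>W = (n / (e c)) ^ n\<close>. Both tail bounds compare \<open>|det A|^2\<close> with \<open>W\<close> up to powers of \<open>n\<close>,
  and the constant \<open>M\<close> absorbs the dependence on \<open>z\<close>.\<close>
lemma log_det_concentration:
  fixes w :: complex and \<rho> c M A :: real
  assumes n: "n \<ge> 5" and w: "(cmod w)\<^sup>2 = real n * \<rho>" "\<rho> \<ge> 0" and A: "A > 0"
    and c: "\<And>t. 0 \<le> t \<Longrightarrow> t \<le> 1 \<Longrightarrow> t * exp (- \<rho> * t) \<le> c" "c > 0"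
    and S: "fact n * (\<Sum>k\<le>n. (real n * \<rho>) ^ k / fact k) \<le> exp 1 * real n * (real n / (c * exp 1)) ^ n"
    and M: "1 / (c * exp 1) \<le> M" "M \<ge> 1"
  shows "\<exists>B\<in>sets (law n). measure (law n) B \<le> 4 * real n powr (- A) \<and>
    (\<forall>x\<in>space (law n) - B. Determinant.det (shifted n w x) \<noteq> 0 \<and>
      \<bar>ln (cmod (Determinant.det (shifted n w x))) - 1 / 2 * (real n * ln (real n) - real n - real n * ln c)\<bar>
        \<le> 3 + 2 * ln M + (6 * A + 20) * ln (real n))"
proof -
  interpret G: prob_space "law n" by (intro prob_space_PiM prob_space_axioms)
  let ?det = "\<lambda>x. Determinant.det (shifted n w x)"
  \<comment> \<open>Since \<open>2 q < n - 1\<close>, the Gram determinant integral converges.\<close>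
  define q where "q = (n - 3) div 2"
  have q: "q \<ge> 1" "2 * q + 3 \<le> n" "n \<le> 2 * q + 4" using n by (auto simp: q_def)
  define l where "l = ln (real n)"
  have n0: "real n > 0" and n1: "real n \<ge> 1" using n by simp_all
  have l0: "l \<ge> 0" using n1 by (simp add: l_def)
  \<comment> \<open>The union over \<open>n\<^sup>2\<close> entries of the inverse costs the exponent \<open>2\<close>.\<close>
  define T where "T = real n powr (A + 2)"
  define m where "m = real n powr A"
  define \<delta> where "\<delta> = 1 / (real n ^ 3 * T\<^sup>2)"
  define a where "a = 1 / (c * exp 1)"
  define W where "W = (real n * a) ^ n"
  have T: "T \<ge> 1" "T > 0" using n1 A by (simp_all add: T_def ge_one_powr_ge_zero)
  have m: "m > 0" using n0 by (simp add: m_def)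
  have \<delta>: "\<delta> > 0" using n0 T by (simp add: \<delta>_def)
  have a: "a > 0" "a \<le> M" using c M by (simp_all add: a_def)
  have M0: "M > 0" using M(2) by simp
  have W: "W > 0" using n0 a by (simp add: W_def)
  have lna: "ln a = - 1 - ln c" using c(2) by (simp add: a_def ln_div ln_mult)
  have lnW: "ln W = real n * ln (real n) - real n - real n * ln c"
    using n0 a by (simp add: W_def ln_realpow ln_mult lna algebra_simps)
  have lnm: "ln m = A * l" and lnT: "ln T = (A + 2) * l" using n0 by (simp_all add: m_def T_def l_def ln_powr)
  have ln\<delta>: "ln \<delta> = - (2 * A + 7) * l"
    using n0 T by (simp add: \<delta>_def ln_div ln_mult ln_realpow lnT l_def[symmetric] algebra_simps)
  obtain B1 where B1: "B1 \<in> sets (law n)" "measure (law n) B1 \<le> 2 * (real n)\<^sup>2 / T + 1 / m"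
    "\<And>x. x \<in> space (law n) - B1 \<Longrightarrow> ?det x \<noteq> 0"
    "\<And>x. x \<in> space (law n) - B1 \<Longrightarrow> exp (-1) * \<delta> ^ 5 / m * (2 * real q / (c * exp 1)) ^ (2 * q) \<le> (cmod (?det x))\<^sup>2"
    using det_lower_tail[OF w q c T(1) m] unfolding \<delta>_def by blast
  obtain B2 where B2: "B2 \<in> sets (law n)" "measure (law n) B2 \<le> 1 / m"
    "\<And>x. x \<in> space (law n) - B2 \<Longrightarrow> (cmod (?det x))\<^sup>2 \<le> m * (exp 1 * real n * W)"
  proof -
    have "exp 1 * real n * W > 0" using n0 W by simp
    moreover have "fact n * (\<Sum>k\<le>n. ((cmod w)\<^sup>2) ^ k / fact k) \<le> exp 1 * real n * W"
      using S by (simp add: w W_def a_def)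
    ultimately show thesis using det_upper_tail[of n w "exp 1 * real n * W" m] m that by blast
  qed
  have meas: "measure (law n) (B1 \<union> B2) \<le> 4 * real n powr (- A)"
  proof -
    have "(real n)\<^sup>2 / T = real n powr (- A)"
      using n0 by (simp add: T_def powr_add powr_minus powr_numeral divide_simps)
    moreover have "1 / m = real n powr (- A)" by (simp add: m_def powr_minus_divide)
    ultimately show ?thesis
      using measure_Un_le[OF B1(1) B2(1)] B1(2) B2(2) by simp
  qed
  have "?det x \<noteq> 0 \<and> \<bar>ln (cmod (?det x)) - 1 / 2 * (real n * ln (real n) - real n - real n * ln c)\<bar>
        \<le> 3 + 2 * ln M + (6 * A + 20) * ln (real n)" if x: "x \<in> space (law n) - (B1 \<union> B2)" for x
  proof
    show det: "?det x \<noteq> 0" using B1(3) x by blast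
    define d where "d = cmod (?det x)"
    have d: "d > 0" using det by (simp add: d_def)
    have lnd: "ln (d\<^sup>2) = 2 * ln d" using d by (simp add: ln_realpow)
    have "d\<^sup>2 \<le> m * (exp 1 * real n * W)" using B2(3) x by (simp add: d_def)
    then have "ln (d\<^sup>2) \<le> ln (m * (exp 1 * real n * W))" using d by (intro ln_mono) simp_all
    also have "\<dots> = A * l + 1 + l + ln W" using m n0 W by (simp add: ln_mult lnm l_def[symmetric])
    finally have up: "2 * ln d \<le> (A + 1) * l + 1 + ln W" unfolding lnd by (simp add: algebra_simps)
    have "exp (-1) * \<delta> ^ 5 / m * W \<le> exp (-1) * \<delta> ^ 5 / m * (exp 4 * (real n * M) ^ 4 * (2 * real q * a) ^ (2 * q))"
      unfolding W_def using \<delta> m by (intro mult_left_mono power_deficit_bound q a M) simp_all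
    also have "\<dots> = (exp (-1) * \<delta> ^ 5 / m * (2 * real q / (c * exp 1)) ^ (2 * q)) * (exp 4 * (real n * M) ^ 4)"
      by (simp add: a_def)
    also have "\<dots> \<le> d\<^sup>2 * (exp 4 * (real n * M) ^ 4)"
      using B1(4)[of x] x by (intro mult_right_mono) (simp_all add: d_def)
    finally have "ln (exp (-1) * \<delta> ^ 5 / m * W) \<le> ln (d\<^sup>2 * (exp 4 * (real n * M) ^ 4))"
      using \<delta> m W by (intro ln_mono) simp_all
    moreover have "ln (exp (-1) * \<delta> ^ 5 / m * W) = ln (exp (-1)) + real 5 * ln \<delta> - ln m + ln W"
      using \<delta> m W
      by (simp only: ln_mult_pos ln_divide_pos ln_realpow mult_pos_pos divide_pos_pos zero_less_power exp_gt_zero)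
    moreover have "ln (d\<^sup>2 * (exp 4 * (real n * M) ^ 4)) = ln (d\<^sup>2) + (ln (exp 4) + real 4 * (ln (real n) + ln M))"
      using d n0 M0
      by (simp only: ln_mult_pos ln_realpow mult_pos_pos zero_less_power exp_gt_zero)
    ultimately have low: "ln W \<le> 2 * ln d + 5 + 4 * l + 4 * ln M + (11 * A + 35) * l"
      unfolding ln_exp lnd ln\<delta> lnm l_def[symmetric] by (simp add: algebra_simps)
    have "ln M \<ge> 0" using M by simp
    moreover have "A * l \<ge> 0" using A l0 by simp
    ultimately show "\<bar>ln (cmod (?det x)) - 1 / 2 * (real n * ln (real n) - real n - real n * ln c)\<bar>
        \<le> 3 + 2 * ln M + (6 * A + 20) * ln (real n)"
      using up low l0 unfolding lnW[symmetric] unfolding d_def[symmetric] l_def[symmetric]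
      by (simp add: abs_le_iff algebra_simps)
  qed
  then show ?thesis using meas B1(1) B2(1) by (intro bexI[of _ "B1 \<union> B2"]) auto
qed

end

section \<open>The real and complex Gaussian ensembles\<close>

lemma std_normal_density_le_1: "std_normal_density x \<le> 1"
proof -
  have "1 \<le> sqrt (2 * pi)" using pi_ge_two by simp
  then have "1 / sqrt (2 * pi) \<le> 1" by simp
  then have "1 / sqrt (2 * pi) * exp (- x\<^sup>2 / 2) \<le> 1 * 1" by (intro mult_mono) simp_all
  then show ?thesis by (simp add: std_normal_density_def)
qed

lemma real_gaussian_kernel_law: "gaussian_kernel_law real_gaussian"
proof -
  interpret prob_space real_gaussian by (rule prob_space_real_gaussian)
  have i: "integrable lborel (\<lambda>x. std_normal_density x *\<^sub>R complex_of_real x)"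
      "(\<integral>x. std_normal_density x *\<^sub>R complex_of_real x \<partial>lborel) = 0"
      "(\<integral>x. std_normal_density x * x \<partial>lborel) = 0"
  proof -
    have odd: "has_bochner_integral lborel (\<lambda>x. std_normal_density x * x) 0"
      using std_normal_moment_odd[of 0] by simp
    from odd have "has_bochner_integral lborel (\<lambda>x. complex_of_real (std_normal_density x * x)) (complex_of_real 0)"
      by (rule has_bochner_integral_of_real)
    then show "integrable lborel (\<lambda>x. std_normal_density x *\<^sub>R complex_of_real x)"
      "(\<integral>x. std_normal_density x *\<^sub>R complex_of_real x \<partial>lborel) = 0"
      by (simp_all add: has_bochner_integral_iff scaleR_conv_of_real)
    from odd show "(\<integral>x. std_normal_density x * x \<partial>lborel) = 0"
      by (simp only: has_bochner_integral_iff)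
  qed
  have s: "integrable lborel (\<lambda>x. std_normal_density x * x\<^sup>2)" "(\<integral>x. std_normal_density x * x\<^sup>2 \<partial>lborel) = 1"
    using std_normal_moment_even[of 1] by (simp_all add: has_bochner_integral_iff numeral_2_eq_2)
  show ?thesis
  proof
    show "sets real_gaussian = sets borel" by simp
    show "integrable real_gaussian (\<lambda>z. z)" "(\<integral>z. z \<partial>real_gaussian) = 0"
      using i by (simp_all add: real_gaussian_def integrable_distr_eq integrable_density integral_distr integral_density)
    show "integrable real_gaussian (\<lambda>z. (cmod z)\<^sup>2)" "(\<integral>z. (cmod z)\<^sup>2 \<partial>real_gaussian) = 1"
      using s by (simp_all add: real_gaussian_def integrable_distr_eq integrable_density integral_distr integral_density)
  next
    fix a :: complex and r :: real assume "r > 0"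
    have "emeasure real_gaussian (cball a r) = (\<integral>\<^sup>+z. indicator (cball a r) z \<partial>real_gaussian)"
      by (rule nn_integral_indicator[symmetric]) simp
    also have "\<dots> = (\<integral>\<^sup>+x. ennreal (std_normal_density x) * indicator (cball a r) (complex_of_real x) \<partial>lborel)"
      by (intro nn_integral_real_gaussian borel_measurable_indicator) simp
    also have "\<dots> \<le> (\<integral>\<^sup>+x. indicator {Re a - r..Re a + r} x \<partial>lborel)"
    proof (intro nn_integral_mono)
      fix x
      have "\<bar>Re a - x\<bar> \<le> r" if "complex_of_real x \<in> cball a r"
        using that abs_Re_le_cmod[of "a - complex_of_real x"] by (simp add: dist_norm)
      then have "indicator (cball a r) (complex_of_real x) \<le> (indicator {Re a - r..Re a + r} x :: ennreal)"
        by (auto simp: indicator_def abs_le_iff)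
      then have "ennreal (std_normal_density x) * indicator (cball a r) (complex_of_real x) \<le> 1 * indicator {Re a - r..Re a + r} x"
        by (intro mult_mono) (simp_all add: std_normal_density_le_1 del: std_normal_density_def)
      then show "ennreal (std_normal_density x) * indicator (cball a r) (complex_of_real x) \<le> indicator {Re a - r..Re a + r} x" by simp
    qed
    also have "\<dots> = ennreal (2 * r)" using \<open>r > 0\<close> by simp
    finally show "emeasure real_gaussian (cball a r) \<le> ennreal (2 * r)" .
  qed (rule kernel_bound_real; assumption)
qed

lemma distr_lborel_uminus: "distr lborel borel uminus = (lborel :: complex measure)"
  using lborel_affine[of "-1" "0 :: complex"] by (simp add: density_1)

text \<open>The real and imaginary parts are independent centred Gaussians of variance \<open>1 / 2\<close>, which gives the second moment. The mean
  vanishes by the symmetry \<open>z \<mapsto> - z\<close>.\<close>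
lemma complex_gaussian_kernel_law: "gaussian_kernel_law complex_gaussian"
proof -
  interpret prob_space complex_gaussian by (rule prob_space_complex_gaussian)
  define p where "p = normal_density 0 (1 / sqrt 2)"
  have p: "p x = 1 / sqrt pi * exp (- x\<^sup>2)" for x
    by (simp add: p_def normal_density_def power_divide)
  have p0: "p x \<ge> 0" for x by (simp add: p_def)
  have [measurable]: "p \<in> borel_measurable borel" by (simp add: p_def)
  have mass: "(\<integral>\<^sup>+x. ennreal (p x) \<partial>lborel) = 1"
    using prob_space.emeasure_space_1[OF prob_space_normal_density[of "1 / sqrt 2" 0]] by (simp add: emeasure_density p_def)
  have var: "(\<integral>\<^sup>+x. ennreal (p x * x\<^sup>2) \<partial>lborel) = ennreal (1 / 2)"
  proof -
    have "has_bochner_integral lborel (\<lambda>x. p x * x\<^sup>2) (1 / 2)"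
      using normal_moment_even[of "1 / sqrt 2" 0 1] by (simp add: p_def power_divide numeral_2_eq_2)
    then have int: "integrable lborel (\<lambda>x. p x * x\<^sup>2)" and val: "(\<integral>x. p x * x\<^sup>2 \<partial>lborel) = 1 / 2"
      by (simp_all only: has_bochner_integral_iff)
    show ?thesis
      unfolding val[symmetric] using p0 by (intro nn_integral_eq_integral int) simp
  qed
  have sq: "(\<integral>\<^sup>+z. ennreal ((cmod z)\<^sup>2) \<partial>complex_gaussian) = 1"
  proof -
    have e: "ennreal (1 / pi * exp (- (cmod (Complex x y))\<^sup>2)) * ennreal ((cmod (Complex x y))\<^sup>2)
       = ennreal (p x * x\<^sup>2) * ennreal (p y) + ennreal (p x) * ennreal (p y * y\<^sup>2)" for x y
    proof -
      have "sqrt pi * sqrt pi = pi" by simp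
      then have "p x * p y = 1 / pi * exp (- (cmod (Complex x y))\<^sup>2)"
        by (simp add: p cmod_power2 exp_add[symmetric] exp_diff exp_minus field_simps)
      then have "1 / pi * exp (- (cmod (Complex x y))\<^sup>2) * (cmod (Complex x y))\<^sup>2 = (p x * p y) * (x\<^sup>2 + y\<^sup>2)"
        by (simp add: cmod_power2)
      also have "\<dots> = p x * x\<^sup>2 * p y + p x * (p y * y\<^sup>2)" by (simp add: algebra_simps)
      finally have "1 / pi * exp (- (cmod (Complex x y))\<^sup>2) * (cmod (Complex x y))\<^sup>2 = p x * x\<^sup>2 * p y + p x * (p y * y\<^sup>2)" .
      then show ?thesis
        by (simp add: ennreal_mult[symmetric] ennreal_plus[symmetric] p0 del: ennreal_plus)
    qed
    have "(\<integral>\<^sup>+z. ennreal ((cmod z)\<^sup>2) \<partial>complex_gaussian)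
      = (\<integral>\<^sup>+x. \<integral>\<^sup>+y. ennreal (p x * x\<^sup>2) * ennreal (p y) + ennreal (p x) * ennreal (p y * y\<^sup>2) \<partial>lborel \<partial>lborel)"
      unfolding e[symmetric] by (subst nn_integral_complex_gaussian, simp, subst nn_integral_lborel_complex) simp_all
    also have "\<dots> = ennreal (1 / 2) + ennreal (1 / 2)"
      by (simp add: nn_integral_add nn_integral_cmult nn_integral_multc mass var)
    also have "\<dots> = 1" by (subst ennreal_plus[symmetric]) simp_all
    finally show ?thesis .
  qed
  have int_sq: "integrable complex_gaussian (\<lambda>z. (cmod z)\<^sup>2)"
    by (rule integrableI_nn_integral_finite[where x = 1]) (simp_all add: sq)
  have int_id: "integrable complex_gaussian (\<lambda>z. z)"
  proof (rule Bochner_Integration.integrable_bound)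
    show "integrable complex_gaussian (\<lambda>z. 1 + (cmod z)\<^sup>2)" using int_sq by simp
    show "AE z in complex_gaussian. norm z \<le> norm (1 + (cmod z)\<^sup>2)"
    proof (intro AE_I2)
      fix z :: complex
      have "2 * cmod z \<le> 1 + (cmod z)\<^sup>2" using sum_squares_bound[of 1 "cmod z"] by simp
      then have "cmod z \<le> 1 + (cmod z)\<^sup>2" using norm_ge_zero[of z] by linarith
      then show "norm z \<le> norm (1 + (cmod z)\<^sup>2)" by simp
    qed
  qed simp
  show ?thesis
  proof
    show "sets complex_gaussian = sets borel" by simp
    show "integrable complex_gaussian (\<lambda>z. z)" by (rule int_id)
    show "integrable complex_gaussian (\<lambda>z. (cmod z)\<^sup>2)" by (rule int_sq)
    show "(\<integral>z. (cmod z)\<^sup>2 \<partial>complex_gaussian) = 1"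
      using sq by (subst integral_eq_nn_integral) simp_all
    have "(\<integral>z. z \<partial>complex_gaussian) = (\<integral>z. (1 / pi * exp (- (cmod z)\<^sup>2)) *\<^sub>R z \<partial>lborel)"
      unfolding complex_gaussian_def by (rule integral_density) simp_all
    also have "\<dots> = (\<integral>z. (1 / pi * exp (- (cmod z)\<^sup>2)) *\<^sub>R z \<partial>distr lborel borel uminus)"
      by (simp only: distr_lborel_uminus)
    also have "\<dots> = (\<integral>z. (1 / pi * exp (- (cmod (- z))\<^sup>2)) *\<^sub>R (- z) \<partial>lborel)"
      by (rule integral_distr) simp_all
    also have "\<dots> = - (\<integral>z. (1 / pi * exp (- (cmod z)\<^sup>2)) *\<^sub>R z \<partial>lborel)" by simp
    also have "(\<integral>z. (1 / pi * exp (- (cmod z)\<^sup>2)) *\<^sub>R z \<partial>lborel) = (\<integral>z. z \<partial>complex_gaussian)"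
      unfolding complex_gaussian_def by (rule integral_density[symmetric]) simp_all
    finally show "(\<integral>z. z \<partial>complex_gaussian) = 0" by simp
  next
    fix a :: complex and r :: real assume r: "r > 0"
    show "emeasure complex_gaussian (cball a r) \<le> ennreal (2 * r)"
    proof (cases "r \<le> 1")
      case True
      have "emeasure complex_gaussian (cball a r) = (\<integral>\<^sup>+z. indicator (cball a r) z \<partial>complex_gaussian)"
        by (rule nn_integral_indicator[symmetric]) simp
      also have "\<dots> = (\<integral>\<^sup>+z. ennreal (1 / pi * exp (- (cmod z)\<^sup>2)) * indicator (cball a r) z \<partial>lborel)"
        by (intro nn_integral_complex_gaussian borel_measurable_indicator) simp
      also have "\<dots> \<le> (\<integral>\<^sup>+z. ennreal (1 / pi) * indicator (cball a r) z \<partial>lborel)"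
        by (intro nn_integral_mono mult_right_mono ennreal_leI) (simp_all add: divide_right_mono)
      also have "\<dots> = ennreal (1 / pi) * emeasure lborel (cball a r)"
        by (rule nn_integral_cmult_indicator) simp
      also have "\<dots> = ennreal (r\<^sup>2)"
        using r by (simp add: emeasure_cball unit_ball_vol_2 ennreal_mult[symmetric])
      also have "\<dots> \<le> ennreal (2 * r)"
        using r True by (intro ennreal_leI) (simp add: power2_eq_square mult_right_mono)
      finally show ?thesis .
    next
      case False
      have "emeasure complex_gaussian (cball a r) \<le> 1" by (rule emeasure_le_1)
      also have "(1 :: ennreal) \<le> ennreal (2 * r)" using False by simp
      finally show ?thesis .
    qed
  qed (rule kernel_bound_complex; assumption)
qed

text \<open>The joint law of the entries is a product measure, so events for the random matrix can be pulled back from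
  arrays of entries.\<close>
lemma iid_matrix_shifted:
  assumes iid: "iid_matrix \<mu> n P M" and n: "n \<ge> 1" and sets: "sets \<mu> = sets borel"
    and B: "B \<in> sets (PiM ({..<n} \<times> {..<n}) (\<lambda>_. \<mu>))"
  obtains E where "E \<in> sets P" "measure P E = measure (PiM ({..<n} \<times> {..<n}) (\<lambda>_. \<mu>)) B"
    "\<And>\<omega>. \<omega> \<in> space P - E \<Longrightarrow> \<exists>x\<in>space (PiM ({..<n} \<times> {..<n}) (\<lambda>_. \<mu>)) - B. \<forall>w. M \<omega> - w \<cdot>\<^sub>m 1\<^sub>m n = shifted n w x"
proof -
  let ?I = "{..<n} \<times> {..<n}"
  interpret P: prob_space P using iid by (simp add: iid_matrix_def)
  define X where "X = (\<lambda>(i, j) \<omega>. M \<omega> $$ (i, j))"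
  have carrier: "M \<omega> \<in> carrier_mat n n" if "\<omega> \<in> space P" for \<omega>
    using iid that by (simp add: iid_matrix_def)
  have ind: "P.indep_vars (\<lambda>_. borel) X ?I" using iid by (simp add: iid_matrix_def X_def)
  then have rv: "X k \<in> borel_measurable P" if "k \<in> ?I" for k
    using that unfolding P.indep_vars_def by blast
  have I: "?I \<noteq> {}" using n by (auto simp: lessThan_empty_iff)
  have law: "distr P borel (X k) = \<mu>" if "k \<in> ?I" for k
    using iid that by (auto simp: iid_matrix_def X_def)
  define f where "f = (\<lambda>\<omega>. \<lambda>k\<in>?I. X k \<omega>)"
  have sets_PiM: "sets (PiM ?I (\<lambda>_. borel :: complex measure)) = sets (PiM ?I (\<lambda>_. \<mu>))"
    by (intro sets_PiM_cong refl) (simp add: sets)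
  have "distr P (PiM ?I (\<lambda>_. borel)) f = (\<Pi>\<^sub>M k\<in>?I. distr P borel (X k))"
    using P.indep_vars_iff_distr_eq_PiM'[OF I rv] ind by (simp add: f_def)
  also have "\<dots> = PiM ?I (\<lambda>_. \<mu>)" by (intro PiM_cong refl law)
  finally have distr: "distr P (PiM ?I (\<lambda>_. borel)) f = PiM ?I (\<lambda>_. \<mu>)" .
  have f: "f \<in> P \<rightarrow>\<^sub>M PiM ?I (\<lambda>_. borel)"
    unfolding f_def by (intro measurable_restrict rv)
  define E where "E = f -` B \<inter> space P"
  have B': "B \<in> sets (PiM ?I (\<lambda>_. borel))" using B sets_PiM by simp
  show thesis
  proof
    show "E \<in> sets P" unfolding E_def by (rule measurable_sets[OF f B'])
    show "measure P E = measure (PiM ?I (\<lambda>_. \<mu>)) B"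
      unfolding distr[symmetric] E_def by (rule measure_distr[OF f B', symmetric])
    fix \<omega> assume \<omega>: "\<omega> \<in> space P - E"
    show "\<exists>x\<in>space (PiM ?I (\<lambda>_. \<mu>)) - B. \<forall>w. M \<omega> - w \<cdot>\<^sub>m 1\<^sub>m n = shifted n w x"
    proof (intro bexI allI)
      show "M \<omega> - w \<cdot>\<^sub>m 1\<^sub>m n = shifted n w (f \<omega>)" for w
        using carrier[of \<omega>] \<omega> by (intro eq_matI) (auto simp: shifted_def f_def X_def)
      have "f \<omega> \<in> space (PiM ?I (\<lambda>_. borel))" using measurable_space[OF f] \<omega> by blast
      then have "f \<omega> \<in> space (PiM ?I (\<lambda>_. \<mu>))" using sets_eq_imp_space_eq[OF sets_PiM] by simp
      then show "f \<omega> \<in> space (PiM ?I (\<lambda>_. \<mu>)) - B" using \<omega> by (auto simp: E_def)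
    qed
  qed
qed

text \<open>Uniformity holds because the error bound depends on \<open>z\<close> only through \<open>R\<close>.\<close>
lemma (in gaussian_kernel_law) log_det_concentrates_uniformly:
  fixes P :: "nat \<Rightarrow> 'a measure" and M :: "nat \<Rightarrow> 'a \<Rightarrow> complex mat" and S :: "complex set" and c :: "complex \<Rightarrow> real" and R :: real
  assumes iid: "\<And>n. n \<ge> 1 \<Longrightarrow> iid_matrix \<mu> n (P n) (M n)"
    and c: "\<And>z t. z \<in> S \<Longrightarrow> 0 \<le> t \<Longrightarrow> t \<le> 1 \<Longrightarrow> t * exp (- (cmod z)\<^sup>2 * t) \<le> c z"
      "\<And>z. z \<in> S \<Longrightarrow> c z > 0" "\<And>z. z \<in> S \<Longrightarrow> 1 / (c z * exp 1) \<le> R" "R \<ge> 1"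
    and second: "\<And>n z. z \<in> S \<Longrightarrow> n \<ge> 1 \<Longrightarrow> fact n * (\<Sum>k\<le>n. (real n * (cmod z)\<^sup>2) ^ k / fact k)
      \<le> exp 1 * real n * (real n / (c z * exp 1)) ^ n"
    and m: "\<And>n z. z \<in> S \<Longrightarrow> m n z = 1 / 2 * (real n * ln (real n) - real n - real n * ln (c z))"
  shows "concentrates_uniformly_on S P
    (\<lambda>n z \<omega>. ln_cmod (Determinant.det (M n \<omega> - (z * complex_of_real (sqrt (real n))) \<cdot>\<^sub>m 1\<^sub>m n))) m"
  unfolding concentrates_uniformly_on_def
proof (intro allI impI)
  let ?dev = "\<lambda>n z \<omega>. \<bar>ln_cmod (Determinant.det (M n \<omega> - (z * complex_of_real (sqrt (real n))) \<cdot>\<^sub>m 1\<^sub>m n)) - ereal (m n z)\<bar>"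
  fix \<epsilon> A :: real assume \<epsilon>: "\<epsilon> > 0" and A: "A > 0"
  define K where "K = 3 + 2 * ln R + (6 * A + 20) / \<epsilon>"
  define L where "L = 4 + 5 powr A"
  show "\<exists>K L :: real. \<forall>n\<ge>1. \<forall>z\<in>S. \<exists>E\<in>sets (P n). measure (P n) E \<le> L * real n powr (- A) \<and>
     (\<forall>\<omega>\<in>space (P n) - E. ?dev n z \<omega> \<le> ereal (K * real n powr \<epsilon>))"
  proof (rule exI[of _ K], rule exI[of _ L], intro allI ballI impI)
    fix n :: nat and z assume n: "n \<ge> 1" and z: "z \<in> S"
    interpret P: prob_space "P n" using iid[OF n] by (simp add: iid_matrix_def)
    show "\<exists>E\<in>sets (P n). measure (P n) E \<le> L * real n powr (- A) \<and>
     (\<forall>\<omega>\<in>space (P n) - E. ?dev n z \<omega> \<le> ereal (K * real n powr \<epsilon>))"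
    proof (cases "n < 5")
      case True
      \<comment> \<open>For these finitely many \<open>n\<close> the constant \<open>L\<close> allows the whole space as exceptional event.\<close>
      have "1 = real n powr A * real n powr (- A)" using n by (simp add: powr_add[symmetric])
      also have "\<dots> \<le> L * real n powr (- A)"
      proof (intro mult_right_mono)
        have "real n powr A \<le> 5 powr A" using True A by (intro powr_mono2) simp_all
        then show "real n powr A \<le> L" by (simp add: L_def)
      qed simp
      finally show ?thesis by (intro bexI[of _ "space (P n)"]) (simp_all add: P.prob_space)
    next
      case False
      define w where "w = z * complex_of_real (sqrt (real n))"
      have w: "(cmod w)\<^sup>2 = real n * (cmod z)\<^sup>2" by (simp add: w_def norm_mult power_mult_distrib)
      obtain B where B: "B \<in> sets (law n)" "measure (law n) B \<le> 4 * real n powr (- A)"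
        "\<And>x. x \<in> space (law n) - B \<Longrightarrow> Determinant.det (shifted n w x) \<noteq> 0 \<and>
          \<bar>ln (cmod (Determinant.det (shifted n w x))) - 1 / 2 * (real n * ln (real n) - real n - real n * ln (c z))\<bar>
          \<le> 3 + 2 * ln R + (6 * A + 20) * ln (real n)"
        using log_det_concentration[OF _ w _ A c(1)[OF z] c(2)[OF z] second[OF z n] c(3)[OF z] c(4)] False by force
      obtain E where E: "E \<in> sets (P n)" "measure (P n) E = measure (law n) B"
        "\<And>\<omega>. \<omega> \<in> space (P n) - E \<Longrightarrow> \<exists>x\<in>space (law n) - B. \<forall>w. M n \<omega> - w \<cdot>\<^sub>m 1\<^sub>m n = shifted n w x"
        using iid_matrix_shifted[OF iid[OF n] n sets_eq B(1)] by metis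
      have small: "3 + 2 * ln R + (6 * A + 20) * ln (real n) \<le> K * real n powr \<epsilon>"
      proof -
        have "1 \<le> real n powr \<epsilon>" using n \<epsilon> by (intro ge_one_powr_ge_zero) simp_all
        moreover have "0 \<le> 3 + 2 * ln R" using c(4) by simp
        ultimately have "(3 + 2 * ln R) * 1 \<le> (3 + 2 * ln R) * real n powr \<epsilon>" by (intro mult_left_mono)
        moreover have "(6 * A + 20) * ln (real n) \<le> (6 * A + 20) * (real n powr \<epsilon> / \<epsilon>)"
          using n A \<epsilon> by (intro mult_left_mono ln_powr_bound) simp_all
        ultimately show ?thesis by (simp add: K_def algebra_simps add_divide_distrib)
      qed
      have "measure (P n) E \<le> L * real n powr (- A)"
        using B(2) E(2) by (rule_tac order_trans[of _ "4 * real n powr (- A)"]) (simp_all add: L_def mult_right_mono)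
      moreover have "\<bar>ln_cmod (Determinant.det (M n \<omega> - w \<cdot>\<^sub>m 1\<^sub>m n)) - ereal (m n z)\<bar> \<le> ereal (K * real n powr \<epsilon>)"
        if \<omega>: "\<omega> \<in> space (P n) - E" for \<omega>
      proof -
        obtain x where x: "x \<in> space (law n) - B" "M n \<omega> - w \<cdot>\<^sub>m 1\<^sub>m n = shifted n w x"
          using E(3)[OF \<omega>] by blast
        show ?thesis using B(3)[OF x(1)] small unfolding x(2) m[OF z, symmetric] by (simp add: ln_cmod_def)
      qed
      ultimately show ?thesis using E(1) unfolding w_def by blast
    qed
  qed
qed

text \<open>For \<open>\<rho> \<ge> 1\<close> this is the maximum over \<open>[0, 1]\<close>, attained at \<open>t = 1 / \<rho>\<close>.\<close>
lemma mult_exp_le_inverse: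
  fixes \<rho> t :: real
  assumes "\<rho> > 0"
  shows "t * exp (- \<rho> * t) \<le> 1 / (exp 1 * \<rho>)"
proof -
  have "\<rho> * t \<le> exp (\<rho> * t - 1)" using exp_ge_add_one_self[of "\<rho> * t - 1"] by simp
  then show ?thesis using assms by (simp add: exp_diff exp_minus field_simps)
qed

text \<open>For \<open>\<rho> \<le> 1\<close> the function \<open>t exp (- \<rho> t)\<close> increases on \<open>[0, 1]\<close>.\<close>
lemma mult_exp_le_endpoint:
  fixes \<rho> t :: real
  assumes "0 \<le> \<rho>" "\<rho> \<le> 1" "0 \<le> t" "t \<le> 1"
  shows "t * exp (- \<rho> * t) \<le> exp (- \<rho>)"
proof -
  have "t \<le> exp (t - 1)" using exp_ge_add_one_self[of "t - 1"] by simp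
  also have "\<dots> \<le> exp (\<rho> * (t - 1))" using assms mult_right_mono_neg[of \<rho> 1 "t - 1"] by simp
  finally have "t * exp (- \<rho> * t) \<le> exp (\<rho> * (t - 1)) * exp (- \<rho> * t)" by (intro mult_right_mono) simp_all
  also have "\<dots> = exp (- \<rho>)" by (simp add: exp_add[symmetric] algebra_simps)
  finally show ?thesis .
qed

theorem theorem33:
  fixes P :: "nat \<Rightarrow> 'a measure" and M :: "nat \<Rightarrow> 'a \<Rightarrow> complex mat" and C :: real
  assumes "(\<forall>n\<ge>1. real_gaussian_ensemble n (P n) (M n)) \<or>
           (\<forall>n\<ge>1. complex_gaussian_ensemble n (P n) (M n))"
    and "C > 0"
  shows "concentrates_uniformly_on {z \<in> ball 0 C. cmod z \<le> 1} P
           (\<lambda>n z \<omega>. ln_cmod (Determinant.det (M n \<omega> - (z * complex_of_real (sqrt (real n))) \<cdot>\<^sub>m 1\<^sub>m n)))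
           (\<lambda>n z. 1 / 2 * real n * ln (real n) + 1 / 2 * real n * ((cmod z)\<^sup>2 - 1))
       \<and> concentrates_uniformly_on {z \<in> ball 0 C. cmod z \<ge> 1} P
           (\<lambda>n z \<omega>. ln_cmod (Determinant.det (M n \<omega> - (z * complex_of_real (sqrt (real n))) \<cdot>\<^sub>m 1\<^sub>m n)))
           (\<lambda>n z. 1 / 2 * real n * ln (real n) + real n * ln (cmod z))"
proof -
  obtain \<mu> where law: "gaussian_kernel_law \<mu>" and iid: "\<And>n. n \<ge> 1 \<Longrightarrow> iid_matrix \<mu> n (P n) (M n)"
    using assms(1) real_gaussian_kernel_law complex_gaussian_kernel_law by blast
  interpret gaussian_kernel_law \<mu> by (rule law)
  show ?thesis
  proof (rule conjI, goal_cases)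
    case 1
    show ?case
    proof (rule log_det_concentrates_uniformly[OF iid, where c = "\<lambda>z. exp (- (cmod z)\<^sup>2)" and R = 1])
      fix z :: complex and t :: real and n :: nat assume "z \<in> {z \<in> ball 0 C. cmod z \<le> 1}"
      then have z: "(cmod z)\<^sup>2 \<le> 1" by (simp add: power_le_one)
      show "t * exp (- (cmod z)\<^sup>2 * t) \<le> exp (- (cmod z)\<^sup>2)" if "0 \<le> t" "t \<le> 1"
        using z that by (intro mult_exp_le_endpoint) simp_all
      show "1 / (exp (- (cmod z)\<^sup>2) * exp 1) \<le> 1"
        using z by (simp add: exp_add[symmetric])
      show "fact n * (\<Sum>k\<le>n. (real n * (cmod z)\<^sup>2) ^ k / fact k) \<le> exp 1 * real n * (real n / (exp (- (cmod z)\<^sup>2) * exp 1)) ^ n"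
        if "n \<ge> 1" using that by (intro second_moment_bound_inside) simp_all
    qed (simp_all add: algebra_simps)
  next
    case 2
    show ?case
    proof (rule log_det_concentrates_uniformly[OF iid, where c = "\<lambda>z. 1 / (exp 1 * (cmod z)\<^sup>2)" and R = "1 + C\<^sup>2"])
      fix z :: complex and t :: real and n :: nat assume z: "z \<in> {z \<in> ball 0 C. cmod z \<ge> 1}"
      then have z1: "1 \<le> (cmod z)\<^sup>2" and zC: "(cmod z)\<^sup>2 \<le> C\<^sup>2" by (simp_all add: power_mono one_le_power)
      show "t * exp (- (cmod z)\<^sup>2 * t) \<le> 1 / (exp 1 * (cmod z)\<^sup>2)" if "0 \<le> t" "t \<le> 1"
        using z by (intro mult_exp_le_inverse) auto
      show "1 / (exp 1 * (cmod z)\<^sup>2) > 0"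
      proof (intro divide_pos_pos mult_pos_pos)
        show "(cmod z)\<^sup>2 > 0" using z1 by linarith
      qed simp_all
      show "1 / (1 / (exp 1 * (cmod z)\<^sup>2) * exp 1) \<le> 1 + C\<^sup>2" using zC by simp
      show "fact n * (\<Sum>k\<le>n. (real n * (cmod z)\<^sup>2) ^ k / fact k) \<le> exp 1 * real n * (real n / (1 / (exp 1 * (cmod z)\<^sup>2) * exp 1)) ^ n"
        if "n \<ge> 1" using that z1 by (rule second_moment_bound_outside)
      have "cmod z > 0" using z by auto
      then have "ln (1 / (exp 1 * (cmod z)\<^sup>2)) = ln 1 - (ln (exp 1) + real 2 * ln (cmod z))"
        by (simp only: ln_divide_pos ln_mult_pos ln_realpow mult_pos_pos zero_less_power exp_gt_zero zero_less_one)
      then have ln_c: "ln (1 / (exp 1 * (cmod z)\<^sup>2)) = - 1 - 2 * ln (cmod z)" by simp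
      show "1 / 2 * real n * ln (real n) + real n * ln (cmod z)
          = 1 / 2 * (real n * ln (real n) - real n - real n * ln (1 / (exp 1 * (cmod z)\<^sup>2)))"
        unfolding ln_c by (simp add: algebra_simps)
    qed simp_all
  qed
qed

end
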